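(* Let $M$ be an $n$-dimensional smooth manifold and $k\ge 1$. Let $F\in C^\infty(T^k_0M)$ be a positive function that satisfies the Zermelo conditions $\mathbb{C}_1(F)=F$ and $\mathbb{C}_\alpha(F)=0$ for all $\alpha\in\{2,\dots,k\}$, and let $S\in\mathfrak{X}(T^{2k-1}_0M)$ be a semispray that is a solution of the equation $\mathcal{L}_S\theta_F=dF$. Then: (i) The Poincar\'e-Cartan $1$-form $\theta_F$ is homogeneous: $i_{\mathbb{C}_\alpha}\theta_F=0$ and $\mathcal{L}_{\mathbb{C}_\alpha}\theta_F=0$ for all $\alpha\in\{1,\dots,2k-1\}$. (ii) $i_S\theta_F=F$, $\mathcal{E}_F=0$, and $i_{\mathbb{C}_\alpha}\omega_F=0$ for all $\alpha\in\{1,\dots,2k-1\}$. (iii) $F$ is a Finsler function of order $k$ if and only if $\operatorname{rank}(d\theta_F)=2k(n-1)$.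
   Context: All objects are smooth. $M$ is a real $n$-dimensional smooth manifold. For $r\ge 1$, $T^rM=J^r_0M$ is the bundle of $r$-jets at $0$ of curves from neighbourhoods of $0\in\mathbb{R}$ to $M$, with induced local coordinates $(x^i,y^{(1)i},\dots,y^{(r)i})$, where $y^{(\alpha)i}(j^r_0c)=\frac{1}{\alpha!}\frac{d^\alpha (x^i\circ c)}{dt^\alpha}\big|_{t=0}$, and $y^{(0)i}:=x^i$. $T^r_0M=\{y^{(1)}\ne 0\}\subset T^rM$. Functions on $T^k_0M$ are identified with their pull-backs to $T^{2k-1}_0M$. Tangent structure on $T^rM$: $J=\sum_{\alpha=1}^{r}\frac{\partial}{\partial y^{(\alpha)i}}\otimes dy^{(\alpha-1)i}$; $J^\alpha$ is its $\alpha$-fold composition. Liouville vector fields: $\mathbb{C}_\alpha=\sum_{\beta=1}^{r+1-\alpha}\beta\, y^{(\beta)i}\frac{\partial}{\partial y^{(\alpha+\beta-1)i}}$, $\alpha\in\{1,\dots,r\}$. (In the Zermelo conditions these are taken on $T^k_0M$; in the rest of the statement on $T^{2k-1}_0M$.) For a function $f$, $d_{J^\alpha}f=df\circ J^\alpha$. A semispray of order $2k-1$ on $T^{2k-1}_0M$ is a vector field $S$ with $JS=\mathbb{C}_1$. The Poincar\'e-Cartan forms and the energy of $F$ are the following objects on $T^{2k-1}_0M$, where $S'$ is any semispray of order $2k-1$ (the result does not depend on the choice): $$\theta_F=\sum_{\alpha=1}^k\frac{(-1)^{\alpha-1}}{\alpha!}\mathcal{L}_{S'}^{\alpha-1}d_{J^\alpha}F,\quad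 \omega_F=-d\theta_F,\quad \mathcal{E}_F=\sum_{\alpha=1}^k\frac{(-1)^{\alpha-1}}{\alpha!}\mathcal{L}_{S'}^{\alpha-1}\mathbb{C}_\alpha(F)-F .$$ A positive function $F\in C^\infty(T^k_0M)$ is a Finsler function of order $k$ if it satisfies the Zermelo conditions and the tensor with components $h_{ij}=F^{2k-1}\frac{\partial^2F}{\partial y^{(k)i}\partial y^{(k)j}}$ has rank $n-1$ on $T^k_0M$. *)

theory Defs
  imports "HOL-Analysis.Analysis"
begin

section \<open>Smooth functions of finitely many real coordinates\<close>

text \<open>Coordinate spaces are function types \<open>'c \<Rightarrow> real\<close> with their product topology. Only the
  coordinates in a finite set \<open>D\<close> are allowed to vary, so that \<open>\<real>\<^sup>D\<close> is the set of all points with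
  some fixed values (below: 0) outside \<open>D\<close>. This keeps the order of a jet bundle a term.\<close>

definition pd :: "'c \<Rightarrow> (('c \<Rightarrow> real) \<Rightarrow> real) \<Rightarrow> ('c \<Rightarrow> real) \<Rightarrow> real" where
  "pd c f z = deriv (\<lambda>s. f (z(c := s))) (z c)"

text \<open>\<open>W\<close> is meant to be relatively open in \<open>\<real>\<^sup>D\<close>: all iterated partial derivatives exist and are
  continuous on \<open>W\<close>.\<close>

definition smooth_fun :: "'c set \<Rightarrow> ('c \<Rightarrow> real) set \<Rightarrow> (('c \<Rightarrow> real) \<Rightarrow> real) \<Rightarrow> bool" where
  "smooth_fun D W f \<longleftrightarrow>
     (\<forall>cs. set cs \<subseteq> D \<longrightarrow>
        continuous_on W (foldr pd cs f) \<and>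
        (\<forall>z\<in>W. \<forall>c\<in>D. (\<lambda>s. foldr pd cs f (z(c := s))) differentiable (at (z c))))"


section \<open>Smooth manifolds\<close>

text \<open>A chart \<open>(U, \<phi>)\<close>; the number \<open>\<phi> p i\<close> is the coordinate \<open>x\<^sup>i\<close> of \<open>p\<close>. Values of \<open>\<phi>\<close> outside
  \<open>U\<close> are irrelevant. The manifold is the whole type \<open>'a\<close>, its dimension is \<open>CARD('n)\<close>.\<close>

type_synonym ('a, 'n) chart = "'a set \<times> ('a \<Rightarrow> 'n \<Rightarrow> real)"

definition smooth_atlas ::
  "('a::{t2_space, second_countable_topology}, 'n::finite) chart set \<Rightarrow> bool" where
  "smooth_atlas A \<longleftrightarrow>
     (\<Union>(fst ` A) = UNIV) \<and>
     (\<forall>(U, \<phi>)\<in>A. open U \<and> open (\<phi> ` U) \<and> homeomorphism U (\<phi> ` U) \<phi> (inv_into U \<phi>)) \<and>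
     (\<forall>(U, \<phi>)\<in>A. \<forall>(V, \<psi>)\<in>A. \<forall>i.
        smooth_fun UNIV (\<phi> ` (U \<inter> V)) (\<lambda>x. \<psi> (inv_into U \<phi> x) i))"


section \<open>Jets of curves\<close>

text \<open>Curves are total functions; only their germ at 0 matters, and it has to be smooth. A jet is the
  set of all curves representing it.\<close>

definition curves :: "('a, 'n) chart set \<Rightarrow> (real \<Rightarrow> 'a) set" where
  "curves A =
     {c. \<forall>(U, \<phi>)\<in>A. c 0 \<in> U \<longrightarrow>
        (\<exists>e>0. \<forall>t. \<bar>t\<bar> < e \<longrightarrow> c t \<in> U \<and>
           (\<forall>m i. ((deriv ^^ m) (\<lambda>s. \<phi> (c s) i)) differentiable (at t)))}"

type_synonym 'a jet = "(real \<Rightarrow> 'a) set"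

definition jet_of :: "('a, 'n) chart set \<Rightarrow> nat \<Rightarrow> (real \<Rightarrow> 'a) \<Rightarrow> 'a jet" where
  "jet_of A r c =
     {c' \<in> curves A. c' 0 = c 0 \<and>
        (\<forall>(U, \<phi>)\<in>A. c 0 \<in> U \<longrightarrow>
           (\<forall>\<alpha>\<le>r. \<forall>i. (deriv ^^ \<alpha>) (\<lambda>t. \<phi> (c' t) i) 0 = (deriv ^^ \<alpha>) (\<lambda>t. \<phi> (c t) i) 0))}"

definition TM :: "('a, 'n) chart set \<Rightarrow> nat \<Rightarrow> 'a jet set" where
  "TM A r = jet_of A r ` curves A"

definition repr :: "'a jet \<Rightarrow> real \<Rightarrow> 'a" where
  "repr p = (SOME c. c \<in> p)"

definition base :: "'a jet \<Rightarrow> 'a" where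
  "base p = repr p 0"

definition ycoord :: "('a \<Rightarrow> 'n \<Rightarrow> real) \<Rightarrow> nat \<Rightarrow> 'n \<Rightarrow> 'a jet \<Rightarrow> real" where
  "ycoord \<phi> \<alpha> i p = (deriv ^^ \<alpha>) (\<lambda>t. \<phi> (repr p t) i) 0 / fact \<alpha>"

definition T0 :: "('a, 'n) chart set \<Rightarrow> nat \<Rightarrow> 'a jet set" where
  "T0 A r = {p \<in> TM A r. \<forall>(U, \<phi>)\<in>A. base p \<in> U \<longrightarrow> (\<exists>i. ycoord \<phi> 1 i p \<noteq> 0)}"

definition jet_proj :: "('a, 'n) chart set \<Rightarrow> nat \<Rightarrow> 'a jet \<Rightarrow> 'a jet" where
  "jet_proj A k p = jet_of A k (repr p)"

definition pull :: "('a, 'n) chart set \<Rightarrow> nat \<Rightarrow> ('a jet \<Rightarrow> real) \<Rightarrow> 'a jet \<Rightarrow> real" where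
  "pull A k F = (\<lambda>p. F (jet_proj A k p))"

text \<open>Induced charts: the coordinate with index \<open>(\<alpha>, i)\<close>, \<open>\<alpha> \<le> r\<close>, is \<open>y\<^sup>(\<^sup>\<alpha>\<^sup>)\<^sup>i\<close>.\<close>

type_synonym 'n pt = "nat \<times> 'n \<Rightarrow> real"

definition idx :: "nat \<Rightarrow> (nat \<times> 'n) set" where
  "idx r = {..r} \<times> UNIV"

definition icoord :: "nat \<Rightarrow> ('a, 'n) chart \<Rightarrow> 'a jet \<Rightarrow> 'n pt" where
  "icoord r ch p = (\<lambda>(\<alpha>, i). if \<alpha> \<le> r then ycoord (snd ch) \<alpha> i p else 0)"

definition jdom :: "('a, 'n) chart set \<Rightarrow> nat \<Rightarrow> ('a, 'n) chart \<Rightarrow> 'a jet set" where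
  "jdom A r ch = {p \<in> T0 A r. base p \<in> fst ch}"

definition jimg :: "('a, 'n) chart set \<Rightarrow> nat \<Rightarrow> ('a, 'n) chart \<Rightarrow> 'n pt set" where
  "jimg A r ch = icoord r ch ` jdom A r ch"

definition jinv :: "('a, 'n) chart set \<Rightarrow> nat \<Rightarrow> ('a, 'n) chart \<Rightarrow> 'n pt \<Rightarrow> 'a jet" where
  "jinv A r ch = inv_into (jdom A r ch) (icoord r ch)"

definition floc ::
  "('a, 'n) chart set \<Rightarrow> nat \<Rightarrow> ('a, 'n) chart \<Rightarrow> ('a jet \<Rightarrow> real) \<Rightarrow> 'n pt \<Rightarrow> real" where
  "floc A r ch f = (\<lambda>z. f (jinv A r ch z))"

definition smooth_T0 :: "('a, 'n) chart set \<Rightarrow> nat \<Rightarrow> ('a jet \<Rightarrow> real) \<Rightarrow> bool" where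
  "smooth_T0 A r f \<longleftrightarrow> (\<forall>ch\<in>A. smooth_fun (idx r) (jimg A r ch) (floc A r ch f))"

definition smooth_near :: "('a, 'n) chart set \<Rightarrow> nat \<Rightarrow> 'a jet \<Rightarrow> ('a jet \<Rightarrow> real) \<Rightarrow> bool" where
  "smooth_near A r p f \<longleftrightarrow>
     (\<forall>ch\<in>A. p \<in> jdom A r ch \<longrightarrow>
        (\<exists>G. open G \<and> icoord r ch p \<in> G \<and>
             smooth_fun (idx r) (G \<inter> jimg A r ch) (floc A r ch f)))"


section \<open>Vector fields\<close>

text \<open>Tangent vectors of \<open>T\<^sup>r\<^sub>0M\<close> at \<open>p\<close> are derivations at \<open>p\<close>, on functions that are smooth near \<open>p\<close>.
  Locality follows from the Leibniz rule, since the indicator function of a neighbourhood of \<open>p\<close> is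
  smooth near \<open>p\<close>.\<close>

definition tangent_at ::
  "('a, 'n) chart set \<Rightarrow> nat \<Rightarrow> 'a jet \<Rightarrow> (('a jet \<Rightarrow> real) \<Rightarrow> real) \<Rightarrow> bool" where
  "tangent_at A r p v \<longleftrightarrow>
     (\<forall>f g. smooth_near A r p f \<longrightarrow> smooth_near A r p g \<longrightarrow>
        (\<forall>a b. v (\<lambda>q. a * f q + b * g q) = a * v f + b * v g) \<and>
        v (\<lambda>q. f q * g q) = f p * v g + g p * v f)"

type_synonym 'a vfield = "'a jet \<Rightarrow> ('a jet \<Rightarrow> real) \<Rightarrow> real"

text \<open>The components of \<open>X\<close> in an induced chart are its values on the coordinate functions.\<close>

definition vloc ::
  "('a, 'n) chart set \<Rightarrow> nat \<Rightarrow> ('a, 'n) chart \<Rightarrow> 'a vfield \<Rightarrow> 'n pt \<Rightarrow> 'n pt" where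
  "vloc A r ch X z = (\<lambda>(\<alpha>, i). X (jinv A r ch z) (ycoord (snd ch) \<alpha> i))"

definition vector_field :: "('a, 'n) chart set \<Rightarrow> nat \<Rightarrow> 'a vfield \<Rightarrow> bool" where
  "vector_field A r X \<longleftrightarrow>
     (\<forall>p\<in>T0 A r. tangent_at A r p (X p)) \<and>
     (\<forall>ch\<in>A. \<forall>a\<in>idx r. smooth_fun (idx r) (jimg A r ch) (\<lambda>z. vloc A r ch X z a))"


section \<open>Tensor calculus in an induced chart\<close>

text \<open>Inside one induced chart of \<open>T\<^sup>r\<^sub>0M\<close>, vector fields and 1-forms are given by their components
  with indices in \<open>idx r\<close>, as functions of the coordinates. Components outside \<open>idx r\<close> have no
  meaning.\<close>

definition lie_fun :: "nat \<Rightarrow> ('n::finite pt \<Rightarrow> 'n pt) \<Rightarrow> ('n pt \<Rightarrow> real) \<Rightarrow> 'n pt \<Rightarrow> real" where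
  "lie_fun r X f z = (\<Sum>a\<in>idx r. X z a * pd a f z)"

definition lie_form ::
  "nat \<Rightarrow> ('n::finite pt \<Rightarrow> 'n pt) \<Rightarrow> ('n pt \<Rightarrow> 'n pt) \<Rightarrow> 'n pt \<Rightarrow> 'n pt" where
  "lie_form r X \<theta> z b =
     (\<Sum>a\<in>idx r. X z a * pd a (\<lambda>w. \<theta> w b) z + \<theta> z a * pd b (\<lambda>w. X w a) z)"

definition contr :: "nat \<Rightarrow> ('n::finite pt \<Rightarrow> 'n pt) \<Rightarrow> ('n pt \<Rightarrow> 'n pt) \<Rightarrow> 'n pt \<Rightarrow> real" where
  "contr r X \<theta> z = (\<Sum>a\<in>idx r. X z a * \<theta> z a)"

type_synonym 'n two_form = "'n pt \<Rightarrow> nat \<times> 'n \<Rightarrow> nat \<times> 'n \<Rightarrow> real"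

definition ext_d :: "('n pt \<Rightarrow> 'n pt) \<Rightarrow> 'n two_form" where
  "ext_d \<theta> z a b = pd a (\<lambda>w. \<theta> w b) z - pd b (\<lambda>w. \<theta> w a) z"

definition contr2 :: "nat \<Rightarrow> ('n::finite pt \<Rightarrow> 'n pt) \<Rightarrow> 'n two_form \<Rightarrow> 'n pt \<Rightarrow> 'n pt" where
  "contr2 r X \<omega> z b = (\<Sum>a\<in>idx r. X z a * \<omega> z a b)"

text \<open>Rank of the component matrix: the maximal number of linearly independent rows.\<close>

definition form_rank :: "nat \<Rightarrow> 'n::finite two_form \<Rightarrow> 'n pt \<Rightarrow> nat" where
  "form_rank r \<omega> z =
     Max {card R | R. R \<subseteq> idx r \<and>
       (\<forall>c. (\<forall>b\<in>idx r. (\<Sum>a\<in>R. c a * \<omega> z a b) = 0) \<longrightarrow> (\<forall>a\<in>R. c a = 0))}"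

text \<open>The tangent structure \<open>J\<close> acting on tangent vectors.\<close>

definition tangent_J :: "nat \<Rightarrow> 'n pt \<Rightarrow> 'n pt" where
  "tangent_J r v = (\<lambda>(\<gamma>, i). if 1 \<le> \<gamma> \<and> \<gamma> \<le> r then v (\<gamma> - 1, i) else 0)"

text \<open>\<open>df \<circ> J\<^sup>\<alpha>\<close>, evaluated at the coordinate vector fields.\<close>

definition d_J :: "nat \<Rightarrow> nat \<Rightarrow> ('n::finite pt \<Rightarrow> real) \<Rightarrow> 'n pt \<Rightarrow> 'n pt" where
  "d_J r \<alpha> f z b =
     (\<Sum>a\<in>idx r. pd a f z * ((tangent_J r ^^ \<alpha>) (\<lambda>a'. if a' = b then 1 else 0)) a)"

definition liouville :: "nat \<Rightarrow> nat \<Rightarrow> 'n pt \<Rightarrow> 'n pt" where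
  "liouville r \<alpha> z =
     (\<lambda>(\<gamma>, i). \<Sum>\<beta>=1..r + 1 - \<alpha>. if \<gamma> = \<alpha> + \<beta> - 1 then real \<beta> * z (\<beta>, i) else 0)"


section \<open>Semisprays, Poincare-Cartan forms and Finsler functions\<close>

definition semispray :: "('a, 'n::finite) chart set \<Rightarrow> nat \<Rightarrow> 'a vfield \<Rightarrow> bool" where
  "semispray A r S \<longleftrightarrow>
     vector_field A r S \<and>
     (\<forall>ch\<in>A. \<forall>z\<in>jimg A r ch. \<forall>a\<in>idx r.
        tangent_J r (vloc A r ch S z) a = liouville r 1 z a)"

text \<open>The components of \<open>\<theta>\<^sub>F\<close> and \<open>\<omega>\<^sub>F\<close>, and the energy, in the chart of \<open>T\<^sup>2\<^sup>k\<^sup>-\<^sup>1\<^sub>0M\<close> induced by \<open>ch\<close>.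
  \<open>S'\<close> is an auxiliary semispray of order \<open>2k - 1\<close>.\<close>

definition theta_F ::
  "('a, 'n::finite) chart set \<Rightarrow> nat \<Rightarrow> 'a vfield \<Rightarrow> ('a jet \<Rightarrow> real) \<Rightarrow> ('a, 'n) chart \<Rightarrow>
   'n pt \<Rightarrow> 'n pt" where
  "theta_F A k S' F ch z b =
     (let r = 2 * k - 1; f = floc A r ch (pull A k F); X = vloc A r ch S' in
      \<Sum>\<alpha>=1..k. (-1) ^ (\<alpha> - 1) / fact \<alpha> * ((lie_form r X ^^ (\<alpha> - 1)) (d_J r \<alpha> f)) z b)"

definition omega_F ::
  "('a, 'n::finite) chart set \<Rightarrow> nat \<Rightarrow> 'a vfield \<Rightarrow> ('a jet \<Rightarrow> real) \<Rightarrow> ('a, 'n) chart \<Rightarrow>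
   'n two_form" where
  "omega_F A k S' F ch z a b = - ext_d (theta_F A k S' F ch) z a b"

definition energy_F ::
  "('a, 'n::finite) chart set \<Rightarrow> nat \<Rightarrow> 'a vfield \<Rightarrow> ('a jet \<Rightarrow> real) \<Rightarrow> ('a, 'n) chart \<Rightarrow>
   'n pt \<Rightarrow> real" where
  "energy_F A k S' F ch z =
     (let r = 2 * k - 1; f = floc A r ch (pull A k F); X = vloc A r ch S' in
      (\<Sum>\<alpha>=1..k. (-1) ^ (\<alpha> - 1) / fact \<alpha> *
         ((lie_fun r X ^^ (\<alpha> - 1)) (lie_fun r (liouville r \<alpha>) f)) z) - f z)"

definition zermelo :: "('a, 'n::finite) chart set \<Rightarrow> nat \<Rightarrow> ('a jet \<Rightarrow> real) \<Rightarrow> bool" where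
  "zermelo A k F \<longleftrightarrow>
     (\<forall>ch\<in>A. \<forall>z\<in>jimg A k ch.
        lie_fun k (liouville k 1) (floc A k ch F) z = floc A k ch F z \<and>
        (\<forall>\<alpha>\<in>{2..k}. lie_fun k (liouville k \<alpha>) (floc A k ch F) z = 0))"

definition h_matrix :: "nat \<Rightarrow> ('n::finite pt \<Rightarrow> real) \<Rightarrow> 'n pt \<Rightarrow> real ^ 'n ^ 'n" where
  "h_matrix k f z = (\<chi> i j. f z ^ (2 * k - 1) * pd (k, i) (pd (k, j) f) z)"

definition finsler_function :: "('a, 'n::finite) chart set \<Rightarrow> nat \<Rightarrow> ('a jet \<Rightarrow> real) \<Rightarrow> bool" where
  "finsler_function A k F \<longleftrightarrow>
     smooth_T0 A k F \<and> (\<forall>p\<in>T0 A k. F p > 0) \<and> zermelo A k F \<and>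
     (\<forall>ch\<in>A. \<forall>z\<in>jimg A k ch. rank (h_matrix k (floc A k ch F) z) = CARD('n) - 1)"

end

theory Submission
  imports Defs
begin

text \<open>In an induced chart let \<open>y\<^sup>\<beta>\<close> be the block of coordinates of order \<open>\<beta>\<close>, \<open>F\<^sub>\<beta>\<close> the block of
  partial derivatives of \<open>F\<close> by \<open>y\<^sup>\<beta>\<close>, and \<open>\<theta>\<^sub>\<beta>\<close> the coefficient of \<open>dy\<^sup>\<beta>\<close> in the Poincare-Cartan
  form, the momentum of order \<open>\<beta>\<close>. Put \<open>r = 2k - 1\<close>. A semispray has the components
  \<open>(\<gamma> + 1) y\<^sup>\<gamma>\<^sup>+\<^sup>1\<close> for \<open>\<gamma> < r\<close>, so a Lie derivative along it raises the order of a semibasic form by at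
  most one. The definition of \<open>\<theta>\<close> therefore gives \<open>\<theta>\<^sub>\<beta> = 0\<close> for \<open>\<beta> \<ge> k\<close>, and \<open>L\<^sub>S\<theta> = dF\<close> becomes the
  recursion \<open>S \<theta>\<^sub>\<beta> + \<beta> \<theta>\<^sub>\<beta>\<^sub>-\<^sub>1 = F\<^sub>\<beta>\<close>, which determines the momenta downwards from \<open>\<beta> = k\<close>
  (\<open>momentum_recursion\<close>). It shows that \<open>\<theta>\<^sub>\<beta>\<close> depends only on coordinates of order at most \<open>r - \<beta>\<close>
  (\<open>momentum_order\<close>). For \<open>\<beta> \<ge> 1\<close> the field \<open>S\<close> may thus be replaced by its prescribed part, which is
  given by the formula of the Liouville field \<open>C\<^sub>\<alpha>\<close> for \<open>\<alpha> = 0\<close>, and the rule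
  \<open>[C\<^sub>\<alpha>, C\<^sub>0] = \<alpha> C\<^sub>\<alpha>\<^sub>-\<^sub>1\<close> becomes available (\<open>L_commutator\<close>).

  For the contractions \<open>c\<^sub>\<alpha>\<close> of \<open>\<theta>\<close> with \<open>C\<^sub>\<alpha>\<close>, where \<open>c\<^sub>0\<close> is the contraction with \<open>S\<close>, the recursion and
  the Zermelo conditions give \<open>S c\<^sub>1 = F - c\<^sub>0\<close> and \<open>S c\<^sub>\<alpha> = - \<alpha> c\<^sub>\<alpha>\<^sub>-\<^sub>1\<close> for \<open>\<alpha> \<ge> 2\<close>. Since \<open>c\<^sub>\<alpha> = 0\<close> for
  \<open>\<alpha> \<ge> k\<close>, going down yields \<open>c\<^sub>\<alpha> = 0\<close> for all \<open>\<alpha> \<ge> 1\<close> and finally \<open>c\<^sub>0 = F\<close>. The components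
  of the Lie derivatives of \<open>\<theta>\<close> along the Liouville fields obey a recursion of the same kind
  (\<open>L0_lie_momentum\<close>) and vanish by a double induction. Cartan's formula then puts every \<open>C\<^sub>\<alpha>\<close> into the
  kernel of \<open>d\<theta>\<close>, and also \<open>S\<close>, because \<open>L\<^sub>S\<theta> = dF\<close> and \<open>F\<close> is the contraction of \<open>\<theta>\<close> with \<open>S\<close>. In
  the energy, the first summand cancels \<open>F\<close>, and the others are derivatives of functions that are zero.

  By the bound on the orders, the matrix of \<open>d\<theta>\<close>, split into blocks by order, vanishes below the
  antidiagonal; the recursion shows that the blocks on the antidiagonal are nonzero multiples of the
  Hessian \<open>H\<close> of \<open>F\<close> in \<open>y\<^sup>k\<close>. The kernel contains \<open>S, C\<^sub>1, \<dots>, C\<^sub>r\<close>, which form a staircase with the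
  nonzero block \<open>y\<^sup>1\<close> at the steps. So the rank is at most \<open>2k(n - 1)\<close>. It is attained if the kernel of
  \<open>H\<close> is spanned by \<open>y\<^sup>1\<close>; otherwise a further vector of that kernel, placed in the top block, is a
  further vector of the kernel of \<open>d\<theta>\<close> (\<open>form_rank_maximal_iff\<close>).

  The passage from the manifold to a chart needs that the image of an induced chart is relatively open
  and consists of all points with \<open>y\<^sup>1 \<noteq> 0\<close> over the image of the base chart (\<open>jimg_eq\<close>), and that a jet is
  determined by its coordinates in a single chart, so that the pull-back of \<open>F\<close> is \<open>F\<close> after truncation
  of the coordinates (\<open>floc_pull\<close>). Both rest on the fact that smooth maps preserve contact of curves
  (\<open>contact_comp\<close>).\<close>

section \<open>Partial derivatives on relatively open sets\<close>

text \<open>Relative openness in \<open>\<real>\<^sup>D\<close>, phrased with boxes: partial derivatives, mean value arguments and mixed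
  second differences move finitely many coordinates at once and only ask for this.\<close>

definition box_open :: "'c set \<Rightarrow> ('c \<Rightarrow> real) set \<Rightarrow> bool" where
  "box_open D W \<longleftrightarrow> (\<forall>z\<in>W. \<exists>e>0. \<forall>w. (\<forall>c\<in>D. \<bar>w c - z c\<bar> < e) \<and> (\<forall>c. c \<notin> D \<longrightarrow> w c = z c)
      \<longrightarrow> w \<in> W)"

lemma box_openE:
  assumes "box_open D W" "z \<in> W"
  obtains e where "e > 0"
    "\<And>w. (\<And>c. c \<in> D \<Longrightarrow> \<bar>w c - z c\<bar> < e) \<Longrightarrow> (\<And>c. c \<notin> D \<Longrightarrow> w c = z c) \<Longrightarrow> w \<in> W"
  using assms unfolding box_open_def by metis

lemma open_contains_box:
  fixes G :: "('c \<Rightarrow> real) set"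
  assumes "open G" "z \<in> G" "finite D"
  obtains e where "e > 0"
    "\<And>w. (\<And>c. c \<in> D \<Longrightarrow> \<bar>w c - z c\<bar> < e) \<Longrightarrow> (\<And>c. c \<notin> D \<Longrightarrow> w c = z c) \<Longrightarrow> w \<in> G"
proof -
  \<comment> \<open>The factors outside \<open>D\<close> contain the coordinates of \<open>z\<close>, which do not move; so \<open>D\<close> may be any finite set.\<close>
  obtain X where X: "z \<in> (\<Pi>\<^sub>E i\<in>UNIV. X i)" "\<And>i. open (X i)" "(\<Pi>\<^sub>E i\<in>UNIV. X i) \<subseteq> G"
    using product_topology_open_contains_basis[of "\<lambda>_. euclidean" UNIV G z] assms
    unfolding open_fun_def by auto
  have "\<exists>e. \<forall>c. e c > 0 \<and> (\<forall>s. \<bar>s - z c\<bar> < e c \<longrightarrow> s \<in> X c)"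
  proof (intro choice allI)
    fix c show "\<exists>d. d > 0 \<and> (\<forall>s. \<bar>s - z c\<bar> < d \<longrightarrow> s \<in> X c)"
      using X(1) X(2)[of c] by (auto simp: open_dist dist_real_def)
  qed
  then obtain e where e: "\<And>c. e c > 0" "\<And>c s. \<bar>s - z c\<bar> < e c \<Longrightarrow> s \<in> X c" by metis
  define d where "d = Min (insert 1 (e ` D))"
  have "d > 0" using assms(3) e(1) by (auto simp: d_def)
  moreover have "w \<in> G" if "\<And>c. c \<in> D \<Longrightarrow> \<bar>w c - z c\<bar> < d" "\<And>c. c \<notin> D \<Longrightarrow> w c = z c" for w
  proof -
    have "w c \<in> X c" for c
    proof (cases "c \<in> D")
      case True
      then have "d \<le> e c" using assms(3) by (auto simp: d_def)
      then show ?thesis using that(1)[OF True] e(2) by fastforce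
    next
      case False
      then show ?thesis using that(2) X(1) by (auto simp: PiE_iff)
    qed
    then show ?thesis using X(3) by auto
  qed
  ultimately show ?thesis using that by blast
qed

lemma box_open_Int_open:
  assumes "open G" "finite D" shows "box_open D {z \<in> G. \<forall>c. c \<notin> D \<longrightarrow> z c = 0}"
  unfolding box_open_def
proof safe
  fix z assume z: "z \<in> G" "\<forall>c. c \<notin> D \<longrightarrow> z c = 0"
  obtain e where "e > 0"
    "\<And>w. (\<And>c. c \<in> D \<Longrightarrow> \<bar>w c - z c\<bar> < e) \<Longrightarrow> (\<And>c. c \<notin> D \<Longrightarrow> w c = z c) \<Longrightarrow> w \<in> G"
    using open_contains_box[OF assms(1) z(1) assms(2)] by metis
  with z show "\<exists>e>0. \<forall>w. (\<forall>c\<in>D. \<bar>w c - z c\<bar> < e) \<and> (\<forall>c. c \<notin> D \<longrightarrow> w c = z c) \<longrightarrow>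
      w \<in> {z \<in> G. \<forall>c. c \<notin> D \<longrightarrow> z c = 0}"
    by (intro exI[of _ e]) auto
qed

lemma box_open_open:
  fixes G :: "('n::finite \<Rightarrow> real) set"
  assumes "open G" shows "box_open UNIV G"
  using box_open_Int_open[OF assms, of UNIV] by simp

lemma continuous_on_boxE:
  fixes g :: "('c \<Rightarrow> real) \<Rightarrow> real"
  assumes "continuous_on W g" "z \<in> W" "finite D" "\<epsilon> > 0"
  obtains e where "e > 0"
    "\<And>w. w \<in> W \<Longrightarrow> (\<And>c. c \<in> D \<Longrightarrow> \<bar>w c - z c\<bar> < e) \<Longrightarrow> (\<And>c. c \<notin> D \<Longrightarrow> w c = z c)
      \<Longrightarrow> \<bar>g w - g z\<bar> < \<epsilon>"
proof -
  have "open (ball (g z) \<epsilon>)" "g z \<in> ball (g z) \<epsilon>" using assms by auto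
  then obtain G where G: "open G" "z \<in> G" "\<And>w. w \<in> W \<Longrightarrow> w \<in> G \<Longrightarrow> g w \<in> ball (g z) \<epsilon>"
    using assms(1,2) unfolding continuous_on_topological by metis
  from open_contains_box[OF G(1,2) assms(3)] obtain e where "e > 0"
    "\<And>w. (\<And>c. c \<in> D \<Longrightarrow> \<bar>w c - z c\<bar> < e) \<Longrightarrow> (\<And>c. c \<notin> D \<Longrightarrow> w c = z c) \<Longrightarrow> w \<in> G"
    by metis
  with G(3) show ?thesis
    by (intro that[of e]) (auto simp: dist_real_def abs_minus_commute)
qed

lemma box_open_eventually:
  assumes "box_open D W" "z \<in> W" "c \<in> D"
  shows "eventually (\<lambda>s. z(c := s) \<in> W) (nhds (z c))"
proof -
  obtain e where e: "e > 0"
    "\<And>w. (\<And>c. c \<in> D \<Longrightarrow> \<bar>w c - z c\<bar> < e) \<Longrightarrow> (\<And>c. c \<notin> D \<Longrightarrow> w c = z c) \<Longrightarrow> w \<in> W"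
    using box_openE[OF assms(1,2)] by metis
  have "z(c := s) \<in> W" if "dist s (z c) < e" for s
    using e that assms(3) by (intro e(2)) (auto simp: dist_real_def)
  then show ?thesis unfolding eventually_nhds_metric using e(1) by auto
qed

lemma has_real_derivative_germ:
  assumes "(f has_real_derivative y) (at x)" "eventually (\<lambda>s. f s = g s) (nhds x)"
  shows "(g has_real_derivative y) (at x)"
  using assms(1) DERIV_cong_ev[OF refl assms(2) refl, of y] by simp

lemma pd_cong:
  assumes "box_open D W" "z \<in> W" "c \<in> D" "\<And>w. w \<in> W \<Longrightarrow> f w = g w"
  shows "pd c f z = pd c g z"
  unfolding pd_def
  by (rule deriv_cong_ev) (use box_open_eventually[OF assms(1-3)] assms(4) in \<open>auto elim: eventually_mono\<close>)

subsection \<open>Smooth functions\<close>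

lemma smooth_fun_continuous: "smooth_fun D W f \<Longrightarrow> continuous_on W f"
  unfolding smooth_fun_def by (drule spec[of _ "[]"]) auto

lemma smooth_fun_differentiable:
  "smooth_fun D W f \<Longrightarrow> z \<in> W \<Longrightarrow> c \<in> D \<Longrightarrow> (\<lambda>s. f (z(c := s))) differentiable (at (z c))"
  unfolding smooth_fun_def by (drule spec[of _ "[]"]) auto

lemma smooth_fun_has_pd:
  assumes "smooth_fun D W f" "z \<in> W" "c \<in> D"
  shows "((\<lambda>s. f (z(c := s))) has_real_derivative pd c f z) (at (z c))"
  unfolding pd_def using smooth_fun_differentiable[OF assms]
  by (simp add: DERIV_deriv_iff_real_differentiable)

lemma smooth_fun_has_pd_at:
  assumes "smooth_fun D W f" "z(c := t) \<in> W" "c \<in> D"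
  shows "((\<lambda>s. f (z(c := s))) has_real_derivative pd c f (z(c := t))) (at t)"
  using smooth_fun_has_pd[OF assms] by simp

lemma smooth_fun_pd: "smooth_fun D W f \<Longrightarrow> c \<in> D \<Longrightarrow> smooth_fun D W (pd c f)"
  unfolding smooth_fun_def
proof safe
  fix cs assume A: "\<forall>cs. set cs \<subseteq> D \<longrightarrow> continuous_on W (foldr pd cs f) \<and>
      (\<forall>z\<in>W. \<forall>c\<in>D. (\<lambda>s. foldr pd cs f (z(c := s))) differentiable at (z c))"
    and c: "c \<in> D" and cs: "set cs \<subseteq> D"
  have "set (cs @ [c]) \<subseteq> D" using c cs by auto
  from A[rule_format, OF this] show "continuous_on W (foldr pd cs (pd c f))"
    and "\<And>z d. z \<in> W \<Longrightarrow> d \<in> D \<Longrightarrow> (\<lambda>s. foldr pd cs (pd c f) (z(d := s))) differentiable at (z d)"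
    by auto
qed

text \<open>Smoothness is the greatest property that implies continuity and partial differentiability and
  is inherited, up to equality on the domain, by partial derivatives. This is how all closure
  properties below are obtained.\<close>

lemma smooth_fun_coinduct:
  assumes box: "box_open D W" and f: "P f"
    and cont: "\<And>g. P g \<Longrightarrow> continuous_on W g"
    and diff: "\<And>g z c. P g \<Longrightarrow> z \<in> W \<Longrightarrow> c \<in> D \<Longrightarrow>
      (\<lambda>s. g (z(c := s))) differentiable (at (z c))"
    and step: "\<And>g c. P g \<Longrightarrow> c \<in> D \<Longrightarrow> \<exists>h. P h \<and> (\<forall>z\<in>W. pd c g z = h z)"
  shows "smooth_fun D W f"
  unfolding smooth_fun_def
proof (intro allI impI)
  fix cs assume "set cs \<subseteq> D"
  then have "\<exists>h. P h \<and> (\<forall>z\<in>W. foldr pd cs f z = h z)"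
  proof (induction cs)
    case Nil then show ?case using f by auto
  next
    case (Cons c cs)
    then obtain h where h: "P h" "\<And>z. z \<in> W \<Longrightarrow> foldr pd cs f z = h z" by auto
    have c: "c \<in> D" using Cons.prems by auto
    obtain h' where "P h'" "\<And>z. z \<in> W \<Longrightarrow> pd c h z = h' z" using step[OF h(1) c] by auto
    moreover have "pd c (foldr pd cs f) z = pd c h z" if "z \<in> W" for z
      using pd_cong[OF box that c h(2)] by simp
    ultimately show ?case by auto
  qed
  then obtain h where h: "P h" "\<And>z. z \<in> W \<Longrightarrow> foldr pd cs f z = h z" by auto
  have "(\<lambda>s. foldr pd cs f (z(c := s))) differentiable at (z c)" if "z \<in> W" "c \<in> D" for z c
  proof -
    have "eventually (\<lambda>s. h (z(c := s)) = foldr pd cs f (z(c := s))) (nhds (z c))"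
      using box_open_eventually[OF box that] by (rule eventually_mono) (simp add: h(2))
    moreover obtain y where "((\<lambda>s. h (z(c := s))) has_real_derivative y) (at (z c))"
      using diff[OF h(1) \<open>z \<in> W\<close> \<open>c \<in> D\<close>] by (auto simp: real_differentiable_def)
    ultimately have "((\<lambda>s. foldr pd cs f (z(c := s))) has_real_derivative y) (at (z c))"
      by (rule has_real_derivative_germ[rotated])
    then show ?thesis by (auto simp: real_differentiable_def)
  qed
  moreover have "continuous_on W (foldr pd cs f)"
    using cont[OF h(1)] h(2) by (simp cong: continuous_on_cong)
  ultimately show "continuous_on W (foldr pd cs f) \<and>
      (\<forall>z\<in>W. \<forall>c\<in>D. (\<lambda>s. foldr pd cs f (z(c := s))) differentiable at (z c))" by blast
qed

lemma smooth_fun_cong: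
  assumes "box_open D W" "smooth_fun D W f" "\<And>z. z \<in> W \<Longrightarrow> f z = g z"
  shows "smooth_fun D W g"
proof (rule smooth_fun_coinduct[where P = "\<lambda>h. \<exists>h'. smooth_fun D W h' \<and> (\<forall>z\<in>W. h' z = h z)",
      OF assms(1)], goal_cases)
  case 1 then show ?case using assms by blast
next
  case (2 g) then show ?case using smooth_fun_continuous by (metis continuous_on_cong)
next
  case (3 g z c)
  then obtain h where h: "smooth_fun D W h" "\<And>z. z \<in> W \<Longrightarrow> h z = g z" by auto
  have "eventually (\<lambda>s. h (z(c := s)) = g (z(c := s))) (nhds (z c))"
    using box_open_eventually[OF assms(1) 3(2,3)] by (rule eventually_mono) (simp add: h(2))
  then have "((\<lambda>s. g (z(c := s))) has_real_derivative pd c h z) (at (z c))"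
    by (rule has_real_derivative_germ[OF smooth_fun_has_pd[OF h(1) 3(2,3)]])
  then show ?case by (auto simp: real_differentiable_def)
next
  case (4 g c)
  then show ?case using smooth_fun_pd pd_cong[OF assms(1)] by metis
qed

lemma
  assumes "smooth_fun D W f" "smooth_fun D W g" "z \<in> W" "c \<in> D"
  shows pd_add: "pd c (\<lambda>w. f w + g w) z = pd c f z + pd c g z"
    and pd_mult: "pd c (\<lambda>w. f w * g w) z = pd c f z * g z + f z * pd c g z"
proof -
  note d = smooth_fun_has_pd[OF assms(1,3,4)] smooth_fun_has_pd[OF assms(2,3,4)]
  show "pd c (\<lambda>w. f w + g w) z = pd c f z + pd c g z"
    unfolding pd_def[of c "\<lambda>w. f w + g w"] by (rule DERIV_imp_deriv) (intro DERIV_add d)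
  show "pd c (\<lambda>w. f w * g w) z = pd c f z * g z + f z * pd c g z"
    unfolding pd_def[of c "\<lambda>w. f w * g w"]
    by (rule DERIV_imp_deriv) (use DERIV_mult[OF d] in \<open>simp add: algebra_simps\<close>)
qed

lemma pd_const [simp]: "pd c (\<lambda>w. a) z = 0"
  by (simp add: pd_def)

lemma pd_coord: "pd c (\<lambda>w. w d) z = (if c = d then 1 else 0)"
  by (auto simp: pd_def)

text \<open>Sums and products do not yield closure of smoothness one operation at a time, since the derivative
  of a product is a sum of products. The algebra generated by the smooth functions is closed under
  partial derivatives as a whole, which is what coinduction asks for.\<close>

inductive smooth_alg :: "'c set \<Rightarrow> ('c \<Rightarrow> real) set \<Rightarrow> (('c \<Rightarrow> real) \<Rightarrow> real) \<Rightarrow> bool" for D W where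
  base: "smooth_fun D W f \<Longrightarrow> smooth_alg D W f"
| const: "smooth_alg D W (\<lambda>w. a)"
| coord: "smooth_alg D W (\<lambda>w. w d)"
| add: "smooth_alg D W f \<Longrightarrow> smooth_alg D W g \<Longrightarrow> smooth_alg D W (\<lambda>w. f w + g w)"
| mult: "smooth_alg D W f \<Longrightarrow> smooth_alg D W g \<Longrightarrow> smooth_alg D W (\<lambda>w. f w * g w)"

lemma smooth_alg_smooth:
  assumes box: "box_open D W" and "smooth_alg D W f"
  shows "smooth_fun D W f"
proof -
  have cont: "continuous_on W g" if "smooth_alg D W g" for g
    using that
  proof (induction)
    case (base f) then show ?case by (rule smooth_fun_continuous)
  next
    case (coord d)
    show ?case by (rule continuous_on_subset[OF continuous_on_product_coordinates]) simp
  qed (auto intro!: continuous_intros)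
  have *: "(\<lambda>s. g (z(c := s))) differentiable (at (z c))" 
    if "smooth_alg D W g" "z \<in> W" "c \<in> D" for g z c
    using that
  proof (induction)
    case (base f) then show ?case by (intro smooth_fun_differentiable)
  next
    case (coord d) then show ?case by (cases "c = d") auto
  next
    case (add f g) then show ?case by (intro differentiable_add) auto
  next
    case (mult f g) then show ?case by (intro differentiable_mult) auto
  qed simp
  have d: "((\<lambda>s. g (z(c := s))) has_real_derivative pd c g z) (at (z c))" 
    if "smooth_alg D W g" "z \<in> W" "c \<in> D" for g z c
    using *[OF that] unfolding pd_def by (simp add: DERIV_deriv_iff_real_differentiable)
  have "\<exists>h. smooth_alg D W h \<and> (\<forall>z\<in>W. pd c g z = h z)" if "smooth_alg D W g" "c \<in> D" for g c
    using that
  proof (induction)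
    case (base f)
    then show ?case by (intro exI[of _ "pd c f"]) (simp add: smooth_alg.base smooth_fun_pd)
  next
    case (const a) then show ?case using smooth_alg.const[of D W 0] by auto
  next
    case (coord d)
    show ?case using smooth_alg.const by (intro exI[of _ "\<lambda>_. if c = d then 1 else 0"]) (auto simp: pd_coord)
  next
    case (add f g)
    then obtain f' g' where h: "smooth_alg D W f'" "\<forall>z\<in>W. pd c f z = f' z"
      "smooth_alg D W g'" "\<forall>z\<in>W. pd c g z = g' z" by auto
    have "pd c (\<lambda>w. f w + g w) z = f' z + g' z" if "z \<in> W" for z
    proof -
      have "((\<lambda>s. f (z(c := s)) + g (z(c := s))) has_real_derivative f' z + g' z) (at (z c))"
        using DERIV_add[OF d[OF add.hyps(1) that add.prems] d[OF add.hyps(2) that add.prems]]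
          h that by simp
      then show ?thesis unfolding pd_def[of c "\<lambda>w. f w + g w"] by (rule DERIV_imp_deriv)
    qed
    then show ?case
      by (intro exI[of _ "\<lambda>w. f' w + g' w"] conjI ballI smooth_alg.add[OF h(1,3)])
  next
    case (mult f g)
    then obtain f' g' where h: "smooth_alg D W f'" "\<forall>z\<in>W. pd c f z = f' z"
      "smooth_alg D W g'" "\<forall>z\<in>W. pd c g z = g' z" by auto
    have "pd c (\<lambda>w. f w * g w) z = f' z * g z + g' z * f z" if "z \<in> W" for z
    proof -
      have "((\<lambda>s. f (z(c := s)) * g (z(c := s))) has_real_derivative f' z * g z + g' z * f z) (at (z c))"
        using DERIV_mult[OF d[OF mult.hyps(1) that mult.prems] d[OF mult.hyps(2) that mult.prems]]
          h that by simp
      then show ?thesis unfolding pd_def[of c "\<lambda>w. f w * g w"] by (rule DERIV_imp_deriv)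
    qed
    then show ?case
      by (intro exI[of _ "\<lambda>w. f' w * g w + g' w * f w"] conjI ballI
          smooth_alg.add[OF smooth_alg.mult[OF h(1) mult.hyps(2)] smooth_alg.mult[OF h(3) mult.hyps(1)]])
  qed
  from smooth_fun_coinduct[of D W "smooth_alg D W", OF box assms(2) cont * this]
  show ?thesis .
qed

lemma
  assumes "box_open D W"
  shows smooth_fun_const: "smooth_fun D W (\<lambda>w. a)"
    and smooth_fun_coord: "smooth_fun D W (\<lambda>w. w d)"
    and smooth_fun_add: "smooth_fun D W f \<Longrightarrow> smooth_fun D W g \<Longrightarrow> smooth_fun D W (\<lambda>w. f w + g w)"
    and smooth_fun_mult: "smooth_fun D W f \<Longrightarrow> smooth_fun D W g \<Longrightarrow> smooth_fun D W (\<lambda>w. f w * g w)"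
proof -
  show "smooth_fun D W (\<lambda>w. a)" by (rule smooth_alg_smooth[OF assms smooth_alg.const])
  show "smooth_fun D W (\<lambda>w. w d)" by (rule smooth_alg_smooth[OF assms smooth_alg.coord])
  assume f: "smooth_fun D W f" and g: "smooth_fun D W g"
  show "smooth_fun D W (\<lambda>w. f w + g w)"
    by (rule smooth_alg_smooth[OF assms smooth_alg.add[OF smooth_alg.base[OF f] smooth_alg.base[OF g]]])
  show "smooth_fun D W (\<lambda>w. f w * g w)"
    by (rule smooth_alg_smooth[OF assms smooth_alg.mult[OF smooth_alg.base[OF f] smooth_alg.base[OF g]]])
qed

lemma smooth_fun_sum:
  assumes "box_open D W" "\<And>i. i \<in> I \<Longrightarrow> smooth_fun D W (f i)"
  shows "smooth_fun D W (\<lambda>w. \<Sum>i\<in>I. f i w)"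
  using assms(2)
proof (induction I rule: infinite_finite_induct)
  case (insert x F)
  then show ?case using smooth_fun_add[OF assms(1), of "f x" "\<lambda>w. \<Sum>i\<in>F. f i w"] by simp
qed (simp_all add: smooth_fun_const[OF assms(1)])

lemma pd_sum:
  assumes "box_open D W" "\<And>i. i \<in> I \<Longrightarrow> smooth_fun D W (f i)" "z \<in> W" "c \<in> D"
  shows "pd c (\<lambda>w. \<Sum>i\<in>I. f i w) z = (\<Sum>i\<in>I. pd c (f i) z)"
  using assms(2)
proof (induction I rule: infinite_finite_induct)
  case (insert x F)
  then show ?case
    using pd_add[of D W "f x" "\<lambda>w. \<Sum>i\<in>F. f i w" z c] smooth_fun_sum[OF assms(1), of F f] assms by simp
qed simp_all

lemma pd_cmult:
  assumes "box_open D W" "smooth_fun D W f" "z \<in> W" "c \<in> D"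
  shows "pd c (\<lambda>w. a * f w) z = a * pd c f z"
  using pd_mult[OF smooth_fun_const[OF assms(1), of a] assms(2-4)] by simp

text \<open>The heart of Clairaut's theorem: the second difference of \<open>f\<close> over a small square with sides in the
  directions \<open>c\<close> and \<open>d\<close> equals \<open>h\<^sup>2\<close> times either mixed derivative at some point of the square.\<close>

lemma second_difference:
  assumes f: "smooth_fun D W f" and cd: "c \<in> D" "d \<in> D" "c \<noteq> d" and h: "h > 0"
    and W: "\<And>s t. \<bar>s - z c\<bar> \<le> h \<Longrightarrow> \<bar>t - z d\<bar> \<le> h \<Longrightarrow> z(c := s, d := t) \<in> W"
  obtains s t where "\<bar>s - z c\<bar> \<le> h" "\<bar>t - z d\<bar> \<le> h"
    "f (z(c := z c + h, d := z d + h)) - f (z(c := z c + h)) - f (z(d := z d + h)) + f z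
       = h\<^sup>2 * pd d (pd c f) (z(c := s, d := t))"
proof -
  define u where "u s = f (z(c := s, d := z d + h)) - f (z(c := s))" for s
  have tw: "z(c := s, d := t) = z(d := t, c := s)" for s t using cd(3) by (rule fun_upd_twist)
  have W0: "z(c := s) \<in> W" if "\<bar>s - z c\<bar> \<le> h" for s
    using W[OF that, of "z d"] h cd(3) by (metis abs_zero diff_self fun_upd_other fun_upd_triv less_imp_le)
  have "(u has_real_derivative (pd c f (z(c := s, d := z d + h)) - pd c f (z(c := s)))) (at s)"
    if "\<bar>s - z c\<bar> \<le> h" for s
    unfolding u_def tw
    using smooth_fun_has_pd_at[OF f, of "z(d := z d + h)" c s] W[OF that, of "z d + h"] cd h
      smooth_fun_has_pd_at[OF f W0[OF that] cd(1)]
    by (intro DERIV_diff) (auto simp: tw)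
  then obtain s where s: "z c < s" "s < z c + h"
    "u (z c + h) - u (z c) = h * (pd c f (z(c := s, d := z d + h)) - pd c f (z(c := s)))"
    using MVT2[of "z c" "z c + h" u "\<lambda>s. pd c f (z(c := s, d := z d + h)) - pd c f (z(c := s))"] h
    by (auto simp: abs_if)
  have sh: "\<bar>s - z c\<bar> \<le> h" using s by auto
  define v where "v t = pd c f (z(c := s, d := t))" for t
  have "(v has_real_derivative pd d (pd c f) (z(c := s, d := t))) (at t)" if "\<bar>t - z d\<bar> \<le> h" for t
    unfolding v_def
    using smooth_fun_has_pd_at[OF smooth_fun_pd[OF f cd(1)] W[OF sh that] cd(2)] .
  then obtain t where t: "z d < t" "t < z d + h"
    "v (z d + h) - v (z d) = h * pd d (pd c f) (z(c := s, d := t))"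
    using MVT2[of "z d" "z d + h" v "\<lambda>t. pd d (pd c f) (z(c := s, d := t))"] h
    by (auto simp: abs_if)
  have "v (z d) = pd c f (z(c := s))" unfolding v_def using cd(3) by (metis fun_upd_other fun_upd_triv)
  then have "u (z c + h) - u (z c) = h\<^sup>2 * pd d (pd c f) (z(c := s, d := t))"
    using s(3) t(3) by (simp add: v_def power2_eq_square)
  moreover have "u (z c + h) - u (z c) =
     f (z(c := z c + h, d := z d + h)) - f (z(c := z c + h)) - f (z(d := z d + h)) + f z"
    by (simp add: u_def)
  ultimately show ?thesis using that[OF sh, of t] t(1,2) by auto
qed

lemma pd_commute:
  assumes box: "box_open D W" and fin: "finite D" and f: "smooth_fun D W f"
    and z: "z \<in> W" and c: "c \<in> D" and d: "d \<in> D"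
  shows "pd c (pd d f) z = pd d (pd c f) z"
proof (cases "c = d")
  case False
  have "\<bar>pd c (pd d f) z - pd d (pd c f) z\<bar> < \<epsilon>" if "\<epsilon> > 0" for \<epsilon>
  proof -
    obtain e0 where e0: "e0 > 0" "\<And>w. (\<And>c. c \<in> D \<Longrightarrow> \<bar>w c - z c\<bar> < e0) \<Longrightarrow>
        (\<And>c. c \<notin> D \<Longrightarrow> w c = z c) \<Longrightarrow> w \<in> W"
      using box_openE[OF box z] by metis
    have e2: "\<epsilon> / 2 > 0" using that by simp
    note s1 = smooth_fun_continuous[OF smooth_fun_pd[OF smooth_fun_pd[OF f c] d]]
    note s2 = smooth_fun_continuous[OF smooth_fun_pd[OF smooth_fun_pd[OF f d] c]]
    obtain e1 where e1: "e1 > 0" "\<And>w. w \<in> W \<Longrightarrow> (\<And>c. c \<in> D \<Longrightarrow> \<bar>w c - z c\<bar> < e1) \<Longrightarrow>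
        (\<And>c. c \<notin> D \<Longrightarrow> w c = z c) \<Longrightarrow> \<bar>pd d (pd c f) w - pd d (pd c f) z\<bar> < \<epsilon> / 2"
      using continuous_on_boxE[OF s1 z fin e2] by metis
    obtain e2 where e2: "e2 > 0" "\<And>w. w \<in> W \<Longrightarrow> (\<And>c. c \<in> D \<Longrightarrow> \<bar>w c - z c\<bar> < e2) \<Longrightarrow>
        (\<And>c. c \<notin> D \<Longrightarrow> w c = z c) \<Longrightarrow> \<bar>pd c (pd d f) w - pd c (pd d f) z\<bar> < \<epsilon> / 2"
      using continuous_on_boxE[OF s2 z fin e2] by metis
    define h where "h = min e0 (min e1 e2) / 2"
    have h: "h > 0" "h < e0" "h < e1" "h < e2" using e0(1) e1(1) e2(1) by (auto simp: h_def)
    have W: "z(c := s, d := t) \<in> W" if "\<bar>s - z c\<bar> \<le> h" "\<bar>t - z d\<bar> \<le> h" for s t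
      using that h c d e0(1) by (intro e0(2)) auto
    have tw: "z(c := s, d := t) = z(d := t, c := s)" for s t using False by (rule fun_upd_twist)
    \<comment> \<open>The second difference is symmetric in the two directions, so both mixed derivatives take a common value near \<open>z\<close>.\<close>
    obtain s t where st: "\<bar>s - z c\<bar> \<le> h" "\<bar>t - z d\<bar> \<le> h"
      "f (z(c := z c + h, d := z d + h)) - f (z(c := z c + h)) - f (z(d := z d + h)) + f z
         = h\<^sup>2 * pd d (pd c f) (z(c := s, d := t))"
      using second_difference[OF f c d False h(1), of z] W by metis
    obtain s' t' where st': "\<bar>s' - z c\<bar> \<le> h" "\<bar>t' - z d\<bar> \<le> h"
      "f (z(d := z d + h, c := z c + h)) - f (z(d := z d + h)) - f (z(c := z c + h)) + f z
         = h\<^sup>2 * pd c (pd d f) (z(d := t', c := s'))"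
      using second_difference[OF f d c False[symmetric] h(1), of z] W unfolding tw by metis
    have "h\<^sup>2 * pd d (pd c f) (z(c := s, d := t)) = h\<^sup>2 * pd c (pd d f) (z(c := s', d := t'))"
      using st(3) st'(3)[folded tw] by linarith
    then have eq: "pd d (pd c f) (z(c := s, d := t)) = pd c (pd d f) (z(c := s', d := t'))"
      using h(1) by simp
    have "\<bar>pd d (pd c f) (z(c := s, d := t)) - pd d (pd c f) z\<bar> < \<epsilon> / 2"
      using W[OF st(1,2)] st(1,2) h c d False by (intro e1(2)) auto
    moreover have "\<bar>pd c (pd d f) (z(c := s', d := t')) - pd c (pd d f) z\<bar> < \<epsilon> / 2"
      using W[OF st'(1,2)] st'(1,2) h c d False by (intro e2(2)) auto
    ultimately show ?thesis using eq by linarith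
  qed
  from this[of "\<bar>pd c (pd d f) z - pd d (pd c f) z\<bar>"] show ?thesis by fastforce
qed simp

section \<open>Germs of smooth curves\<close>

text \<open>One radius serves all orders of differentiation, as in the definition of the curves that represent
  jets.\<close>

definition smooth_within :: "real \<Rightarrow> (real \<Rightarrow> real) \<Rightarrow> bool" where
  "smooth_within e g \<longleftrightarrow> (\<forall>t. \<bar>t\<bar> < e \<longrightarrow> (\<forall>m. (deriv ^^ m) g differentiable (at t)))"

lemma eventually_abs_less:
  fixes t :: real
  assumes "\<bar>t\<bar> < e" shows "eventually (\<lambda>s. \<bar>s\<bar> < e) (nhds t)"
  by (rule eventually_nhds_in_open[of "{s. \<bar>s\<bar> < e}", simplified])
    (use assms in \<open>auto intro!: open_Collect_less continuous_intros\<close>)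

lemma smooth_within_deriv: "smooth_within e g \<Longrightarrow> smooth_within e (deriv g)"
  unfolding smooth_within_def
  by (metis comp_apply funpow_Suc_right)

lemma smooth_within_mono: "smooth_within e g \<Longrightarrow> e' \<le> e \<Longrightarrow> smooth_within e' g"
  unfolding smooth_within_def by auto

lemma smooth_within_differentiable: "smooth_within e g \<Longrightarrow> \<bar>t\<bar> < e \<Longrightarrow> g differentiable (at t)"
  unfolding smooth_within_def by (metis funpow_0)

lemma smooth_within_DERIV:
  "smooth_within e g \<Longrightarrow> \<bar>t\<bar> < e \<Longrightarrow> (g has_real_derivative deriv g t) (at t)"
  using smooth_within_differentiable by (simp add: DERIV_deriv_iff_real_differentiable)

text \<open>The analogue of \<open>smooth_fun_coinduct\<close> for functions of one variable.\<close>

lemma smooth_within_coinduct: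
  assumes f: "P f" and diff: "\<And>g t. P g \<Longrightarrow> \<bar>t\<bar> < e \<Longrightarrow> g differentiable (at t)"
    and step: "\<And>g. P g \<Longrightarrow> \<exists>h. P h \<and> (\<forall>t. \<bar>t\<bar> < e \<longrightarrow> deriv g t = h t)"
  shows "smooth_within e f"
  unfolding smooth_within_def
proof (intro allI impI)
  fix t :: real and m assume t: "\<bar>t\<bar> < e"
  have "\<exists>h. P h \<and> (\<forall>t. \<bar>t\<bar> < e \<longrightarrow> (deriv ^^ m) f t = h t)"
  proof (induction m)
    case 0 then show ?case using f by auto
  next
    case (Suc m)
    then obtain h where h: "P h" "\<And>t. \<bar>t\<bar> < e \<Longrightarrow> (deriv ^^ m) f t = h t" by auto
    obtain h' where h': "P h'" "\<And>t. \<bar>t\<bar> < e \<Longrightarrow> deriv h t = h' t" using step[OF h(1)] by auto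
    have "deriv ((deriv ^^ m) f) t = deriv h t" if "\<bar>t\<bar> < e" for t
      by (rule deriv_cong_ev) (use eventually_mono[OF eventually_abs_less[OF that] h(2)] in auto)
    then show ?case using h' by auto
  qed
  then obtain h where h: "P h" "\<And>t. \<bar>t\<bar> < e \<Longrightarrow> (deriv ^^ m) f t = h t" by auto
  obtain y where "(h has_real_derivative y) (at t)"
    using diff[OF h(1) t] by (auto simp: real_differentiable_def)
  then have "((deriv ^^ m) f has_real_derivative y) (at t)"
    by (rule has_real_derivative_germ)
      (use eventually_mono[OF eventually_abs_less[OF t], of "\<lambda>s. h s = (deriv ^^ m) f s"] h(2) in auto)
  then show "(deriv ^^ m) f differentiable (at t)" by (auto simp: real_differentiable_def)
qed

lemma smooth_within_poly: "smooth_within e (poly p)"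
proof (rule smooth_within_coinduct[of "\<lambda>g. \<exists>p. g = poly p"])
  fix g :: "real \<Rightarrow> real" assume "\<exists>p. g = poly p"
  then obtain p where "g = poly p" by auto
  then have "deriv g t = poly (pderiv p) t" for t using poly_DERIV[of p t] by (simp add: DERIV_imp_deriv)
  then show "\<exists>h. (\<exists>p. h = poly p) \<and> (\<forall>t. \<bar>t\<bar> < e \<longrightarrow> deriv g t = h t)" by blast
qed auto

lemma smooth_within_const: "smooth_within e (\<lambda>t. a)"
proof -
  have "poly [:a:] = (\<lambda>t. a)" by (simp add: fun_eq_iff)
  then show ?thesis using smooth_within_poly[of e "[:a:]"] by simp
qed

subsection \<open>The chain rule along a curve\<close>

lemma MVT_segment:
  fixes F :: "real \<Rightarrow> real"
  assumes "\<And>x. \<bar>x - a\<bar> \<le> \<bar>b - a\<bar> \<Longrightarrow> (F has_real_derivative F' x) (at x)"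
  obtains x where "\<bar>x - a\<bar> \<le> \<bar>b - a\<bar>" "F b - F a = F' x * (b - a)"
proof -
  consider "a < b" | "b < a" | "a = b" by linarith
  then show ?thesis
  proof cases
    case 1
    obtain x where "a < x" "x < b" "F b - F a = (b - a) * F' x"
      using MVT2[OF 1, of F F'] assms 1 by (auto simp: abs_if)
    then show ?thesis using that[of x] by (simp add: mult.commute)
  next
    case 2
    obtain x where "b < x" "x < a" "F a - F b = (a - b) * F' x"
      using MVT2[OF 2, of F F'] assms 2 by (auto simp: abs_if)
    then show ?thesis using that[of x] by (simp add: algebra_simps)
  next
    case 3 then show ?thesis using that[of a] by simp
  qed
qed

text \<open>The coordinates are switched on one after the other: \<open>Z E\<close> follows the curve in the coordinates in
  \<open>E\<close> and rests at \<open>\<gamma> t0\<close> in the others. Each switch changes \<open>g\<close> by a partial derivative at an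
  intermediate point, by the mean value theorem, and continuity of the partial derivative finishes.\<close>

lemma chain_rule_curve:
  fixes \<gamma> :: "real \<Rightarrow> 'n::finite \<Rightarrow> real"
  assumes box: "box_open UNIV W" and g: "smooth_fun UNIV W g" and W: "\<gamma> t0 \<in> W"
    and \<gamma>: "\<And>i. ((\<lambda>t. \<gamma> t i) has_real_derivative v i) (at t0)"
  shows "((\<lambda>t. g (\<gamma> t)) has_real_derivative (\<Sum>i\<in>UNIV. pd i g (\<gamma> t0) * v i)) (at t0)"
proof -
  define z where "z = \<gamma> t0"
  define Z where "Z E t = (\<lambda>i. if i \<in> E then \<gamma> t i else z i)" for E t
  obtain e0 where e0: "e0 > 0" "\<And>w. (\<And>i. \<bar>w i - z i\<bar> < e0) \<Longrightarrow> w \<in> W"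
    using box_openE[OF box W] unfolding z_def by (metis UNIV_I)
  have near: "eventually (\<lambda>t. \<forall>i. \<bar>\<gamma> t i - z i\<bar> < e) (nhds t0)" if "e > 0" for e
  proof (rule eventually_all_finite)
    fix i
    have "isCont (\<lambda>t. \<gamma> t i) t0" using DERIV_isCont[OF \<gamma>] .
    then show "eventually (\<lambda>t. \<bar>\<gamma> t i - z i\<bar> < e) (nhds t0)"
      using tendstoD[of "\<lambda>t. \<gamma> t i" "z i" "at t0" e] that
      by (simp add: eventually_nhds_conv_at isCont_def dist_real_def z_def)
  qed
  have "((\<lambda>t. g (Z E t)) has_real_derivative (\<Sum>i\<in>E. pd i g z * v i)) (at t0)" for E
  proof (induction E rule: finite_induct[OF finite])
    case 1
    show ?case by (simp add: Z_def)
  next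
    case (2 j E)
    have Zj: "Z (insert j E) t = (Z E t)(j := \<gamma> t j)" "Z E t = (Z E t)(j := z j)" for t
      using 2 by (auto simp: Z_def fun_eq_iff)
    \<comment> \<open>the intermediate point of the mean value theorem when coordinate \<open>j\<close> is switched on\<close>
    define x where "x t = (SOME x. \<bar>x - z j\<bar> \<le> \<bar>\<gamma> t j - z j\<bar> \<and>
      g (Z (insert j E) t) - g (Z E t) = pd j g ((Z E t)(j := x)) * (\<gamma> t j - z j))" for t
    define q where "q t = pd j g ((Z E t)(j := x t))" for t
    have x: "\<bar>x t - z j\<bar> \<le> \<bar>\<gamma> t j - z j\<bar>"
        "g (Z (insert j E) t) - g (Z E t) = q t * (\<gamma> t j - z j)"
      if t: "\<forall>i. \<bar>\<gamma> t i - z i\<bar> < e0" for t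
    proof -
      have "(Z E t)(j := s) \<in> W" if "\<bar>s - z j\<bar> \<le> \<bar>\<gamma> t j - z j\<bar>" for s
        using t e0(1) le_less_trans[OF that t[rule_format]] by (intro e0(2)) (auto simp: Z_def)
      then have "((\<lambda>s. g ((Z E t)(j := s))) has_real_derivative pd j g ((Z E t)(j := s))) (at s)"
        if "\<bar>s - z j\<bar> \<le> \<bar>\<gamma> t j - z j\<bar>" for s
        using smooth_fun_has_pd_at[OF g] that by blast
      then obtain s where "\<bar>s - z j\<bar> \<le> \<bar>\<gamma> t j - z j\<bar>"
        "g ((Z E t)(j := \<gamma> t j)) - g ((Z E t)(j := z j)) = pd j g ((Z E t)(j := s)) * (\<gamma> t j - z j)"
        using MVT_segment[of "z j" "\<gamma> t j" "\<lambda>s. g ((Z E t)(j := s))" "\<lambda>s. pd j g ((Z E t)(j := s))"]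
        by blast
      then have "\<exists>s. \<bar>s - z j\<bar> \<le> \<bar>\<gamma> t j - z j\<bar> \<and>
        g (Z (insert j E) t) - g (Z E t) = pd j g ((Z E t)(j := s)) * (\<gamma> t j - z j)"
        using Zj(1)[of t] Zj(2)[of t] by metis
      from someI_ex[OF this] show "\<bar>x t - z j\<bar> \<le> \<bar>\<gamma> t j - z j\<bar>"
        "g (Z (insert j E) t) - g (Z E t) = q t * (\<gamma> t j - z j)"
        unfolding x_def q_def by blast+
    qed
    have "(q \<longlongrightarrow> pd j g z) (at t0)"
    proof (rule tendstoI)
      fix \<epsilon> :: real assume "\<epsilon> > 0"
      have zW: "z \<in> W" using W by (simp add: z_def)
      have "\<exists>e>0. \<forall>w\<in>W. (\<forall>i. \<bar>w i - z i\<bar> < e) \<longrightarrow> \<bar>pd j g w - pd j g z\<bar> < \<epsilon>"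
        by (rule continuous_on_boxE[OF smooth_fun_continuous[OF smooth_fun_pd[OF g UNIV_I[of j]]]
              zW finite[of UNIV] \<open>\<epsilon> > 0\<close>]) auto
      then obtain e where e: "e > 0"
        "\<And>w. w \<in> W \<Longrightarrow> (\<And>i. \<bar>w i - z i\<bar> < e) \<Longrightarrow> \<bar>pd j g w - pd j g z\<bar> < \<epsilon>"
        by blast
      have "eventually (\<lambda>t. \<forall>i. \<bar>\<gamma> t i - z i\<bar> < min e e0) (at t0)"
        using near[of "min e e0"] e(1) e0(1) unfolding eventually_nhds_conv_at by simp
      then show "eventually (\<lambda>t. dist (q t) (pd j g z) < \<epsilon>) (at t0)"
      proof (rule eventually_mono)
        fix t assume t: "\<forall>i. \<bar>\<gamma> t i - z i\<bar> < min e e0"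
        then have "\<bar>x t - z j\<bar> \<le> \<bar>\<gamma> t j - z j\<bar>" using x(1)[of t] by auto
        also have "\<dots> < min e e0" using t by blast
        finally have "\<bar>((Z E t)(j := x t)) i - z i\<bar> < min e e0" for i
          using t e(1) e0(1) by (auto simp: Z_def)
        then have "\<bar>((Z E t)(j := x t)) i - z i\<bar> < e" "\<bar>((Z E t)(j := x t)) i - z i\<bar> < e0" for i
          by (metis min_less_iff_conj)+
        then show "dist (q t) (pd j g z) < \<epsilon>"
          unfolding q_def dist_real_def using e(2)[of "(Z E t)(j := x t)"] e0(2) by blast
      qed
    qed
    moreover have "((\<lambda>t. (\<gamma> t j - z j) / (t - t0)) \<longlongrightarrow> v j) (at t0)"
      using \<gamma>[of j] unfolding has_field_derivative_iff z_def .
    ultimately have lim: "((\<lambda>t. q t * ((\<gamma> t j - z j) / (t - t0))) \<longlongrightarrow> pd j g z * v j) (at t0)"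
      by (rule tendsto_mult)
    have Z0: "Z E t0 = z" "Z (insert j E) t0 = z" by (auto simp: Z_def z_def)
    have "eventually (\<lambda>t. q t * ((\<gamma> t j - z j) / (t - t0)) =
        ((g (Z (insert j E) t) - g (Z E t)) - (g (Z (insert j E) t0) - g (Z E t0))) / (t - t0)) (at t0)"
      using near[OF e0(1)] unfolding eventually_nhds_conv_at
      by (auto elim!: eventually_mono simp: x(2) Z0)
    from tendsto_cong[OF this] lim
    have "((\<lambda>t. g (Z (insert j E) t) - g (Z E t)) has_real_derivative pd j g z * v j) (at t0)"
      unfolding has_field_derivative_iff by simp
    from DERIV_add[OF this 2(3)] show ?case using 2 by simp
  qed
  from this[of UNIV] show ?thesis by (simp add: Z_def z_def)
qed


lemma eventually_curve_in:
  fixes \<gamma> :: "real \<Rightarrow> 'n::finite \<Rightarrow> real"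
  assumes "open T" "\<gamma> 0 \<in> T" "0 < e" "\<And>i. smooth_within e (\<lambda>t. \<gamma> t i)"
  obtains e' where "0 < e'" "e' \<le> e" "\<And>t. \<bar>t\<bar> < e' \<Longrightarrow> \<gamma> t \<in> T"
proof -
  have "continuous_on {-e<..<e} \<gamma>"
  proof (rule continuous_on_coordinatewise_then_product)
    fix i
    have "isCont (\<lambda>t. \<gamma> t i) t" if "t \<in> {-e<..<e}" for t
      by (rule DERIV_isCont[OF smooth_within_DERIV[OF assms(4)]]) (use that in auto)
    then show "continuous_on {-e<..<e} (\<lambda>t. \<gamma> t i)" by (simp add: continuous_at_imp_continuous_on)
  qed
  then have "open ({-e<..<e} \<inter> \<gamma> -` T)"
    by (rule continuous_open_preimage) (use assms in auto)
  moreover have "0 \<in> {-e<..<e} \<inter> \<gamma> -` T" using assms by auto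
  ultimately obtain d where d: "d > 0" "\<And>t. dist t 0 < d \<Longrightarrow> t \<in> {-e<..<e} \<inter> \<gamma> -` T"
    unfolding open_dist by metis
  show ?thesis
    by (rule that[of "min d e"]) (use d assms(3) in \<open>auto simp: dist_real_def\<close>)
qed

text \<open>The chain rule expresses the derivative of \<open>g (\<gamma> t)\<close> by products of the same kind of functions with
  the components of the velocity. So the generated algebra is again the right coinductive family.\<close>

inductive curve_alg :: "real \<Rightarrow> ('n::finite \<Rightarrow> real) set \<Rightarrow> (real \<Rightarrow> 'n \<Rightarrow> real) \<Rightarrow> (real \<Rightarrow> real) \<Rightarrow> bool"
  for e W \<gamma> where
  base: "smooth_within e f \<Longrightarrow> curve_alg e W \<gamma> f"
| comp: "smooth_fun UNIV W g \<Longrightarrow> curve_alg e W \<gamma> (\<lambda>t. g (\<gamma> t))"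
| add: "curve_alg e W \<gamma> f \<Longrightarrow> curve_alg e W \<gamma> g \<Longrightarrow> curve_alg e W \<gamma> (\<lambda>t. f t + g t)"
| mult: "curve_alg e W \<gamma> f \<Longrightarrow> curve_alg e W \<gamma> g \<Longrightarrow> curve_alg e W \<gamma> (\<lambda>t. f t * g t)"

lemma curve_alg_sum: "(\<And>i. i \<in> I \<Longrightarrow> curve_alg e W \<gamma> (f i)) \<Longrightarrow> curve_alg e W \<gamma> (\<lambda>t. \<Sum>i\<in>I. f i t)"
proof (induction I rule: infinite_finite_induct)
  case (insert x F)
  then have "curve_alg e W \<gamma> (f x)" "curve_alg e W \<gamma> (\<lambda>t. \<Sum>i\<in>F. f i t)" by auto
  from curve_alg.add[OF this] insert.hyps show ?case by simp
qed (simp_all add: curve_alg.base[OF smooth_within_const])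

lemma curve_alg_smooth:
  assumes box: "box_open UNIV W" and W: "\<And>t. \<bar>t\<bar> < e \<Longrightarrow> \<gamma> t \<in> W"
    and \<gamma>: "\<And>i. smooth_within e (\<lambda>t. \<gamma> t i)" and f: "curve_alg e W \<gamma> f"
  shows "smooth_within e f"
proof -
  have *: "\<exists>h. curve_alg e W \<gamma> h \<and> (\<forall>t. \<bar>t\<bar> < e \<longrightarrow> (g has_real_derivative h t) (at t))"
    if "curve_alg e W \<gamma> g" for g
    using that
  proof induction
    case (base f)
    show ?case using curve_alg.base[OF smooth_within_deriv[OF base]] smooth_within_DERIV[OF base] by blast
  next
    case (comp g)
    have "curve_alg e W \<gamma> (\<lambda>t. \<Sum>i\<in>UNIV. pd i g (\<gamma> t) * deriv (\<lambda>t. \<gamma> t i) t)"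
    proof (rule curve_alg_sum)
      fix i
      show "curve_alg e W \<gamma> (\<lambda>t. pd i g (\<gamma> t) * deriv (\<lambda>t. \<gamma> t i) t)"
        by (rule curve_alg.mult[OF curve_alg.comp[OF smooth_fun_pd[OF comp UNIV_I]]
              curve_alg.base[OF smooth_within_deriv[OF \<gamma>]]])
    qed
    moreover have "((\<lambda>t. g (\<gamma> t)) has_real_derivative
        (\<Sum>i\<in>UNIV. pd i g (\<gamma> t) * deriv (\<lambda>t. \<gamma> t i) t)) (at t)" if "\<bar>t\<bar> < e" for t
      by (rule chain_rule_curve[OF box comp W[OF that] smooth_within_DERIV[OF \<gamma> that]])
    ultimately show ?case by blast
  next
    case (add f g)
    then obtain f' g' where h: "curve_alg e W \<gamma> f'" "\<forall>t. \<bar>t\<bar> < e \<longrightarrow> (f has_real_derivative f' t) (at t)"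
      "curve_alg e W \<gamma> g'" "\<forall>t. \<bar>t\<bar> < e \<longrightarrow> (g has_real_derivative g' t) (at t)" by auto
    show ?case
      by (intro exI[of _ "\<lambda>t. f' t + g' t"] conjI curve_alg.add[OF h(1,3)])
        (use h in \<open>auto intro: DERIV_add\<close>)
  next
    case (mult f g)
    then obtain f' g' where h: "curve_alg e W \<gamma> f'" "\<forall>t. \<bar>t\<bar> < e \<longrightarrow> (f has_real_derivative f' t) (at t)"
      "curve_alg e W \<gamma> g'" "\<forall>t. \<bar>t\<bar> < e \<longrightarrow> (g has_real_derivative g' t) (at t)" by auto
    show ?case
      by (intro exI[of _ "\<lambda>t. f' t * g t + g' t * f t"] conjI
          curve_alg.add[OF curve_alg.mult[OF h(1) mult(2)] curve_alg.mult[OF h(3) mult(1)]])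
        (use h in \<open>auto intro: DERIV_mult\<close>)
  qed
  show ?thesis
  proof (rule smooth_within_coinduct[of "curve_alg e W \<gamma>", OF f])
    fix g and t :: real assume "curve_alg e W \<gamma> g" "\<bar>t\<bar> < e"
    then show "g differentiable (at t)" using * real_differentiable_def by blast
  next
    fix g assume "curve_alg e W \<gamma> g"
    then show "\<exists>h. curve_alg e W \<gamma> h \<and> (\<forall>t. \<bar>t\<bar> < e \<longrightarrow> deriv g t = h t)"
      using * DERIV_imp_deriv by blast
  qed
qed

lemma smooth_within_comp:
  fixes \<gamma> :: "real \<Rightarrow> 'n::finite \<Rightarrow> real"
  assumes "box_open UNIV W" "\<And>t. \<bar>t\<bar> < e \<Longrightarrow> \<gamma> t \<in> W" "\<And>i. smooth_within e (\<lambda>t. \<gamma> t i)"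
    "smooth_fun UNIV W g"
  shows "smooth_within e (\<lambda>t. g (\<gamma> t))"
  by (rule curve_alg_smooth[OF assms(1-3) curve_alg.comp[OF assms(4)]])

lemma
  assumes "smooth_within e f" "smooth_within e g"
  shows smooth_within_add: "smooth_within e (\<lambda>t. f t + g t)"
    and smooth_within_mult: "smooth_within e (\<lambda>t. f t * g t)"
proof -
  \<comment> \<open>any smooth curve would serve; this one is constant, in one dimension\<close>
  have *: "smooth_within e h" if "curve_alg e UNIV (\<lambda>t. \<lambda>i :: unit. 0) h" for h
    by (rule curve_alg_smooth[OF _ _ smooth_within_const that]) (auto simp: box_open_def zero_less_one intro!: exI[of _ 1])
  show "smooth_within e (\<lambda>t. f t + g t)"
    by (rule *[OF curve_alg.add[OF curve_alg.base[OF assms(1)] curve_alg.base[OF assms(2)]]])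
  show "smooth_within e (\<lambda>t. f t * g t)"
    by (rule *[OF curve_alg.mult[OF curve_alg.base[OF assms(1)] curve_alg.base[OF assms(2)]]])
qed

subsection \<open>Contact of curves\<close>

definition contact :: "nat \<Rightarrow> (real \<Rightarrow> real) \<Rightarrow> (real \<Rightarrow> real) \<Rightarrow> bool" where
  "contact m g h \<longleftrightarrow> (\<forall>j\<le>m. (deriv ^^ j) g 0 = (deriv ^^ j) h 0)"

lemma contact_0: "contact 0 g h \<longleftrightarrow> g 0 = h 0"
  by (simp add: contact_def)

lemma contact_Suc: "contact (Suc m) g h \<longleftrightarrow> g 0 = h 0 \<and> contact m (deriv g) (deriv h)"
proof -
  have "contact (Suc m) g h \<longleftrightarrow> (\<forall>j<Suc (Suc m). (deriv ^^ j) g 0 = (deriv ^^ j) h 0)"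
    by (simp add: contact_def less_Suc_eq_le)
  also have "\<dots> \<longleftrightarrow> g 0 = h 0 \<and> (\<forall>j<Suc m. (deriv ^^ Suc j) g 0 = (deriv ^^ Suc j) h 0)"
    by (subst All_less_Suc2) simp
  finally show ?thesis
    by (simp add: contact_def less_Suc_eq_le funpow_Suc_right del: funpow.simps)
qed

lemma contact_le: "contact m g h \<Longrightarrow> l \<le> m \<Longrightarrow> contact l g h"
  by (simp add: contact_def)

lemma contact_sym: "contact m g h \<longleftrightarrow> contact m h g"
  unfolding contact_def by auto

lemma contact_trans: "contact m f g \<Longrightarrow> contact m g h \<Longrightarrow> contact m f h"
  unfolding contact_def by auto

lemma contact_cong:
  assumes "0 < e" "\<And>t. \<bar>t\<bar> < e \<Longrightarrow> g t = g' t" "\<And>t. \<bar>t\<bar> < e \<Longrightarrow> h t = h' t"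
  shows "contact m g h \<longleftrightarrow> contact m g' h'"
proof -
  have ev: "eventually (\<lambda>s. \<bar>s\<bar> < e) (nhds (0 :: real))" using assms(1) by (intro eventually_abs_less) simp
  have "(deriv ^^ j) g 0 = (deriv ^^ j) g' 0" "(deriv ^^ j) h 0 = (deriv ^^ j) h' 0" for j
    by (rule higher_deriv_cong_ev; use eventually_mono[OF ev] assms(2,3) in auto)+
  then show ?thesis by (simp add: contact_def)
qed

lemma contact_add:
  assumes "0 < e" "smooth_within e g" "smooth_within e g'" "smooth_within e h" "smooth_within e h'"
    "contact m g g'" "contact m h h'"
  shows "contact m (\<lambda>t. g t + h t) (\<lambda>t. g' t + h' t)"
  using assms(2-)
proof (induction m arbitrary: g g' h h')
  case 0 then show ?case by (simp add: contact_0)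
next
  case (Suc m)
  have "contact m (\<lambda>t. deriv g t + deriv h t) (\<lambda>t. deriv g' t + deriv h' t)"
    by (rule Suc.IH) (use Suc.prems in \<open>auto simp: contact_Suc intro: smooth_within_deriv\<close>)
  also have "?this \<longleftrightarrow> contact m (deriv (\<lambda>t. g t + h t)) (deriv (\<lambda>t. g' t + h' t))"
    by (rule contact_cong[OF assms(1)])
      (use Suc.prems in \<open>auto intro!: DERIV_imp_deriv[symmetric] DERIV_add smooth_within_DERIV\<close>)
  finally show ?case using Suc.prems by (simp add: contact_Suc)
qed

lemma contact_mult:
  assumes "0 < e" "smooth_within e g" "smooth_within e g'" "smooth_within e h" "smooth_within e h'"
    "contact m g g'" "contact m h h'"
  shows "contact m (\<lambda>t. g t * h t) (\<lambda>t. g' t * h' t)"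
  using assms(2-)
proof (induction m arbitrary: g g' h h')
  case 0 then show ?case by (simp add: contact_0)
next
  case (Suc m)
  note c = Suc.prems[unfolded contact_Suc] contact_le[OF Suc.prems(5), of m] contact_le[OF Suc.prems(6), of m]
  have "contact m (\<lambda>t. deriv g t * h t + deriv h t * g t) (\<lambda>t. deriv g' t * h' t + deriv h' t * g' t)"
    by (rule contact_add[OF assms(1)])
      (use c in \<open>auto intro!: smooth_within_mult smooth_within_deriv Suc.IH\<close>)
  also have "?this \<longleftrightarrow> contact m (deriv (\<lambda>t. g t * h t)) (deriv (\<lambda>t. g' t * h' t))"
    by (rule contact_cong[OF assms(1)])
      (use Suc.prems in \<open>auto intro!: DERIV_imp_deriv[symmetric] DERIV_mult smooth_within_DERIV\<close>)
  finally show ?case using c by (simp add: contact_Suc)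
qed

lemma smooth_within_sum:
  "(\<And>i. i \<in> I \<Longrightarrow> smooth_within e (g i)) \<Longrightarrow> smooth_within e (\<lambda>t. \<Sum>i\<in>I. g i t)"
proof (induction I rule: infinite_finite_induct)
  case (insert x F)
  then show ?case using smooth_within_add[of e "g x" "\<lambda>t. \<Sum>i\<in>F. g i t"] by simp
qed (simp_all add: smooth_within_const)

lemma contact_sum:
  assumes "0 < e" "\<And>i. i \<in> I \<Longrightarrow> smooth_within e (g i) \<and> smooth_within e (h i) \<and> contact m (g i) (h i)"
  shows "contact m (\<lambda>t. \<Sum>i\<in>I. g i t) (\<lambda>t. \<Sum>i\<in>I. h i t)"
  using assms(2)
proof (induction I rule: infinite_finite_induct)
  case (insert x F)
  then show ?case
    using contact_add[OF assms(1), of "g x" "h x" "\<lambda>t. \<Sum>i\<in>F. g i t" "\<lambda>t. \<Sum>i\<in>F. h i t" m]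
      smooth_within_sum[of F e g] smooth_within_sum[of F e h] by simp
qed (simp_all add: contact_def)

text \<open>Contact of order \<open>m\<close> is preserved by smooth maps. Induction on \<open>m\<close>, for all maps \<open>g\<close> at once: by the
  chain rule the derivative of \<open>g (\<gamma> t)\<close> consists of the partial derivatives of \<open>g\<close> along \<open>\<gamma>\<close>, which
  have contact of one order less by the induction hypothesis, and of the velocity components.\<close>

lemma contact_comp:
  fixes \<gamma> \<gamma>' :: "real \<Rightarrow> 'n::finite \<Rightarrow> real"
  assumes e: "0 < e" and box: "box_open UNIV W"
    and W: "\<And>t. \<bar>t\<bar> < e \<Longrightarrow> \<gamma> t \<in> W" "\<And>t. \<bar>t\<bar> < e \<Longrightarrow> \<gamma>' t \<in> W"
    and s: "\<And>i. smooth_within e (\<lambda>t. \<gamma> t i)" "\<And>i. smooth_within e (\<lambda>t. \<gamma>' t i)"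
    and c: "\<And>i. contact m (\<lambda>t. \<gamma> t i) (\<lambda>t. \<gamma>' t i)" and g: "smooth_fun UNIV W g"
  shows "contact m (\<lambda>t. g (\<gamma> t)) (\<lambda>t. g (\<gamma>' t))"
  using c g
proof (induction m arbitrary: g)
  case 0
  then have "\<gamma> 0 = \<gamma>' 0" by (auto simp: contact_0)
  then show ?case by (simp add: contact_0)
next
  case (Suc m)
  have "contact m (\<lambda>t. \<Sum>i\<in>UNIV. pd i g (\<gamma> t) * deriv (\<lambda>t. \<gamma> t i) t)
      (\<lambda>t. \<Sum>i\<in>UNIV. pd i g (\<gamma>' t) * deriv (\<lambda>t. \<gamma>' t i) t)"
  proof (rule contact_sum[OF e], intro conjI)
    fix i
    note p = smooth_fun_pd[OF Suc.prems(2) UNIV_I[of i]]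
    note q = smooth_within_comp[OF box W(1) s(1) p] smooth_within_comp[OF box W(2) s(2) p]
      smooth_within_deriv[OF s(1)] smooth_within_deriv[OF s(2)]
    show "smooth_within e (\<lambda>t. pd i g (\<gamma> t) * deriv (\<lambda>t. \<gamma> t i) t)"
      by (rule smooth_within_mult[OF q(1,3)])
    show "smooth_within e (\<lambda>t. pd i g (\<gamma>' t) * deriv (\<lambda>t. \<gamma>' t i) t)"
      by (rule smooth_within_mult[OF q(2,4)])
    have "contact m (\<lambda>t. pd i g (\<gamma> t)) (\<lambda>t. pd i g (\<gamma>' t))"
      by (rule Suc.IH[OF contact_le[OF Suc.prems(1)] p]) simp
    then show "contact m (\<lambda>t. pd i g (\<gamma> t) * deriv (\<lambda>t. \<gamma> t i) t)
        (\<lambda>t. pd i g (\<gamma>' t) * deriv (\<lambda>t. \<gamma>' t i) t)"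
      using Suc.prems(1) by (intro contact_mult[OF e q]) (auto simp: contact_Suc)
  qed
  also have "?this \<longleftrightarrow> contact m (deriv (\<lambda>t. g (\<gamma> t))) (deriv (\<lambda>t. g (\<gamma>' t)))"
  proof (rule contact_cong[OF e])
    fix t assume t: "\<bar>t\<bar> < e"
    show "(\<Sum>i\<in>UNIV. pd i g (\<gamma> t) * deriv (\<lambda>t. \<gamma> t i) t) = deriv (\<lambda>t. g (\<gamma> t)) t"
      by (rule DERIV_imp_deriv[symmetric, OF chain_rule_curve[OF box Suc.prems(2) W(1)[OF t] smooth_within_DERIV[OF s(1) t]]])
    show "(\<Sum>i\<in>UNIV. pd i g (\<gamma>' t) * deriv (\<lambda>t. \<gamma>' t i) t) = deriv (\<lambda>t. g (\<gamma>' t)) t"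
      by (rule DERIV_imp_deriv[symmetric, OF chain_rule_curve[OF box Suc.prems(2) W(2)[OF t] smooth_within_DERIV[OF s(2) t]]])
  qed
  finally have "contact m (deriv (\<lambda>t. g (\<gamma> t))) (deriv (\<lambda>t. g (\<gamma>' t)))" .
  moreover have "\<gamma> 0 = \<gamma>' 0" using Suc.prems(1) by (auto simp: contact_Suc)
  ultimately show ?case by (simp add: contact_Suc)
qed

lemma higher_deriv_poly_0:
  fixes p :: "real poly"
  shows "(deriv ^^ m) (poly p) 0 = fact m * coeff p m"
proof -
  have "(deriv ^^ m) (poly p) = poly ((pderiv ^^ m) p)"
  proof (induction m)
    case (Suc m)
    have "deriv (poly ((pderiv ^^ m) p)) t = poly (pderiv ((pderiv ^^ m) p)) t" for t
      by (rule DERIV_imp_deriv) simp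
    then show ?case using Suc by auto
  qed simp
  then show ?thesis by (simp add: poly_0_coeff_0 coeff_higher_pderiv pochhammer_fact[symmetric])
qed

section \<open>Induced charts on jet spaces\<close>

text \<open>The image of the induced chart, as \<open>jimg_eq\<close> shows.\<close>

definition jet_range :: "nat \<Rightarrow> ('a, 'n) chart \<Rightarrow> 'n pt set" where
  "jet_range r ch = {z. (\<lambda>i. z (0, i)) \<in> snd ch ` fst ch \<and> (\<exists>i. z (1, i) \<noteq> 0) \<and>
     (\<forall>\<gamma> i. r < \<gamma> \<longrightarrow> z (\<gamma>, i) = 0)}"

text \<open>The projection from jets of higher order to jets of order \<open>k\<close>, in induced coordinates.\<close>

definition truncate :: "nat \<Rightarrow> 'n pt \<Rightarrow> 'n pt" where
  "truncate k z = (\<lambda>(\<gamma>, i). if \<gamma> \<le> k then z (\<gamma>, i) else 0)"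

locale smooth_manifold =
  fixes A :: "('a::{t2_space, second_countable_topology}, 'n::finite) chart set"
  assumes atlas: "smooth_atlas A"
begin

lemma chart:
  assumes "(U, \<phi>) \<in> A"
  shows "open U" "open (\<phi> ` U)" "homeomorphism U (\<phi> ` U) \<phi> (inv_into U \<phi>)" "inj_on \<phi> U"
proof -
  show "open U" "open (\<phi> ` U)" and h: "homeomorphism U (\<phi> ` U) \<phi> (inv_into U \<phi>)"
    using atlas assms unfolding smooth_atlas_def by auto
  show "inj_on \<phi> U" using h unfolding homeomorphism_def by (metis inj_on_inverseI)
qed

lemma overlap:
  assumes "(U, \<phi>) \<in> A" "(V, \<psi>) \<in> A"
  shows "open (\<phi> ` (U \<inter> V))" "smooth_fun UNIV (\<phi> ` (U \<inter> V)) (\<lambda>x. \<psi> (inv_into U \<phi> x) i)"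
proof -
  have "openin (top_of_set U) (U \<inter> V)" using chart(1)[OF assms(2)] by auto
  from homeomorphism_imp_open_map[OF chart(3)[OF assms(1)] this]
  show "open (\<phi> ` (U \<inter> V))" using openin_open_eq[OF chart(2)[OF assms(1)]] by blast
  show "smooth_fun UNIV (\<phi> ` (U \<inter> V)) (\<lambda>x. \<psi> (inv_into U \<phi> x) i)"
    using atlas assms unfolding smooth_atlas_def by blast
qed

lemma curvesD:
  assumes "c \<in> curves A" "(U, \<phi>) \<in> A" "c 0 \<in> U"
  obtains e where "0 < e" "\<And>t. \<bar>t\<bar> < e \<Longrightarrow> c t \<in> U" "\<And>i. smooth_within e (\<lambda>t. \<phi> (c t) i)"
proof -
  have "\<exists>e>0. \<forall>t. \<bar>t\<bar> < e \<longrightarrow> c t \<in> U \<and> (\<forall>m i. (deriv ^^ m) (\<lambda>s. \<phi> (c s) i) differentiable (at t))"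
    using assms unfolding curves_def by blast
  then obtain e where "e > 0" "\<And>t. \<bar>t\<bar> < e \<Longrightarrow> c t \<in> U"
      "\<And>t m i. \<bar>t\<bar> < e \<Longrightarrow> (deriv ^^ m) (\<lambda>s. \<phi> (c s) i) differentiable (at t)" by blast
  then show ?thesis using that[of e] by (simp add: smooth_within_def)
qed

lemma curvesI:
  assumes "\<And>U \<phi>. (U, \<phi>) \<in> A \<Longrightarrow> c 0 \<in> U \<Longrightarrow> \<exists>e>0. (\<forall>t. \<bar>t\<bar> < e \<longrightarrow> c t \<in> U) \<and>
    (\<forall>i. smooth_within e (\<lambda>t. \<phi> (c t) i))"
  shows "c \<in> curves A"
  unfolding curves_def
proof safe
  fix U \<phi> assume "(U, \<phi>) \<in> A" "c 0 \<in> U"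
  from assms[OF this] show "\<exists>e>0. \<forall>t. \<bar>t\<bar> < e \<longrightarrow> c t \<in> U \<and>
      (\<forall>m i. (deriv ^^ m) (\<lambda>s. \<phi> (c s) i) differentiable (at t))"
    unfolding smooth_within_def by blast
qed

lemma const_curve: "(\<lambda>t. x) \<in> curves A"
  by (rule curvesI) (auto intro!: exI[of _ "1 :: real"] smooth_within_const)

text \<open>Contact in one chart implies contact in every other, since the transition map is smooth.\<close>

lemma contact_change_chart:
  assumes c: "c \<in> curves A" "c' \<in> curves A" and 0: "c 0 = c' 0" "c 0 \<in> U" "c 0 \<in> V"
    and ch: "(U, \<phi>) \<in> A" "(V, \<psi>) \<in> A"
    and con: "\<And>i. contact m (\<lambda>t. \<phi> (c t) i) (\<lambda>t. \<phi> (c' t) i)"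
  shows "contact m (\<lambda>t. \<psi> (c t) i) (\<lambda>t. \<psi> (c' t) i)"
proof -
  have *: "\<exists>e>0. (\<forall>t. \<bar>t\<bar> < e \<longrightarrow> c t \<in> U \<inter> V) \<and> (\<forall>i. smooth_within e (\<lambda>t. \<phi> (c t) i))"
    if cUV: "c \<in> curves A" "c 0 \<in> U" "c 0 \<in> V" for c
  proof -
    obtain e1 where e1: "0 < e1" "\<And>t. \<bar>t\<bar> < e1 \<Longrightarrow> c t \<in> U" "\<And>i. smooth_within e1 (\<lambda>t. \<phi> (c t) i)"
      using curvesD[OF cUV(1) ch(1) cUV(2)] by metis
    obtain e2 where e2: "0 < e2" "\<And>t. \<bar>t\<bar> < e2 \<Longrightarrow> c t \<in> V"
      using curvesD[OF cUV(1) ch(2) cUV(3)] by metis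
    show ?thesis
      by (rule exI[of _ "min e1 e2"]) (use e1 e2 smooth_within_mono[OF e1(3)] in auto)
  qed
  obtain e1 where e1: "0 < e1" "\<And>t. \<bar>t\<bar> < e1 \<Longrightarrow> c t \<in> U \<inter> V" "\<And>i. smooth_within e1 (\<lambda>t. \<phi> (c t) i)"
    using *[OF c(1) 0(2,3)] by blast
  obtain e2 where e2: "0 < e2" "\<And>t. \<bar>t\<bar> < e2 \<Longrightarrow> c' t \<in> U \<inter> V" "\<And>i. smooth_within e2 (\<lambda>t. \<phi> (c' t) i)"
    using *[OF c(2)] 0 by auto
  define e where "e = min e1 e2"
  have e: "0 < e" "\<And>t. \<bar>t\<bar> < e \<Longrightarrow> c t \<in> U \<inter> V" "\<And>t. \<bar>t\<bar> < e \<Longrightarrow> c' t \<in> U \<inter> V"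
    "\<And>i. smooth_within e (\<lambda>t. \<phi> (c t) i)" "\<And>i. smooth_within e (\<lambda>t. \<phi> (c' t) i)"
    using e1 e2 smooth_within_mono[OF e1(3)] smooth_within_mono[OF e2(3)] by (auto simp: e_def)
  have "contact m (\<lambda>t. \<psi> (inv_into U \<phi> (\<phi> (c t))) i) (\<lambda>t. \<psi> (inv_into U \<phi> (\<phi> (c' t))) i)"
    by (rule contact_comp[OF e(1) box_open_open[OF overlap(1)[OF ch]] _ _ e(4,5) con overlap(2)[OF ch]])
      (use e in auto)
  also have "?this \<longleftrightarrow> contact m (\<lambda>t. \<psi> (c t) i) (\<lambda>t. \<psi> (c' t) i)"
    by (rule contact_cong[OF e(1)]) (use e chart(4)[OF ch(1)] in \<open>auto simp: inv_into_f_f\<close>)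
  finally show ?thesis .
qed

lemma jet_of_alt: "jet_of A r c = {c' \<in> curves A. c' 0 = c 0 \<and>
    (\<forall>(U, \<phi>)\<in>A. c 0 \<in> U \<longrightarrow> (\<forall>i. contact r (\<lambda>t. \<phi> (c' t) i) (\<lambda>t. \<phi> (c t) i)))}"
  unfolding jet_of_def contact_def by fastforce

lemma contact_jet:
  assumes "c' \<in> jet_of A r c" "(U, \<phi>) \<in> A" "c 0 \<in> U"
  shows "contact r (\<lambda>t. \<phi> (c' t) i) (\<lambda>t. \<phi> (c t) i)"
  using assms unfolding jet_of_alt by blast

lemma jet_of_eq:
  assumes "c' \<in> jet_of A r c"
  shows "jet_of A r c' = jet_of A r c"
proof -
  have 0: "c' 0 = c 0" using assms by (simp add: jet_of_alt)
  have *: "contact r (\<lambda>t. \<phi> (c' t) i) (\<lambda>t. \<phi> (c t) i)" if "(U, \<phi>) \<in> A" "c 0 \<in> U" for U \<phi> i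
    using contact_jet[OF assms that] .
  show ?thesis
    unfolding jet_of_alt 0 using * contact_trans contact_sym by (auto; blast)
qed

lemma repr_jet:
  assumes "p \<in> TM A r"
  shows "repr p \<in> curves A" "jet_of A r (repr p) = p"
proof -
  obtain c where c: "c \<in> curves A" "p = jet_of A r c" using assms by (auto simp: TM_def)
  then have "c \<in> p" by (auto simp: jet_of_alt contact_def)
  then have r: "repr p \<in> p" unfolding repr_def by (rule someI[of "\<lambda>c. c \<in> p"])
  then show "repr p \<in> curves A" using c by (simp add: jet_of_alt)
  show "jet_of A r (repr p) = p" using jet_of_eq r c by blast
qed

lemma repr_jet_of:
  assumes "c \<in> curves A"
  shows "jet_of A r c \<in> TM A r" "repr (jet_of A r c) \<in> jet_of A r c" "base (jet_of A r c) = c 0"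
proof -
  have "c \<in> jet_of A r c" using assms by (auto simp: jet_of_alt contact_def)
  then show r: "repr (jet_of A r c) \<in> jet_of A r c" unfolding repr_def by (rule someI[of "\<lambda>c'. c' \<in> jet_of A r c"])
  then show "base (jet_of A r c) = c 0" by (simp add: base_def jet_of_alt)
  show "jet_of A r c \<in> TM A r" using assms by (simp add: TM_def)
qed

lemma ycoord_jet_of:
  assumes "c \<in> curves A" "(U, \<phi>) \<in> A" "c 0 \<in> U" "\<alpha> \<le> r"
  shows "ycoord \<phi> \<alpha> i (jet_of A r c) = (deriv ^^ \<alpha>) (\<lambda>t. \<phi> (c t) i) 0 / fact \<alpha>"
  using contact_jet[OF repr_jet_of(2)[OF assms(1)] assms(2,3)] assms(4)
  unfolding ycoord_def contact_def by simp

lemma ycoord_0: "ycoord \<phi> 0 i p = \<phi> (base p) i"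
  by (simp add: ycoord_def base_def)

lemma jet_eqI:
  assumes p: "p \<in> TM A r" "q \<in> TM A r" and U: "(U, \<phi>) \<in> A" "base p \<in> U" "base q \<in> U"
    and eq: "\<And>\<alpha> i. \<alpha> \<le> r \<Longrightarrow> ycoord \<phi> \<alpha> i p = ycoord \<phi> \<alpha> i q"
  shows "p = q"
proof -
  have "\<phi> (base p) = \<phi> (base q)" using eq[of 0] by (auto simp: ycoord_0)
  then have b: "repr p 0 = repr q 0"
    using chart(4)[OF U(1)] U(2,3) by (auto simp: inj_on_def base_def)
  have con: "contact r (\<lambda>t. \<phi> (repr p t) i) (\<lambda>t. \<phi> (repr q t) i)" for i
    using eq by (auto simp: contact_def ycoord_def)
  have "repr p \<in> jet_of A r (repr q)"
    unfolding jet_of_alt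
  proof (safe)
    show "repr p \<in> curves A" "repr p 0 = repr q 0" using repr_jet p b by auto
    fix V \<psi> i assume V: "(V, \<psi>) \<in> A" "repr q 0 \<in> V"
    show "contact r (\<lambda>t. \<psi> (repr p t) i) (\<lambda>t. \<psi> (repr q t) i)"
      by (rule contact_change_chart[OF repr_jet(1)[OF p(1)] repr_jet(1)[OF p(2)] b _ _ U(1) V(1) con])
        (use U V b in \<open>auto simp: base_def\<close>)
  qed
  then show ?thesis using jet_of_eq repr_jet(2) p by metis
qed

text \<open>A velocity that vanishes in another chart is contact of order 1 with a constant curve there, hence
  also in the given chart.\<close>

lemma T0I:
  assumes p: "p \<in> TM A r" and U: "(U, \<phi>) \<in> A" "base p \<in> U" and nz: "ycoord \<phi> 1 i p \<noteq> 0"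
  shows "p \<in> T0 A r"
  unfolding T0_def
proof safe
  show "p \<in> TM A r" by fact
  fix V \<psi> assume V: "(V, \<psi>) \<in> A" "base p \<in> V"
  show "\<exists>i. ycoord \<psi> 1 i p \<noteq> 0"
  proof (rule ccontr)
    assume "\<not> ?thesis"
    then have "contact 1 (\<lambda>t. \<psi> (repr p t) i) (\<lambda>t. \<psi> (base p) i)" for i
      by (auto simp: contact_Suc contact_0 ycoord_def base_def)
    from contact_change_chart[OF repr_jet(1)[OF p] const_curve _ _ _ V(1) U(1) this, of i]
    have "contact 1 (\<lambda>t. \<phi> (repr p t) i) (\<lambda>t. \<phi> (base p) i)" using U V by (simp add: base_def)
    then show False using nz by (simp add: contact_Suc contact_0 ycoord_def)
  qed
qed

lemma icoord_inj: "ch \<in> A \<Longrightarrow> inj_on (icoord r ch) (jdom A r ch)"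
proof (rule inj_onI)
  fix p q assume ch: "ch \<in> A" and pq: "p \<in> jdom A r ch" "q \<in> jdom A r ch" "icoord r ch p = icoord r ch q"
  have "ycoord (snd ch) \<alpha> i p = ycoord (snd ch) \<alpha> i q" if "\<alpha> \<le> r" for \<alpha> i
    using fun_cong[OF pq(3), of "(\<alpha>, i)"] that by (simp add: icoord_def)
  then show "p = q"
    using jet_eqI[of p r q "fst ch" "snd ch"] ch pq(1,2) by (auto simp: jdom_def T0_def)
qed

text \<open>Taylor polynomials realise all coordinates. Outside a neighbourhood of 0 the polynomial may leave the
  chart; the values of the curve there are arbitrary.\<close>

lemma curve_with_jet:
  assumes ch: "(U, \<phi>) \<in> A" and z: "(\<lambda>i. z (0, i)) \<in> \<phi> ` U"
  obtains c where "c \<in> curves A" "c 0 \<in> U"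
    "\<And>\<alpha> i. \<alpha> \<le> r \<Longrightarrow> (deriv ^^ \<alpha>) (\<lambda>t. \<phi> (c t) i) 0 / fact \<alpha> = z (\<alpha>, i)"
proof -
  define q where "q i = (\<Sum>\<alpha>\<le>r. monom (z (\<alpha>, i)) \<alpha>)" for i
  have coeff_q: "coeff (q i) \<alpha> = z (\<alpha>, i)" if "\<alpha> \<le> r" for i \<alpha>
    using that by (simp add: q_def coeff_sum coeff_monom)
  define \<pi> where "\<pi> t = (\<lambda>i. poly (q i) t)" for t
  have \<pi>_smooth: "smooth_within e (\<lambda>t. \<pi> t i)" for e i
    unfolding \<pi>_def by (rule smooth_within_poly)
  have \<pi>0: "\<pi> 0 = (\<lambda>i. z (0, i))" by (simp add: \<pi>_def poly_0_coeff_0 coeff_q)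
  define c where "c t = inv_into U \<phi> (\<pi> t)" for t
  have c0: "c 0 \<in> U" "\<phi> (c 0) = \<pi> 0" unfolding c_def \<pi>0 using z by (auto intro: inv_into_into f_inv_into_f)
  have near: "\<exists>e>0. \<forall>t. \<bar>t\<bar> < e \<longrightarrow> \<pi> t \<in> T" if T: "open T" "\<pi> 0 \<in> T" for T
    using eventually_curve_in[OF T zero_less_one \<pi>_smooth] by blast
  have "c \<in> curves A"
  proof (rule curvesI)
    fix V \<psi> assume V: "(V, \<psi>) \<in> A" "c 0 \<in> V"
    have "\<pi> 0 \<in> \<phi> ` (U \<inter> V)" using c0 V(2) by (metis IntI imageI)
    then obtain e where e: "0 < e" "\<And>t. \<bar>t\<bar> < e \<Longrightarrow> \<pi> t \<in> \<phi> ` (U \<inter> V)"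
      using near[OF overlap(1)[OF ch V(1)]] by blast
    have "c t \<in> V" if te: "\<bar>t\<bar> < e" for t
    proof -
      obtain x where "x \<in> U \<inter> V" "\<pi> t = \<phi> x" using e(2)[OF te] by auto
      then show ?thesis unfolding c_def using chart(4)[OF ch] by (simp add: inv_into_f_f)
    qed
    moreover have "smooth_within e (\<lambda>t. \<psi> (c t) i)" for i
      unfolding c_def
      by (rule smooth_within_comp[OF box_open_open[OF overlap(1)[OF ch V(1)]] e(2) \<pi>_smooth overlap(2)[OF ch V(1)]])
    ultimately show "\<exists>e>0. (\<forall>t. \<bar>t\<bar> < e \<longrightarrow> c t \<in> V) \<and> (\<forall>i. smooth_within e (\<lambda>t. \<psi> (c t) i))"
      using e(1) by blast
  qed
  moreover have "(deriv ^^ \<alpha>) (\<lambda>t. \<phi> (c t) i) 0 / fact \<alpha> = z (\<alpha>, i)" if "\<alpha> \<le> r" for \<alpha> i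
  proof -
    obtain e where e: "0 < e" "\<And>t. \<bar>t\<bar> < e \<Longrightarrow> \<pi> t \<in> \<phi> ` U"
      using near[OF chart(2)[OF ch]] z \<pi>0 by auto
    have "eventually (\<lambda>t. \<phi> (c t) i = poly (q i) t) (nhds 0)"
      by (rule eventually_mono[OF eventually_abs_less[of 0 e]])
        (use e in \<open>auto simp: c_def f_inv_into_f \<pi>_def\<close>)
    from higher_deriv_cong_ev[OF this refl, of \<alpha>] show ?thesis
      using higher_deriv_poly_0[of \<alpha> "q i"] coeff_q[OF that] by simp
  qed
  ultimately show ?thesis using that c0(1) by blast
qed

lemma jimg_eq:
  assumes ch: "ch \<in> A" and r: "1 \<le> r"
  shows "jimg A r ch = jet_range r ch"
proof
  obtain U \<phi> where [simp]: "ch = (U, \<phi>)" by (cases ch)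
  show "jimg A r ch \<subseteq> jet_range r ch"
  proof
    fix z assume "z \<in> jimg A r ch"
    then obtain p where p: "p \<in> T0 A r" "base p \<in> U" "z = icoord r ch p" by (auto simp: jimg_def jdom_def)
    then have "\<exists>i. ycoord \<phi> 1 i p \<noteq> 0" using ch unfolding T0_def by auto
    then show "z \<in> jet_range r ch"
      using p(2,3) r by (auto simp: jet_range_def icoord_def ycoord_0)
  qed
  show "jet_range r ch \<subseteq> jimg A r ch"
  proof
    fix z assume z: "z \<in> jet_range r ch"
    have UA: "(U, \<phi>) \<in> A" using ch by simp
    obtain c where c: "c \<in> curves A" "c 0 \<in> U"
      "\<And>\<alpha> i. \<alpha> \<le> r \<Longrightarrow> (deriv ^^ \<alpha>) (\<lambda>t. \<phi> (c t) i) 0 / fact \<alpha> = z (\<alpha>, i)"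
      using curve_with_jet[OF UA, of z r] z by (auto simp: jet_range_def)
    let ?p = "jet_of A r c"
    have y: "ycoord \<phi> \<alpha> i ?p = z (\<alpha>, i)" if "\<alpha> \<le> r" for \<alpha> i
      using ycoord_jet_of[OF c(1) UA c(2) that] c(3)[OF that] by simp
    obtain i where "z (1, i) \<noteq> 0" using z by (auto simp: jet_range_def)
    then have "?p \<in> T0 A r"
      using T0I[OF repr_jet_of(1)[OF c(1)] UA, of r i] y[OF r, of i] repr_jet_of(3)[OF c(1), of r] c(2) by simp
    then have "?p \<in> jdom A r ch" using repr_jet_of(3)[OF c(1)] c(2) by (simp add: jdom_def)
    moreover have "icoord r ch ?p = z"
      using y z by (auto simp: icoord_def jet_range_def fun_eq_iff)
    ultimately show "z \<in> jimg A r ch" unfolding jimg_def by blast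
  qed
qed

lemma box_open_jet_range:
  assumes ch: "ch \<in> A" shows "box_open (idx r) (jet_range r ch)"
proof -
  let ?G = "(\<lambda>z i. z (0, i)) -` (snd ch ` fst ch) \<inter> (\<Union>i. {z :: 'n pt. z (1, i) \<noteq> 0})"
  have "open ((\<lambda>(z :: 'n pt) i. z (0, i)) -` (snd ch ` fst ch))"
    by (rule open_vimage) (use chart(2)[of "fst ch" "snd ch"] ch in
        \<open>auto intro!: continuous_on_coordinatewise_then_product\<close>)
  moreover have "open {z :: 'n pt. z (1, i) \<noteq> 0}" for i
    by (rule open_Collect_neq) (auto intro!: continuous_intros)
  ultimately have G: "open ?G" by (intro open_Int open_UN) auto
  have "jet_range r ch = {z \<in> ?G. \<forall>c. c \<notin> idx r \<longrightarrow> z c = 0}"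
    by (force simp: jet_range_def idx_def)
  then show ?thesis using box_open_Int_open[OF G, of "idx r"] by (simp add: idx_def)
qed

lemma truncate_jet_range: "1 \<le> k \<Longrightarrow> k \<le> r \<Longrightarrow> truncate k ` jet_range r ch = jet_range k ch"
proof (intro equalityI subsetI)
  fix z assume k: "1 \<le> k" "k \<le> r" and z: "z \<in> jet_range k ch"
  then have "truncate k z = z" "z \<in> jet_range r ch" by (auto simp: jet_range_def truncate_def fun_eq_iff)
  then show "z \<in> truncate k ` jet_range r ch" by force
qed (auto simp: jet_range_def truncate_def)

lemma floc_pull:
  assumes ch: "ch \<in> A" and k: "1 \<le> k" "k \<le> r" and z: "z \<in> jet_range r ch"
  shows "floc A r ch (pull A k F) z = floc A k ch F (truncate k z)"
proof -
  obtain U \<phi> where [simp]: "ch = (U, \<phi>)" by (cases ch)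
  have UA: "(U, \<phi>) \<in> A" using ch by simp
  define p where "p = jinv A r ch z"
  have "z \<in> icoord r ch ` jdom A r ch" using z jimg_eq[OF ch, of r] k by (simp add: jimg_def)
  then have p: "p \<in> jdom A r ch" "icoord r ch p = z"
    unfolding p_def jinv_def by (auto intro: inv_into_into f_inv_into_f)
  have pTM: "p \<in> TM A r" "base p \<in> U" using p(1) by (auto simp: jdom_def T0_def)
  define q where "q = jet_of A k (repr p)"
  note c = repr_jet(1)[OF pTM(1)]
  have q: "q \<in> TM A k" "base q = base p"
    using repr_jet_of[OF c, of k] by (auto simp: q_def base_def)
  have y: "ycoord \<phi> \<alpha> i q = ycoord \<phi> \<alpha> i p" if "\<alpha> \<le> k" for \<alpha> i
    using ycoord_jet_of[OF c UA _ that, of i] pTM(2) by (simp add: q_def ycoord_def base_def)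
  obtain i where "ycoord \<phi> 1 i p \<noteq> 0" using p(1) UA by (auto simp: jdom_def T0_def)
  then have "q \<in> T0 A k" using T0I[OF q(1) UA] q(2) pTM(2) y[OF k(1)] by metis
  then have "q \<in> jdom A k ch" using q(2) pTM(2) by (simp add: jdom_def)
  moreover have "icoord k ch q = truncate k z"
    using y k(2) by (auto simp: icoord_def truncate_def p(2)[symmetric] fun_eq_iff)
  ultimately have "jinv A k ch (truncate k z) = q"
    unfolding jinv_def using icoord_inj[OF ch] by (metis inv_into_f_f)
  then show ?thesis by (simp add: floc_def pull_def jet_proj_def q_def p_def)
qed

end

section \<open>The Liouville fields as derivations\<close>

lemma finite_idx [simp]: "finite (idx r :: (nat \<times> 'n::finite) set)"
  by (simp add: idx_def)

lemma mem_idx [simp]: "(\<gamma>, i) \<in> idx r \<longleftrightarrow> \<gamma> \<le> r"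
  by (simp add: idx_def)

lemma sum_idx: "(\<Sum>a\<in>idx r. g a) = (\<Sum>\<gamma>\<le>r. \<Sum>i\<in>UNIV. g (\<gamma>, i :: 'n::finite))"
  by (simp add: idx_def sum.cartesian_product)

text \<open>The sum in the definition has at most one nonzero term, \<open>\<beta> = \<gamma> + 1 - \<alpha>\<close>; truncated subtraction
  makes the coefficient 0 exactly when there is none. For \<open>\<alpha> = 0\<close> the formula describes the total
  derivative \<open>(\<gamma> + 1) y\<^sup>\<gamma>\<^sup>+\<^sup>1\<close>, the part common to all semisprays.\<close>

lemma liouville_apply:
  assumes "\<gamma> \<le> r"
  shows "liouville r \<alpha> z (\<gamma>, i) = real (\<gamma> + 1 - \<alpha>) * z (\<gamma> + 1 - \<alpha>, i)"
proof -
  have "liouville r \<alpha> z (\<gamma>, i) =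
      (\<Sum>\<beta>=1..r + 1 - \<alpha>. if \<beta> = \<gamma> + 1 - \<alpha> then real \<beta> * z (\<beta>, i) else 0)"
    unfolding liouville_def prod.case
  proof (intro sum.cong refl)
    fix \<beta> assume "\<beta> \<in> {1..r + 1 - \<alpha>}"
    then have "\<gamma> = \<alpha> + \<beta> - 1 \<longleftrightarrow> \<beta> = \<gamma> + 1 - \<alpha>" by auto
    then show "(if \<gamma> = \<alpha> + \<beta> - 1 then real \<beta> * z (\<beta>, i) else 0) =
      (if \<beta> = \<gamma> + 1 - \<alpha> then real \<beta> * z (\<beta>, i) else 0)" by simp
  qed
  also have "\<dots> = (if \<gamma> + 1 - \<alpha> \<in> {1..r + 1 - \<alpha>}
      then real (\<gamma> + 1 - \<alpha>) * z (\<gamma> + 1 - \<alpha>, i) else 0)"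
    by (rule sum.delta) simp
  also have "\<dots> = real (\<gamma> + 1 - \<alpha>) * z (\<gamma> + 1 - \<alpha>, i)"
  proof (cases "\<gamma> + 1 - \<alpha> = 0")
    case False
    then have "\<gamma> + 1 - \<alpha> \<in> {1..r + 1 - \<alpha>}" using assms by auto
    then show ?thesis by simp
  qed simp
  finally show ?thesis .
qed

locale jet_patch =
  fixes r :: nat and W :: "'n::finite pt set"
  assumes box: "box_open (idx r) W"
begin

abbreviation smooth :: "('n pt \<Rightarrow> real) \<Rightarrow> bool" where
  "smooth \<equiv> smooth_fun (idx r) W"

text \<open>The derivation along the Liouville field \<open>C\<^sub>\<alpha>\<close>; for \<open>\<alpha> = 0\<close>, the total derivative.\<close>

definition L :: "nat \<Rightarrow> ('n pt \<Rightarrow> real) \<Rightarrow> 'n pt \<Rightarrow> real" where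
  "L \<alpha> = lie_fun r (liouville r \<alpha>)"

text \<open>Extending the partial derivatives by 0 beyond the top order makes the commutation rules below uniform
  in the order.\<close>

definition pd0 :: "nat \<Rightarrow> 'n \<Rightarrow> ('n pt \<Rightarrow> real) \<Rightarrow> 'n pt \<Rightarrow> real" where
  "pd0 \<beta> i g z = (if \<beta> \<le> r then pd (\<beta>, i) g z else 0)"

lemma L_eq: "L \<alpha> g z = (\<Sum>\<gamma>\<le>r. \<Sum>i\<in>UNIV. real (\<gamma> + 1 - \<alpha>) * z (\<gamma> + 1 - \<alpha>, i) * pd (\<gamma>, i) g z)"
  unfolding L_def lie_fun_def sum_idx by (intro sum.cong refl) (simp add: liouville_apply)

lemmas smooth_add = smooth_fun_add[OF box]
lemmas smooth_mult = smooth_fun_mult[OF box]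
lemmas smooth_const = smooth_fun_const[OF box]
lemmas smooth_coord = smooth_fun_coord[OF box]
lemmas smooth_sum = smooth_fun_sum[OF box]
lemmas smooth_cmult = smooth_mult[OF smooth_const]
lemmas smooth_cong = smooth_fun_cong[OF box]

lemma smooth_pd: "smooth g \<Longrightarrow> \<gamma> \<le> r \<Longrightarrow> smooth (pd (\<gamma>, i) g)"
  by (rule smooth_fun_pd) auto

lemma smooth_liou: "smooth (\<lambda>w. real m * w (m, i))"
  by (rule smooth_cmult[OF smooth_coord])

lemma smooth_L: "smooth g \<Longrightarrow> smooth (L \<alpha> g)"
  unfolding L_eq[abs_def] by (intro smooth_sum smooth_mult[OF smooth_liou] smooth_pd) auto

lemma pd_cong_W: "z \<in> W \<Longrightarrow> \<gamma> \<le> r \<Longrightarrow> (\<And>w. w \<in> W \<Longrightarrow> f w = g w) \<Longrightarrow> pd (\<gamma>, i) f z = pd (\<gamma>, i) g z"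
  by (rule pd_cong[OF box]) auto

lemma L_cong: "z \<in> W \<Longrightarrow> (\<And>w. w \<in> W \<Longrightarrow> f w = g w) \<Longrightarrow> L \<alpha> f z = L \<alpha> g z"
  unfolding L_eq by (intro sum.cong refl) (simp add: pd_cong_W[of z _ f g])

lemma L_const: "L \<alpha> (\<lambda>w. a) z = 0"
  by (simp add: L_eq)

lemma L_add:
  assumes "smooth f" "smooth g" "z \<in> W"
  shows "L \<alpha> (\<lambda>w. f w + g w) z = L \<alpha> f z + L \<alpha> g z"
  unfolding L_eq sum.distrib[symmetric]
  by (intro sum.cong refl) (simp add: pd_add[OF assms] algebra_simps)

lemma L_mult:
  assumes "smooth f" "smooth g" "z \<in> W"
  shows "L \<alpha> (\<lambda>w. f w * g w) z = L \<alpha> f z * g z + f z * L \<alpha> g z"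
  unfolding L_eq sum_distrib_left sum_distrib_right sum.distrib[symmetric]
  by (intro sum.cong refl) (simp add: pd_mult[OF assms] algebra_simps)

lemma L_cmult: "smooth f \<Longrightarrow> z \<in> W \<Longrightarrow> L \<alpha> (\<lambda>w. a * f w) z = a * L \<alpha> f z"
  using L_mult[OF smooth_const, of f z \<alpha> a] by (simp add: L_const)

lemma L_sum:
  assumes "\<And>i. i \<in> I \<Longrightarrow> smooth (f i)" "z \<in> W"
  shows "L \<alpha> (\<lambda>w. \<Sum>i\<in>I. f i w) z = (\<Sum>i\<in>I. L \<alpha> (f i) z)"
  using assms(1)
proof (induction I rule: infinite_finite_induct)
  case (insert x F)
  then show ?case
    using L_add[of "f x" "\<lambda>w. \<Sum>i\<in>F. f i w" z] smooth_sum[of F f] assms(2) by simp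
qed (simp_all add: L_const)

lemma L_coord:
  assumes "m \<le> r"
  shows "L \<alpha> (\<lambda>w. w (m, i)) z = real (m + 1 - \<alpha>) * z (m + 1 - \<alpha>, i)"
proof -
  have "L \<alpha> (\<lambda>w. w (m, i)) z = (\<Sum>\<gamma>\<le>r. \<Sum>j\<in>UNIV.
      if \<gamma> = m then (if j = i then real (m + 1 - \<alpha>) * z (m + 1 - \<alpha>, i) else 0) else 0)"
    unfolding L_eq by (intro sum.cong refl) (auto simp: pd_coord)
  also have "\<dots> = (\<Sum>\<gamma>\<le>r. if \<gamma> = m then real (m + 1 - \<alpha>) * z (m + 1 - \<alpha>, i) else 0)"
    by (intro sum.cong refl) auto
  finally show ?thesis using assms by simp
qed

lemma L_leibniz_sum:
  assumes "\<And>\<gamma> i. \<gamma> \<le> r \<Longrightarrow> smooth (f \<gamma> i)" "\<And>\<gamma> i. \<gamma> \<le> r \<Longrightarrow> smooth (g \<gamma> i)" "z \<in> W"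
  shows "L \<alpha> (\<lambda>w. \<Sum>\<gamma>\<le>r. \<Sum>i\<in>UNIV. f \<gamma> i w * g \<gamma> i w) z =
    (\<Sum>\<gamma>\<le>r. \<Sum>i\<in>UNIV. L \<alpha> (f \<gamma> i) z * g \<gamma> i z + f \<gamma> i z * L \<alpha> (g \<gamma> i) z)"
proof -
  have "L \<alpha> (\<lambda>w. \<Sum>\<gamma>\<le>r. \<Sum>i\<in>UNIV. f \<gamma> i w * g \<gamma> i w) z =
      (\<Sum>\<gamma>\<le>r. L \<alpha> (\<lambda>w. \<Sum>i\<in>UNIV. f \<gamma> i w * g \<gamma> i w) z)"
    by (intro L_sum smooth_sum smooth_mult assms) auto
  also have "\<dots> = (\<Sum>\<gamma>\<le>r. \<Sum>i\<in>UNIV. L \<alpha> (\<lambda>w. f \<gamma> i w * g \<gamma> i w) z)"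
    by (intro sum.cong refl L_sum smooth_mult assms) auto
  also have "\<dots> = (\<Sum>\<gamma>\<le>r. \<Sum>i\<in>UNIV. L \<alpha> (f \<gamma> i) z * g \<gamma> i z + f \<gamma> i z * L \<alpha> (g \<gamma> i) z)"
    by (intro sum.cong refl L_mult assms) auto
  finally show ?thesis .
qed

lemma pd_double_sum:
  assumes f: "\<And>\<gamma> i. \<gamma> \<le> r \<Longrightarrow> smooth (f \<gamma> i)" and z: "z \<in> W" and b: "\<beta> \<le> r"
  shows "pd (\<beta>, j) (\<lambda>w. \<Sum>\<gamma>\<le>r. \<Sum>i\<in>UNIV. f \<gamma> i w) z = (\<Sum>\<gamma>\<le>r. \<Sum>i\<in>UNIV. pd (\<beta>, j) (f \<gamma> i) z)"
proof -
  have b': "(\<beta>, j) \<in> idx r" using b by simp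
  have "pd (\<beta>, j) (\<lambda>w. \<Sum>\<gamma>\<le>r. \<Sum>i\<in>UNIV. f \<gamma> i w) z = (\<Sum>\<gamma>\<le>r. pd (\<beta>, j) (\<lambda>w. \<Sum>i\<in>UNIV. f \<gamma> i w) z)"
    by (rule pd_sum[OF box _ z b']) (auto intro: smooth_sum f)
  also have "\<dots> = (\<Sum>\<gamma>\<le>r. \<Sum>i\<in>UNIV. pd (\<beta>, j) (f \<gamma> i) z)"
    by (intro sum.cong refl pd_sum[OF box _ z b']) (auto intro: f)
  finally show ?thesis .
qed

lemma slot_sum:
  assumes "\<beta> \<le> r"
  shows "(\<Sum>\<gamma>\<le>r. \<Sum>j\<in>UNIV. u \<gamma> j *
      (real (\<gamma> + 1 - \<alpha>) * (if (\<beta>, i) = (\<gamma> + 1 - \<alpha>, j) then 1 else 0)))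
    = real \<beta> * (if \<alpha> + \<beta> - 1 \<le> r then u (\<alpha> + \<beta> - 1) (i :: 'n) else 0)"
proof -
  have "(\<Sum>\<gamma>\<le>r. \<Sum>j\<in>UNIV. u \<gamma> j *
      (real (\<gamma> + 1 - \<alpha>) * (if (\<beta>, i) = (\<gamma> + 1 - \<alpha>, j) then 1 else 0)))
    = (\<Sum>\<gamma>\<le>r. \<Sum>j\<in>UNIV. if j = i then
        if \<gamma> = \<alpha> + \<beta> - 1 then real \<beta> * u (\<alpha> + \<beta> - 1) i else 0 else 0)"
    by (intro sum.cong refl) auto
  then show ?thesis by simp
qed

text \<open>The commutator of \<open>C\<^sub>\<alpha>\<close> with a coordinate field: in \<open>C\<^sub>\<alpha>\<close> the coordinate \<open>y\<^sup>\<beta>\<close> occurs once, with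
  coefficient \<open>\<beta>\<close>, in the component of order \<open>\<alpha> + \<beta> - 1\<close>.\<close>

lemma pd_L:
  assumes g: "smooth g" and z: "z \<in> W" and \<beta>: "\<beta> \<le> r"
  shows "pd (\<beta>, i) (L \<alpha> g) z = L \<alpha> (pd (\<beta>, i) g) z + real \<beta> * pd0 (\<alpha> + \<beta> - 1) i g z"
proof -
  let ?l = "\<lambda>\<gamma> (j :: 'n) w. real (\<gamma> + 1 - \<alpha>) * w (\<gamma> + 1 - \<alpha>, j)"
  have bi: "(\<beta>, i) \<in> idx r" using \<beta> by simp
  have "pd (\<beta>, i) (L \<alpha> g) z =
      (\<Sum>\<gamma>\<le>r. \<Sum>j\<in>UNIV. pd (\<beta>, i) (\<lambda>w. ?l \<gamma> j w * pd (\<gamma>, j) g w) z)"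
    unfolding L_eq[abs_def]
    by (intro pd_double_sum smooth_mult[OF smooth_liou] smooth_pd g z \<beta>)
  also have "\<dots> = (\<Sum>\<gamma>\<le>r. \<Sum>j\<in>UNIV. (real (\<gamma> + 1 - \<alpha>) * (if (\<beta>, i) = (\<gamma> + 1 - \<alpha>, j) then 1 else 0))
      * pd (\<gamma>, j) g z + ?l \<gamma> j z * pd (\<gamma>, j) (pd (\<beta>, i) g) z)"
  proof (intro sum.cong refl)
    fix \<gamma> and j :: 'n assume "\<gamma> \<in> {..r}"
    then have \<gamma>: "\<gamma> \<le> r" "(\<gamma>, j) \<in> idx r" by auto
    have "pd (\<beta>, i) (\<lambda>w. ?l \<gamma> j w * pd (\<gamma>, j) g w) z =
        pd (\<beta>, i) (?l \<gamma> j) z * pd (\<gamma>, j) g z + ?l \<gamma> j z * pd (\<beta>, i) (pd (\<gamma>, j) g) z"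
      by (rule pd_mult[OF smooth_liou smooth_pd[OF g \<gamma>(1)] z bi])
    moreover have "pd (\<beta>, i) (?l \<gamma> j) z =
        real (\<gamma> + 1 - \<alpha>) * (if (\<beta>, i) = (\<gamma> + 1 - \<alpha>, j) then 1 else 0)"
      by (subst pd_cmult[OF box smooth_coord z bi]) (simp add: pd_coord)
    moreover have "pd (\<beta>, i) (pd (\<gamma>, j) g) z = pd (\<gamma>, j) (pd (\<beta>, i) g) z"
      by (rule pd_commute[OF box finite_idx g z bi \<gamma>(2)])
    ultimately show "pd (\<beta>, i) (\<lambda>w. ?l \<gamma> j w * pd (\<gamma>, j) g w) z =
      (real (\<gamma> + 1 - \<alpha>) * (if (\<beta>, i) = (\<gamma> + 1 - \<alpha>, j) then 1 else 0))
      * pd (\<gamma>, j) g z + ?l \<gamma> j z * pd (\<gamma>, j) (pd (\<beta>, i) g) z" by simp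
  qed
  also have "\<dots> = (\<Sum>\<gamma>\<le>r. \<Sum>j\<in>UNIV. pd (\<gamma>, j) g z *
      (real (\<gamma> + 1 - \<alpha>) * (if (\<beta>, i) = (\<gamma> + 1 - \<alpha>, j) then 1 else 0)))
      + L \<alpha> (pd (\<beta>, i) g) z"
    unfolding L_eq sum.distrib by (simp only: mult.commute)
  also have "\<dots> = L \<alpha> (pd (\<beta>, i) g) z + real \<beta> * pd0 (\<alpha> + \<beta> - 1) i g z"
    unfolding slot_sum[OF \<beta>] pd0_def by simp
  finally show ?thesis by simp
qed

lemma sum_atMost_shift:
  fixes g :: "nat \<Rightarrow> real"
  assumes "g 0 = 0" "g (Suc r) = 0"
  shows "(\<Sum>\<gamma>\<le>r. g \<gamma>) = (\<Sum>\<gamma>\<le>r. g (Suc \<gamma>))"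
  using sum.atMost_Suc[of g r] sum.atMost_Suc_shift[of g r] assms by simp

text \<open>The numerical content of \<open>[C\<^sub>\<alpha>, C\<^sub>0] = \<alpha> C\<^sub>\<alpha>\<^sub>-\<^sub>1\<close>: after an index shift the two sums differ in each term by
  the factor \<open>(\<gamma> + 1) - (\<gamma> + 1 - \<alpha>)\<close>. The boundary term of the shift is killed by \<open>u r = 0\<close>. It is applied
  to the derivatives of a function and to the momenta.\<close>

lemma shift_sum:
  assumes "\<alpha> \<ge> 1" and u: "\<And>i. u r i = 0"
  shows "(\<Sum>\<gamma>\<le>r. \<Sum>i\<in>UNIV. real (\<gamma> + 1 - \<alpha>) * z (\<gamma> + 1 - \<alpha>, i) * (real \<gamma> * u (\<gamma> - 1) i))
    - (\<Sum>\<gamma>\<le>r. \<Sum>i\<in>UNIV. real (\<gamma> + 1 - \<alpha>) *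
        (real (\<gamma> + 1 - \<alpha> + 1) * z (\<gamma> + 1 - \<alpha> + 1, i)) * u \<gamma> i)
    = real \<alpha> * (\<Sum>\<gamma>\<le>r. \<Sum>i\<in>UNIV. real (\<gamma> + 1 - (\<alpha> - 1)) * z (\<gamma> + 1 - (\<alpha> - 1), (i :: 'n)) * u \<gamma> i)"
proof -
  have "(\<Sum>\<gamma>\<le>r. \<Sum>i\<in>UNIV. real (\<gamma> + 1 - \<alpha>) * z (\<gamma> + 1 - \<alpha>, i) * (real \<gamma> * u (\<gamma> - 1) i))
      = (\<Sum>\<gamma>\<le>r. \<Sum>i\<in>UNIV. real (Suc \<gamma> + 1 - \<alpha>) * z (Suc \<gamma> + 1 - \<alpha>, i) * (real (Suc \<gamma>) * u \<gamma> i))"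
    by (subst sum_atMost_shift) (use u in auto)
  moreover have "real (Suc \<gamma> + 1 - \<alpha>) * z (Suc \<gamma> + 1 - \<alpha>, i) * (real (Suc \<gamma>) * u \<gamma> i)
      - real (\<gamma> + 1 - \<alpha>) * (real (\<gamma> + 1 - \<alpha> + 1) * z (\<gamma> + 1 - \<alpha> + 1, i)) * u \<gamma> i
      = real \<alpha> * (real (\<gamma> + 1 - (\<alpha> - 1)) * z (\<gamma> + 1 - (\<alpha> - 1), i) * u \<gamma> i)" for \<gamma> and i :: 'n
  proof (cases "\<gamma> + 1 \<ge> \<alpha>")
    case True
    have "Suc \<gamma> + 1 - \<alpha> = \<gamma> + 1 - \<alpha> + 1" "\<gamma> + 1 - (\<alpha> - 1) = \<gamma> + 1 - \<alpha> + 1"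
      "real (Suc \<gamma>) = real \<alpha> + real (\<gamma> + 1 - \<alpha>)" using True assms(1) by auto
    then show ?thesis by (simp only:) (simp add: algebra_simps)
  next
    case False
    then have "Suc \<gamma> + 1 - \<alpha> = 0" "\<gamma> + 1 - \<alpha> = 0" "\<gamma> + 1 - (\<alpha> - 1) = 0" by auto
    then show ?thesis by simp
  qed
  ultimately show ?thesis
    by (simp only: sum_subtractf[symmetric] sum_distrib_left)
qed

lemma L_liou:
  assumes "z \<in> W" "m \<le> r"
  shows "L 0 (\<lambda>w. real m * w (m, i)) z = real m * (real (m + 1) * z (m + 1, i))"
  using L_cmult[OF smooth_coord assms(1), of 0 "real m"] L_coord[OF assms(2), of 0 i z] by simp

text \<open>The terms of second order cancel by Clairaut's theorem. That \<open>g\<close> does not depend on the coordinates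
  of order \<open>r\<close> removes the boundary term, where the bracket would see the missing coordinates of order
  \<open>r + 1\<close>.\<close>

lemma L_commutator:
  assumes g: "smooth g" and ord: "\<And>w i. w \<in> W \<Longrightarrow> pd (r, i) g w = 0"
    and \<alpha>: "\<alpha> \<ge> 1" and z: "z \<in> W"
  shows "L \<alpha> (L 0 g) z = L 0 (L \<alpha> g) z + real \<alpha> * L (\<alpha> - 1) g z"
proof -
  let ?l = "\<lambda>\<gamma> (j :: 'n) w. real (\<gamma> + 1 - \<alpha>) * w (\<gamma> + 1 - \<alpha>, j)"
  have "L \<alpha> (L 0 g) z = (\<Sum>\<gamma>\<le>r. \<Sum>i\<in>UNIV. ?l \<gamma> i z * L 0 (pd (\<gamma>, i) g) z
      + ?l \<gamma> i z * (real \<gamma> * pd (\<gamma> - 1, i) g z))"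
    unfolding L_eq[of \<alpha> "L 0 g"]
    by (intro sum.cong refl) (auto simp: pd_L[OF g z] pd0_def algebra_simps)
  moreover have "L 0 (L \<alpha> g) z = (\<Sum>\<gamma>\<le>r. \<Sum>i\<in>UNIV. real (\<gamma> + 1 - \<alpha>) *
        (real (\<gamma> + 1 - \<alpha> + 1) * z (\<gamma> + 1 - \<alpha> + 1, i)) * pd (\<gamma>, i) g z
      + ?l \<gamma> i z * L 0 (pd (\<gamma>, i) g) z)"
  proof -
    have "L 0 (L \<alpha> g) z = (\<Sum>\<gamma>\<le>r. \<Sum>i\<in>UNIV. L 0 (?l \<gamma> i) z * pd (\<gamma>, i) g z
        + ?l \<gamma> i z * L 0 (pd (\<gamma>, i) g) z)"
      unfolding L_eq[of \<alpha> g, abs_def]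
      by (rule L_leibniz_sum) (auto intro: smooth_liou smooth_pd g z)
    also have "\<dots> = (\<Sum>\<gamma>\<le>r. \<Sum>i\<in>UNIV. real (\<gamma> + 1 - \<alpha>) *
        (real (\<gamma> + 1 - \<alpha> + 1) * z (\<gamma> + 1 - \<alpha> + 1, i)) * pd (\<gamma>, i) g z
      + ?l \<gamma> i z * L 0 (pd (\<gamma>, i) g) z)"
    proof (intro sum.cong refl)
      fix \<gamma> and i :: 'n assume "\<gamma> \<in> {..r}"
      then have "\<gamma> + 1 - \<alpha> \<le> r" using \<alpha> by auto
      from L_liou[OF z this, of i]
      show "L 0 (?l \<gamma> i) z * pd (\<gamma>, i) g z + ?l \<gamma> i z * L 0 (pd (\<gamma>, i) g) z =
        real (\<gamma> + 1 - \<alpha>) * (real (\<gamma> + 1 - \<alpha> + 1) * z (\<gamma> + 1 - \<alpha> + 1, i)) * pd (\<gamma>, i) g z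
        + ?l \<gamma> i z * L 0 (pd (\<gamma>, i) g) z" by simp
    qed
    finally show ?thesis .
  qed
  moreover have "L (\<alpha> - 1) g z = (\<Sum>\<gamma>\<le>r. \<Sum>i\<in>UNIV. real (\<gamma> + 1 - (\<alpha> - 1)) * z (\<gamma> + 1 - (\<alpha> - 1), i) * pd (\<gamma>, i) g z)"
    by (rule L_eq)
  moreover note shift_sum[OF \<alpha>, of "\<lambda>\<gamma> i. pd (\<gamma>, i) g z" z] 
  ultimately show ?thesis using ord[OF z] by (simp add: sum.distrib)
qed

end

section \<open>The momenta of a Lagrangian\<close>

context jet_patch
begin

lemma cartan_formula:
  assumes Y: "\<And>a. a \<in> idx r \<Longrightarrow> smooth (\<lambda>w. Y w a)"
    and \<theta>: "\<And>a. a \<in> idx r \<Longrightarrow> smooth (\<lambda>w. \<theta> w a)"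
    and z: "z \<in> W" and b: "b \<in> idx r"
  shows "lie_form r Y \<theta> z b = contr2 r Y (ext_d \<theta>) z b + pd b (contr r Y \<theta>) z"
proof -
  have "pd b (contr r Y \<theta>) z = (\<Sum>a\<in>idx r. pd b (\<lambda>w. Y w a * \<theta> w a) z)"
    unfolding contr_def[abs_def] by (rule pd_sum[OF box smooth_mult[OF Y \<theta>] z b])
  also have "\<dots> = (\<Sum>a\<in>idx r. pd b (\<lambda>w. Y w a) z * \<theta> z a + Y z a * pd b (\<lambda>w. \<theta> w a) z)"
    by (intro sum.cong refl pd_mult[OF Y \<theta> z b])
  finally show ?thesis
    unfolding lie_form_def contr2_def ext_d_def by (simp add: sum.distrib[symmetric] algebra_simps)
qed

end

text \<open>The situation in one induced chart of the space of jets of order \<open>r = 2k - 1\<close>: a function \<open>f\<close> of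
  order \<open>k\<close> with the Zermelo conditions, the components \<open>X\<close> of a semispray, and a 1-form \<open>\<theta>\<close> that is
  semibasic and solves \<open>L\<^sub>X \<theta> = df\<close>. These properties determine \<open>\<theta>\<close>.\<close>

locale poincare_cartan = jet_patch r W for r and W :: "'n::finite pt set" +
  fixes k :: nat and f :: "'n pt \<Rightarrow> real" and X \<theta> :: "'n pt \<Rightarrow> 'n pt"
  assumes rk: "Suc r = 2 * k"
    and smooth_f: "smooth f"
    and f_order: "\<And>z \<gamma> i. z \<in> W \<Longrightarrow> k < \<gamma> \<Longrightarrow> \<gamma> \<le> r \<Longrightarrow> pd (\<gamma>, i) f z = 0"
    and zermelo: "\<And>z \<alpha>. z \<in> W \<Longrightarrow> 1 \<le> \<alpha> \<Longrightarrow> \<alpha> \<le> r \<Longrightarrow> L \<alpha> f z = (if \<alpha> = 1 then f z else 0)"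
    and smooth_X: "\<And>a. a \<in> idx r \<Longrightarrow> smooth (\<lambda>z. X z a)"
    and semispray: "\<And>z \<gamma> i. z \<in> W \<Longrightarrow> \<gamma> < r \<Longrightarrow> X z (\<gamma>, i) = real (\<gamma> + 1) * z (\<gamma> + 1, i)"
    and semibasic: "\<And>z \<beta> i. z \<in> W \<Longrightarrow> k \<le> \<beta> \<Longrightarrow> \<beta> \<le> r \<Longrightarrow> \<theta> z (\<beta>, i) = 0"
    and lie_eq: "\<And>z b. z \<in> W \<Longrightarrow> b \<in> idx r \<Longrightarrow> lie_form r X \<theta> z b = pd b f z"
begin

lemma k_pos: "1 \<le> k" and k_le_r: "k \<le> r" and r_pos: "1 \<le> r"
  using rk by presburger+

text \<open>The components of \<open>\<theta>\<close>, extended by 0 so that index arithmetic beyond the top order is harmless.\<close>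

definition momentum :: "nat \<Rightarrow> 'n \<Rightarrow> 'n pt \<Rightarrow> real" where
  "momentum \<beta> i z = (if \<beta> \<le> r then \<theta> z (\<beta>, i) else 0)"

lemma theta_component: "\<beta> \<le> r \<Longrightarrow> (\<lambda>w. \<theta> w (\<beta>, i)) = momentum \<beta> i"
  by (simp add: momentum_def[abs_def])

lemma momentum_high: "z \<in> W \<Longrightarrow> k \<le> \<beta> \<Longrightarrow> momentum \<beta> i z = 0"
  using semibasic by (auto simp: momentum_def)

text \<open>The top component of \<open>X\<close>, whose derivatives are unknown, is multiplied by \<open>\<theta>\<^sub>r = 0\<close>.\<close>

lemma lie_form_semispray:
  assumes z: "z \<in> W" and \<beta>: "\<beta> \<le> r"
  shows "lie_form r X \<theta> z (\<beta>, i) = lie_fun r X (momentum \<beta> i) z + real \<beta> * momentum (\<beta> - 1) i z"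
proof -
  have "(\<Sum>a\<in>idx r. \<theta> z a * pd (\<beta>, i) (\<lambda>w. X w a) z) = (\<Sum>\<gamma>\<le>r. \<Sum>j\<in>UNIV. \<theta> z (\<gamma>, j) *
      (real (\<gamma> + 1 - 0) * (if (\<beta>, i) = (\<gamma> + 1 - 0, j) then 1 else 0)))"
    unfolding sum_idx
  proof (intro sum.cong refl)
    fix \<gamma> and j :: 'n assume "\<gamma> \<in> {..r}"
    then consider "\<gamma> < r" | "\<gamma> = r" by force
    then show "\<theta> z (\<gamma>, j) * pd (\<beta>, i) (\<lambda>w. X w (\<gamma>, j)) z =
      \<theta> z (\<gamma>, j) * (real (\<gamma> + 1 - 0) * (if (\<beta>, i) = (\<gamma> + 1 - 0, j) then 1 else 0))"
    proof cases
      case 1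
      have "pd (\<beta>, i) (\<lambda>w. X w (\<gamma>, j)) z = pd (\<beta>, i) (\<lambda>w. real (\<gamma> + 1) * w (\<gamma> + 1, j)) z"
        by (rule pd_cong_W[OF z \<beta>]) (simp add: semispray[OF _ 1])
      also have "\<dots> = real (\<gamma> + 1) * (if (\<beta>, i) = (\<gamma> + 1, j) then 1 else 0)"
        by (subst pd_cmult[OF box smooth_coord z]) (use \<beta> in \<open>auto simp: pd_coord\<close>)
      finally show ?thesis by simp
    next
      case 2 then show ?thesis using semibasic[OF z k_le_r] by simp
    qed
  qed
  also have "\<dots> = real \<beta> * momentum (\<beta> - 1) i z"
    unfolding slot_sum[OF \<beta>] momentum_def by simp
  finally show ?thesis
    unfolding lie_form_def lie_fun_def sum.distrib theta_component[OF \<beta>] by simp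
qed

lemma lie_fun_semispray:
  assumes "z \<in> W" "\<And>i. pd (r, i) g z = 0"
  shows "lie_fun r X g z = L 0 g z"
  unfolding L_eq lie_fun_def sum_idx
proof (intro sum.cong refl)
  fix \<gamma> and i :: 'n assume "\<gamma> \<in> {..r}"
  then consider "\<gamma> < r" | "\<gamma> = r" by force
  then show "X z (\<gamma>, i) * pd (\<gamma>, i) g z = real (\<gamma> + 1 - 0) * z (\<gamma> + 1 - 0, i) * pd (\<gamma>, i) g z"
    by cases (use assms semispray in auto)
qed

text \<open>Dependence on the coordinates of order at most \<open>m\<close> only, expressed infinitesimally.\<close>

definition has_order :: "nat \<Rightarrow> ('n pt \<Rightarrow> real) \<Rightarrow> bool" where
  "has_order m g \<longleftrightarrow> smooth g \<and> (\<forall>\<gamma> i. \<forall>z\<in>W. m < \<gamma> \<longrightarrow> pd0 \<gamma> i g z = 0)"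

lemma has_orderD: "has_order m g \<Longrightarrow> z \<in> W \<Longrightarrow> m < \<gamma> \<Longrightarrow> \<gamma> \<le> r \<Longrightarrow> pd (\<gamma>, i) g z = 0"
  unfolding has_order_def pd0_def by metis

lemma momentum_recursion_aux:
  assumes "has_order (r - \<beta>) (momentum \<beta> i)" "1 \<le> \<beta>" "\<beta> \<le> r" "z \<in> W"
  shows "L 0 (momentum \<beta> i) z + real \<beta> * momentum (\<beta> - 1) i z = pd (\<beta>, i) f z"
proof -
  have "lie_fun r X (momentum \<beta> i) z = L 0 (momentum \<beta> i) z"
    by (rule lie_fun_semispray[OF assms(4)]) (use has_orderD[OF assms(1,4), of r] assms(2,3) in auto)
  then show ?thesis
    using lie_form_semispray[OF assms(4,3), of i] lie_eq[OF assms(4), of "(\<beta>, i)"] assms(3) by simp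
qed

lemma has_order_cong:
  assumes "has_order m g" "\<And>z. z \<in> W \<Longrightarrow> g z = h z"
  shows "has_order m h"
proof -
  have "pd0 \<gamma> i h z = pd0 \<gamma> i g z" if "z \<in> W" for z \<gamma> i
    unfolding pd0_def using pd_cong_W[OF that, of \<gamma> h g i] assms(2) by simp
  then show ?thesis using assms smooth_cong[OF _ assms(2)] unfolding has_order_def by auto
qed

lemma has_order_const: "has_order m (\<lambda>w. a)"
  by (simp add: has_order_def smooth_const pd0_def)

lemma pd_pd_f_high:
  assumes "z \<in> W" "k < \<gamma>" "\<gamma> \<le> r" "\<beta> \<le> r"
  shows "pd (\<gamma>, j) (pd (\<beta>, i) f) z = 0"
proof -
  have "pd (\<gamma>, j) (pd (\<beta>, i) f) z = pd (\<beta>, i) (pd (\<gamma>, j) f) z"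
    by (rule pd_commute[OF box finite_idx smooth_f assms(1)]) (use assms in auto)
  also have "\<dots> = pd (\<beta>, i) (\<lambda>w. 0) z"
    by (rule pd_cong_W[OF assms(1,4)]) (use f_order assms in auto)
  finally show ?thesis by simp
qed

text \<open>The total derivative raises the order by one and multiplies the derivative in the top order by that
  order.\<close>

lemma pd_total_top:
  assumes "has_order m g" "m < \<gamma>" "\<gamma> \<le> r" "z \<in> W"
  shows "pd (\<gamma>, j) (L 0 g) z = real \<gamma> * pd (\<gamma> - 1, j) g z"
proof -
  have g: "smooth g" using assms(1) by (simp add: has_order_def)
  have "L 0 (pd (\<gamma>, j) g) z = L 0 (\<lambda>w. 0) z"
    by (rule L_cong[OF assms(4)]) (use has_orderD[OF assms(1)] assms in auto)
  then show ?thesis using pd_L[OF g assms(4,3), of j 0] assms by (simp add: pd0_def L_const)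
qed

text \<open>Downward induction on \<open>\<beta>\<close>, starting from \<open>\<theta>\<^sub>\<beta> = 0\<close> for \<open>\<beta> \<ge> k\<close>. Order and recursion have to be
  established together: the recursion in this form presupposes that \<open>\<theta>\<^sub>\<beta>\<close> is independent of the
  coordinates of order \<open>r\<close>, and it in turn bounds the order of \<open>\<theta>\<^sub>\<beta>\<^sub>-\<^sub>1\<close>.\<close>

lemma momentum_order: "has_order (r - \<beta>) (momentum \<beta> i)"
proof -
  have "k - d \<le> \<beta> \<Longrightarrow> has_order (r - \<beta>) (momentum \<beta> i)" for d
  proof (induction d arbitrary: \<beta> i)
    case 0
    show ?case by (rule has_order_cong[OF has_order_const[of _ 0]]) (use 0 momentum_high in auto)
  next
    case (Suc d)
    show ?case
    proof (cases "k - d \<le> \<beta>")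
      case False
      then have \<beta>: "\<beta> < k" "Suc \<beta> \<le> r" using k_le_r by auto
      have IH: "has_order (r - Suc \<beta>) (momentum (Suc \<beta>) i)" using Suc False by auto
      \<comment> \<open>the value of \<open>\<theta>\<^sub>\<beta>\<close> that the recursion prescribes\<close>
      define g where "g w = 1 / real (Suc \<beta>) * (pd (Suc \<beta>, i) f w + (- 1) * L 0 (momentum (Suc \<beta>) i) w)" for w
      have eq: "g w = momentum \<beta> i w" if "w \<in> W" for w
        using momentum_recursion_aux[OF IH _ \<beta>(2) that] by (simp add: g_def field_simps)
      have sT: "smooth (momentum (Suc \<beta>) i)" using IH by (simp add: has_order_def)
      have sL: "smooth (\<lambda>w. (-1) * L 0 (momentum (Suc \<beta>) i) w)"
        by (rule smooth_cmult[OF smooth_L[OF sT]])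
      have sm: "smooth (\<lambda>w. pd (Suc \<beta>, i) f w + (- 1) * L 0 (momentum (Suc \<beta>) i) w)"
        by (rule smooth_add[OF smooth_pd[OF smooth_f \<beta>(2)] sL])
      have "pd (\<gamma>, j) g w = 0" if "w \<in> W" "r - \<beta> < \<gamma>" "\<gamma> \<le> r" for \<gamma> j w
      proof -
        have gi: "(\<gamma>, j) \<in> idx r" using that by simp
        have "pd (\<gamma>, j) g w = 1 / real (Suc \<beta>) *
            (pd (\<gamma>, j) (pd (Suc \<beta>, i) f) w + (- 1) * pd (\<gamma>, j) (L 0 (momentum (Suc \<beta>) i)) w)"
          unfolding g_def[abs_def] pd_cmult[OF box sm that(1) gi]
            pd_add[OF smooth_pd[OF smooth_f \<beta>(2)] sL that(1) gi]
            pd_cmult[OF box smooth_L[OF sT] that(1) gi] by simp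
        moreover have "pd (\<gamma>, j) (pd (Suc \<beta>, i) f) w = 0"
          by (rule pd_pd_f_high) (use that \<beta> rk in auto)
        moreover have "pd (\<gamma>, j) (L 0 (momentum (Suc \<beta>) i)) w = real \<gamma> * pd (\<gamma> - 1, j) (momentum (Suc \<beta>) i) w"
          by (rule pd_total_top[OF IH]) (use that in auto)
        moreover have "pd (\<gamma> - 1, j) (momentum (Suc \<beta>) i) w = 0"
          by (rule has_orderD[OF IH that(1)]) (use that \<beta> in auto)
        ultimately show ?thesis by simp
      qed
      then have "has_order (r - \<beta>) g"
        unfolding has_order_def pd0_def using smooth_cmult[OF sm, of "1 / real (Suc \<beta>)"]
        by (auto simp: g_def[abs_def])
      then show ?thesis by (rule has_order_cong) (rule eq)
    qed (use Suc in auto)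
  qed
  from this[of k] show ?thesis by simp
qed

lemma smooth_momentum: "smooth (momentum \<beta> i)"
  using momentum_order by (simp add: has_order_def)

lemma momentum_recursion:
  assumes "z \<in> W" "1 \<le> \<beta>"
  shows "L 0 (momentum \<beta> i) z + real \<beta> * momentum (\<beta> - 1) i z = pd0 \<beta> i f z"
proof (cases "\<beta> \<le> r")
  case True
  then show ?thesis using momentum_recursion_aux[OF momentum_order assms(2) True assms(1)] by (simp add: pd0_def)
next
  case False
  then have "L 0 (momentum \<beta> i) z = L 0 (\<lambda>w. 0) z"
    by (intro L_cong assms) (simp add: momentum_def)
  moreover have "momentum (\<beta> - 1) i z = 0" using False k_le_r by (intro momentum_high assms) auto
  ultimately show ?thesis using False by (simp add: L_const pd0_def)
qed

subsection \<open>Contractions\<close>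

text \<open>The contraction of \<open>\<theta>\<close> with \<open>C\<^sub>\<alpha>\<close> and, for \<open>\<alpha> = 0\<close>, with the semispray (\<open>contr_semispray\<close>).\<close>

definition contraction :: "nat \<Rightarrow> 'n pt \<Rightarrow> real" where
  "contraction \<alpha> z = (\<Sum>\<gamma>\<le>r. \<Sum>i\<in>UNIV. real (\<gamma> + 1 - \<alpha>) * z (\<gamma> + 1 - \<alpha>, i) * momentum \<gamma> i z)"

lemma contr_liouville: "contr r (liouville r \<alpha>) \<theta> z = contraction \<alpha> z"
  unfolding contr_def contraction_def sum_idx
  by (intro sum.cong refl) (simp add: liouville_apply momentum_def)

lemma contr_semispray: 
  assumes "z \<in> W" shows "contr r X \<theta> z = contraction 0 z"
  unfolding contr_def contraction_def sum_idx
proof (intro sum.cong refl)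
  fix \<gamma> and i :: 'n assume "\<gamma> \<in> {..r}"
  then consider "\<gamma> < r" | "\<gamma> = r" by force
  then show "X z (\<gamma>, i) * \<theta> z (\<gamma>, i) = real (\<gamma> + 1 - 0) * z (\<gamma> + 1 - 0, i) * momentum \<gamma> i z"
    by cases (use assms semispray semibasic[OF assms k_le_r] in \<open>auto simp: momentum_def\<close>)
qed

lemma L0_contraction:
  assumes z: "z \<in> W" and \<alpha>: "1 \<le> \<alpha>" "\<alpha> \<le> r"
  shows "L 0 (contraction \<alpha>) z = (if \<alpha> = 1 then f z else 0) - real \<alpha> * contraction (\<alpha> - 1) z"
proof -
  let ?l = "\<lambda>\<gamma> (j :: 'n) w. real (\<gamma> + 1 - \<alpha>) * w (\<gamma> + 1 - \<alpha>, j)"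
  have "L 0 (contraction \<alpha>) z = (\<Sum>\<gamma>\<le>r. \<Sum>i\<in>UNIV. L 0 (?l \<gamma> i) z * momentum \<gamma> i z
        + ?l \<gamma> i z * L 0 (momentum \<gamma> i) z)"
    unfolding contraction_def[abs_def]
    by (rule L_leibniz_sum) (auto intro: smooth_liou smooth_momentum z)
  also have "\<dots> = (\<Sum>\<gamma>\<le>r. \<Sum>i\<in>UNIV. (real (\<gamma> + 1 - \<alpha>) *
        (real (\<gamma> + 1 - \<alpha> + 1) * z (\<gamma> + 1 - \<alpha> + 1, i)) * momentum \<gamma> i z
      - ?l \<gamma> i z * (real \<gamma> * momentum (\<gamma> - 1) i z)) + ?l \<gamma> i z * pd (\<gamma>, i) f z)"
  proof (intro sum.cong refl)
    fix \<gamma> and i :: 'n assume "\<gamma> \<in> {..r}"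
    then have \<gamma>: "\<gamma> \<le> r" "\<gamma> + 1 - \<alpha> \<le> r" using \<alpha> by auto
    \<comment> \<open>The recursion is not available for \<open>\<gamma> = 0\<close>, but there the coefficient is 0.\<close>
    have "?l \<gamma> i z * L 0 (momentum \<gamma> i) z = ?l \<gamma> i z * (pd (\<gamma>, i) f z - real \<gamma> * momentum (\<gamma> - 1) i z)"
    proof (cases "\<gamma> = 0")
      case False
      then show ?thesis using momentum_recursion[OF z, of \<gamma> i] \<gamma> by (simp add: pd0_def)
    qed (use \<alpha> in auto)
    then show "L 0 (?l \<gamma> i) z * momentum \<gamma> i z + ?l \<gamma> i z * L 0 (momentum \<gamma> i) z = (real (\<gamma> + 1 - \<alpha>) *
        (real (\<gamma> + 1 - \<alpha> + 1) * z (\<gamma> + 1 - \<alpha> + 1, i)) * momentum \<gamma> i z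
      - ?l \<gamma> i z * (real \<gamma> * momentum (\<gamma> - 1) i z)) + ?l \<gamma> i z * pd (\<gamma>, i) f z"
      using L_liou[OF z \<gamma>(2), of i] by (simp add: right_diff_distrib)
  qed
  also have "\<dots> = L \<alpha> f z - real \<alpha> * contraction (\<alpha> - 1) z"
    using shift_sum[OF \<alpha>(1), of "\<lambda>\<gamma> i. momentum \<gamma> i z" z] momentum_high[OF z k_le_r]
    unfolding sum.distrib sum_subtractf L_eq contraction_def by simp
  finally show ?thesis using zermelo[OF z \<alpha>] by simp
qed

text \<open>Downward induction on \<open>\<alpha>\<close>: for \<open>\<alpha> \<ge> k\<close> every product in the sum has a zero factor, and if \<open>c\<^sub>\<alpha>\<^sub>+\<^sub>1 = 0\<close>, its
  total derivative shows \<open>c\<^sub>\<alpha> = 0\<close>.\<close>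

lemma contraction_zero:
  assumes "1 \<le> \<alpha>" "z \<in> W"
  shows "contraction \<alpha> z = 0"
proof -
  have "k - d \<le> \<alpha> \<Longrightarrow> 1 \<le> \<alpha> \<Longrightarrow> z \<in> W \<Longrightarrow> contraction \<alpha> z = 0" for d z
  proof (induction d arbitrary: \<alpha> z)
    case 0
    have "momentum \<gamma> i z = 0 \<or> \<gamma> + 1 - \<alpha> = 0" for \<gamma> i
      using momentum_high[OF 0(3), of \<gamma> i] 0(1) by (cases "k \<le> \<gamma>") auto
    then have "real (\<gamma> + 1 - \<alpha>) * z (\<gamma> + 1 - \<alpha>, i) * momentum \<gamma> i z = 0" for \<gamma> i
      by (metis mult_zero_left mult_zero_right of_nat_0)
    then show ?case by (simp only: contraction_def sum.neutral_const)
  next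
    case (Suc d)
    show ?case
    proof (cases "k - d \<le> \<alpha>")
      case False
      have "L 0 (contraction (Suc \<alpha>)) z = L 0 (\<lambda>w. 0) z"
        by (rule L_cong[OF Suc.prems(3)]) (use Suc False in auto)
      then show ?thesis
        using L0_contraction[OF Suc.prems(3), of "Suc \<alpha>"] False k_le_r Suc.prems(2) by (simp add: L_const)
    qed (use Suc in auto)
  qed
  from this[of k] assms show ?thesis by simp
qed

lemma contraction_0:
  assumes "z \<in> W" shows "contraction 0 z = f z"
proof -
  have "L 0 (contraction 1) z = L 0 (\<lambda>w. 0) z"
    by (rule L_cong[OF assms]) (simp add: contraction_zero)
  then show ?thesis using L0_contraction[OF assms, of 1] r_pos by (simp add: L_const)
qed

subsection \<open>Lie derivatives along the Liouville fields\<close>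

text \<open>The components of the Lie derivative of \<open>\<theta>\<close> along \<open>C\<^sub>\<alpha>\<close>, see \<open>lie_form_liouville\<close>.\<close>

definition lie_momentum :: "nat \<Rightarrow> nat \<Rightarrow> 'n \<Rightarrow> 'n pt \<Rightarrow> real" where
  "lie_momentum \<alpha> \<beta> i z = L \<alpha> (momentum \<beta> i) z + real \<beta> * momentum (\<alpha> + \<beta> - 1) i z"

lemma lie_form_liouville:
  assumes z: "z \<in> W" and \<beta>: "\<beta> \<le> r"
  shows "lie_form r (liouville r \<alpha>) \<theta> z (\<beta>, i) = lie_momentum \<alpha> \<beta> i z"
proof -
  have "(\<Sum>a\<in>idx r. \<theta> z a * pd (\<beta>, i) (\<lambda>w. liouville r \<alpha> w a) z) = (\<Sum>\<gamma>\<le>r. \<Sum>j\<in>UNIV. \<theta> z (\<gamma>, j) *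
      (real (\<gamma> + 1 - \<alpha>) * (if (\<beta>, i) = (\<gamma> + 1 - \<alpha>, j) then 1 else 0)))"
    unfolding sum_idx
  proof (intro sum.cong refl)
    fix \<gamma> and j :: 'n assume "\<gamma> \<in> {..r}"
    then have "pd (\<beta>, i) (\<lambda>w. liouville r \<alpha> w (\<gamma>, j)) z =
        pd (\<beta>, i) (\<lambda>w. real (\<gamma> + 1 - \<alpha>) * w (\<gamma> + 1 - \<alpha>, j)) z"
      by (simp add: liouville_apply)
    also have "\<dots> = real (\<gamma> + 1 - \<alpha>) * (if (\<beta>, i) = (\<gamma> + 1 - \<alpha>, j) then 1 else 0)"
      by (subst pd_cmult[OF box smooth_coord z]) (use \<beta> in \<open>auto simp: pd_coord\<close>)
    finally show "\<theta> z (\<gamma>, j) * pd (\<beta>, i) (\<lambda>w. liouville r \<alpha> w (\<gamma>, j)) z = \<theta> z (\<gamma>, j) *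
      (real (\<gamma> + 1 - \<alpha>) * (if (\<beta>, i) = (\<gamma> + 1 - \<alpha>, j) then 1 else 0))" by simp
  qed
  also have "\<dots> = real \<beta> * momentum (\<alpha> + \<beta> - 1) i z"
    unfolding slot_sum[OF \<beta>] momentum_def by simp
  finally show ?thesis
    unfolding lie_form_def sum.distrib theta_component[OF \<beta>] lie_momentum_def L_def lie_fun_def by simp
qed

text \<open>In invariant terms: \<open>L\<^sub>S L\<^sub>C \<theta> = L\<^sub>C L\<^sub>S \<theta> - L\<^bsub>[C, S]\<^esub> \<theta>\<close>, where \<open>L\<^sub>S \<theta> = df\<close>, \<open>C f\<close> is known and \<open>[C, S]\<close>
  is a multiple of the previous Liouville field up to a field in the directions of top order. That field
  affects only the component \<open>\<beta> = 0\<close>. For \<open>\<alpha> = 1\<close> the previous field is \<open>S\<close> and its contribution cancels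
  against \<open>d(C\<^sub>1 f) = df\<close>.\<close>

lemma L0_lie_momentum:
  assumes z: "z \<in> W" and \<alpha>: "1 \<le> \<alpha>" "\<alpha> \<le> r" and \<beta>: "1 \<le> \<beta>" "\<beta> \<le> r"
  shows "L 0 (lie_momentum \<alpha> \<beta> i) z = - real \<beta> * lie_momentum \<alpha> (\<beta> - 1) i z
    - (if \<alpha> = 1 then 0 else real \<alpha> * lie_momentum (\<alpha> - 1) \<beta> i z)"
proof -
  have 1: "L 0 (lie_momentum \<alpha> \<beta> i) z = L 0 (L \<alpha> (momentum \<beta> i)) z + real \<beta> * L 0 (momentum (\<alpha> + \<beta> - 1) i) z"
    unfolding lie_momentum_def[abs_def] L_add[OF smooth_L[OF smooth_momentum] smooth_cmult[OF smooth_momentum] z]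
      L_cmult[OF smooth_momentum z] ..
  have 2: "L \<alpha> (L 0 (momentum \<beta> i)) z = L 0 (L \<alpha> (momentum \<beta> i)) z + real \<alpha> * L (\<alpha> - 1) (momentum \<beta> i) z"
    by (rule L_commutator[OF smooth_momentum _ \<alpha>(1) z], rule has_orderD[OF momentum_order])
      (use \<beta> in auto)
  have 3: "L \<alpha> (L 0 (momentum \<beta> i)) z = L \<alpha> (pd (\<beta>, i) f) z + (- real \<beta>) * L \<alpha> (momentum (\<beta> - 1) i) z"
  proof -
    have "L \<alpha> (L 0 (momentum \<beta> i)) z = L \<alpha> (\<lambda>w. pd (\<beta>, i) f w + (- real \<beta>) * momentum (\<beta> - 1) i w) z"
      by (rule L_cong[OF z]) (use momentum_recursion[OF _ \<beta>(1), of _ i] \<beta>(2) in \<open>simp add: pd0_def algebra_simps\<close>)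
    then show ?thesis
      by (simp only: L_add[OF smooth_pd[OF smooth_f \<beta>(2)] smooth_cmult[OF smooth_momentum] z]
          L_cmult[OF smooth_momentum z])
  qed
  have 4: "(if \<alpha> = 1 then pd (\<beta>, i) f z else 0) =
      L \<alpha> (pd (\<beta>, i) f) z + real \<beta> * pd0 (\<alpha> + \<beta> - 1) i f z"
  proof -
    have "pd (\<beta>, i) (L \<alpha> f) z = pd (\<beta>, i) (\<lambda>w. if \<alpha> = 1 then f w else 0) z"
      by (rule pd_cong_W[OF z \<beta>(2)]) (rule zermelo[OF _ \<alpha>])
    then show ?thesis using pd_L[OF smooth_f z \<beta>(2), of i \<alpha>] by (cases "\<alpha> = 1") auto
  qed
  have 5: "L 0 (momentum (\<alpha> + \<beta> - 1) i) z = pd0 (\<alpha> + \<beta> - 1) i f z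
      - (real \<alpha> + real \<beta> - 1) * momentum (\<alpha> + \<beta> - 2) i z"
  proof -
    have "1 \<le> \<alpha> + \<beta> - 1" "\<alpha> + \<beta> - 1 - 1 = \<alpha> + \<beta> - 2"
      "real (\<alpha> + \<beta> - 1) = real \<alpha> + real \<beta> - 1" using \<alpha> \<beta> by auto
    then show ?thesis using momentum_recursion[OF z, of "\<alpha> + \<beta> - 1" i] by simp
  qed
  have 6: "lie_momentum \<alpha> (\<beta> - 1) i z = L \<alpha> (momentum (\<beta> - 1) i) z + (real \<beta> - 1) * momentum (\<alpha> + \<beta> - 2) i z"
    unfolding lie_momentum_def using \<beta> by (simp add: of_nat_diff numeral_2_eq_2)
  have 7: "lie_momentum (\<alpha> - 1) \<beta> i z = L (\<alpha> - 1) (momentum \<beta> i) z + real \<beta> * momentum (\<alpha> + \<beta> - 2) i z"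
    unfolding lie_momentum_def using \<alpha> by (simp add: numeral_2_eq_2)
  have 8: "L 0 (momentum \<beta> i) z + real \<beta> * momentum (\<beta> - 1) i z = pd (\<beta>, i) f z"
    using momentum_recursion[OF z \<beta>(1), of i] \<beta>(2) by (simp add: pd0_def)
  have 9: "L 0 (L \<alpha> (momentum \<beta> i)) z = (if \<alpha> = 1 then pd (\<beta>, i) f z else 0)
      - real \<beta> * pd0 (\<alpha> + \<beta> - 1) i f z - real \<beta> * L \<alpha> (momentum (\<beta> - 1) i) z
      - real \<alpha> * L (\<alpha> - 1) (momentum \<beta> i) z"
    using 2 3 4 by simp
  show ?thesis
  proof (cases "\<alpha> = 1")
    case True
    have "\<alpha> + \<beta> - 1 = \<beta>" "\<alpha> + \<beta> - 2 = \<beta> - 1" using True by auto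
    then show ?thesis unfolding 1 9 5 6 using 8 True by (simp add: algebra_simps)
  next
    case False
    then show ?thesis unfolding 1 9 5 6 7 by (simp add: algebra_simps)
  qed
qed

text \<open>Upward induction on \<open>\<alpha>\<close>, and for fixed \<open>\<alpha>\<close> downward induction on \<open>\<beta>\<close> from \<open>k\<close>.\<close>

lemma lie_momentum_zero:
  assumes "1 \<le> \<alpha>" "\<alpha> \<le> r" "z \<in> W"
  shows "lie_momentum \<alpha> \<beta> i z = 0"
  using assms
proof (induction \<alpha> arbitrary: \<beta> z)
  case (Suc a)
  have "k - d \<le> \<beta> \<Longrightarrow> z \<in> W \<Longrightarrow> lie_momentum (Suc a) \<beta> i z = 0" for d z
  proof (induction d arbitrary: \<beta> z)
    case 0
    have "L (Suc a) (momentum \<beta> i) z = L (Suc a) (\<lambda>w. 0) z"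
      by (rule L_cong[OF 0(2)]) (use momentum_high 0 in auto)
    then show ?case using momentum_high[OF 0(2), of "Suc a + \<beta> - 1" i] 0(1) by (simp add: lie_momentum_def L_const)
  next
    case (Suc d)
    show ?case
    proof (cases "k - d \<le> \<beta>")
      case False
      have "L 0 (lie_momentum (Suc a) (Suc \<beta>) i) z = L 0 (\<lambda>w. 0) z"
        by (rule L_cong[OF Suc.prems(2)]) (use Suc.IH[of "Suc \<beta>"] Suc.prems(1) in auto)
      moreover have "a \<noteq> 0 \<Longrightarrow> lie_momentum a (Suc \<beta>) i z = 0"
        using Suc.prems \<open>Suc a \<le> r\<close> \<open>\<And>z \<beta>. \<lbrakk>1 \<le> a; a \<le> r; z \<in> W\<rbrakk> \<Longrightarrow> lie_momentum a \<beta> i z = 0\<close> by auto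
      ultimately show ?thesis
        using L0_lie_momentum[OF Suc.prems(2), of "Suc a" "Suc \<beta>" i] \<open>Suc a \<le> r\<close> False k_le_r
        by (cases "a = 0") (auto simp: L_const)
    qed (use Suc in auto)
  qed
  from this[of k] Suc.prems show ?case by simp
qed simp

theorem lie_form_liouville_zero:
  assumes "z \<in> W" "b \<in> idx r" "1 \<le> \<alpha>" "\<alpha> \<le> r"
  shows "lie_form r (liouville r \<alpha>) \<theta> z b = 0"
  using lie_form_liouville[OF assms(1)] lie_momentum_zero[OF assms(3,4,1)] assms(2) by (cases b) simp

lemma smooth_theta: "a \<in> idx r \<Longrightarrow> smooth (\<lambda>w. \<theta> w a)"
  using smooth_momentum theta_component by (cases a) auto

lemma liouville_kernel:
  assumes "z \<in> W" "b \<in> idx r" "1 \<le> \<alpha>" "\<alpha> \<le> r"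
  shows "contr2 r (liouville r \<alpha>) (ext_d \<theta>) z b = 0"
proof -
  have "smooth (\<lambda>w. liouville r \<alpha> w a)" if "a \<in> idx r" for a
    using that smooth_liou by (cases a) (simp add: liouville_apply)
  from cartan_formula[OF this smooth_theta assms(1,2)]
  have "lie_form r (liouville r \<alpha>) \<theta> z b =
      contr2 r (liouville r \<alpha>) (ext_d \<theta>) z b + pd b (contr r (liouville r \<alpha>) \<theta>) z" by simp
  moreover have "pd b (contr r (liouville r \<alpha>) \<theta>) z = pd b (\<lambda>w. 0) z"
    by (rule pd_cong[OF box assms(1,2)]) (simp add: contr_liouville contraction_zero[OF assms(3)])
  ultimately show ?thesis using lie_form_liouville_zero[OF assms] by simp
qed

lemma semispray_kernel:
  assumes "z \<in> W" "b \<in> idx r"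
  shows "contr2 r X (ext_d \<theta>) z b = 0"
proof -
  have "pd b (contr r X \<theta>) z = pd b f z"
    by (rule pd_cong[OF box assms]) (simp add: contr_semispray contraction_0)
  then show ?thesis using cartan_formula[OF smooth_X smooth_theta assms] lie_eq[OF assms] by simp
qed

subsection \<open>The matrix of the exterior derivative\<close>

text \<open>The recursion, differentiated in the highest order that occurs in it: \<open>F\<^sub>\<beta>\<close> has order \<open>k\<close> and
  contributes only at the start \<open>\<beta> = k\<close>; afterwards each step multiplies by
  \<open>- (r - \<beta>) / (\<beta> + 1)\<close>.\<close>

lemma pd_momentum_top:
  assumes "\<beta> < k"
  obtains c where "c \<noteq> 0"
    "\<And>z i j. z \<in> W \<Longrightarrow> pd (r - \<beta>, i) (momentum \<beta> j) z = c * pd (k, i) (pd (k, j) f) z"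
proof -
  have "\<beta> = k - 1 - d \<Longrightarrow> d < k \<Longrightarrow> \<exists>c. c \<noteq> 0 \<and>
      (\<forall>z\<in>W. \<forall>i j. pd (r - \<beta>, i) (momentum \<beta> j) z = c * pd (k, i) (pd (k, j) f) z)" for d
  proof (induction d arbitrary: \<beta>)
    case 0
    then have \<beta>: "r - \<beta> = k" "Suc \<beta> = k" using rk by auto
    have "pd (r - \<beta>, i) (momentum \<beta> j) z = (1 / real k) * pd (k, i) (pd (k, j) f) z" if z: "z \<in> W" for z i j
    proof -
      have "momentum \<beta> j w = 1 / real k * pd (k, j) f w" if w: "w \<in> W" for w
      proof -
        have "L 0 (momentum k j) w = L 0 (\<lambda>w. 0) w" by (rule L_cong[OF w]) (simp add: momentum_high)
        then show ?thesis
          using momentum_recursion[OF w k_pos, of j] k_le_r k_pos \<beta>(2)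
          by (auto simp: L_const pd0_def field_simps)
      qed
      then have "pd (k, i) (momentum \<beta> j) z = pd (k, i) (\<lambda>w. 1 / real k * pd (k, j) f w) z"
        by (intro pd_cong_W[OF z k_le_r])
      also have "\<dots> = 1 / real k * pd (k, i) (pd (k, j) f) z"
        by (rule pd_cmult[OF box smooth_pd[OF smooth_f k_le_r] z]) (use k_le_r in auto)
      finally show ?thesis by (simp add: \<beta>)
    qed
    then show ?case using k_pos by (intro exI[of _ "1 / real k"]) auto
  next
    case (Suc d)
    then have \<beta>: "Suc \<beta> = k - 1 - d" "Suc \<beta> < k" "Suc \<beta> \<le> r" "k < r - \<beta>" using rk by auto
    obtain c where c: "c \<noteq> 0" "\<And>z i j. z \<in> W \<Longrightarrow>
        pd (r - Suc \<beta>, i) (momentum (Suc \<beta>) j) z = c * pd (k, i) (pd (k, j) f) z"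
      using Suc.IH[OF \<beta>(1)] Suc.prems(2) by auto
    define q where "q = - (real (r - \<beta>) / real (Suc \<beta>))"
    have "pd (r - \<beta>, i) (momentum \<beta> j) z = (q * c) * pd (k, i) (pd (k, j) f) z" if z: "z \<in> W" for z i j
    proof -
      have sL: "smooth (\<lambda>w. (-1) * L 0 (momentum (Suc \<beta>) j) w)"
        by (rule smooth_cmult[OF smooth_L[OF smooth_momentum]])
      have gi: "(r - \<beta>, i) \<in> idx r" by simp
      have "momentum \<beta> j w = 1 / real (Suc \<beta>) * (pd (Suc \<beta>, j) f w + (- 1) * L 0 (momentum (Suc \<beta>) j) w)"
        if w: "w \<in> W" for w
        using momentum_recursion[OF w, of "Suc \<beta>" j] \<beta>(3) by (simp add: pd0_def field_simps)
      then have "pd (r - \<beta>, i) (momentum \<beta> j) z = pd (r - \<beta>, i)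
          (\<lambda>w. 1 / real (Suc \<beta>) * (pd (Suc \<beta>, j) f w + (- 1) * L 0 (momentum (Suc \<beta>) j) w)) z"
        by (intro pd_cong_W[OF z]) auto
      also have "\<dots> = 1 / real (Suc \<beta>) *
          (pd (r - \<beta>, i) (pd (Suc \<beta>, j) f) z + (- 1) * pd (r - \<beta>, i) (L 0 (momentum (Suc \<beta>) j)) z)"
        unfolding pd_cmult[OF box smooth_add[OF smooth_pd[OF smooth_f \<beta>(3)] sL] z gi]
            pd_add[OF smooth_pd[OF smooth_f \<beta>(3)] sL z gi]
            pd_cmult[OF box smooth_L[OF smooth_momentum] z gi] ..
      also have "pd (r - \<beta>, i) (pd (Suc \<beta>, j) f) z = 0"
        by (rule pd_pd_f_high[OF z \<beta>(4)]) (use \<beta> in auto)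
      also have "pd (r - \<beta>, i) (L 0 (momentum (Suc \<beta>) j)) z =
          real (r - \<beta>) * pd (r - \<beta> - 1, i) (momentum (Suc \<beta>) j) z"
        by (rule pd_total_top[OF momentum_order _ _ z]) (use \<beta> in auto)
      also have "r - \<beta> - 1 = r - Suc \<beta>" by simp
      finally show ?thesis using c(2)[OF z] by (simp add: q_def)
    qed
    moreover have "q * c \<noteq> 0" using c(1) \<beta> by (simp add: q_def)
    ultimately show ?case by blast
  qed
  from this[of "k - 1 - \<beta>"] assms that show ?thesis by auto
qed

lemma ext_d_low:
  assumes "z \<in> W" "\<alpha> \<le> r" "\<beta> \<le> r" "r < \<alpha> + \<beta>"
  shows "ext_d \<theta> z (\<alpha>, i) (\<beta>, j) = 0"
  unfolding ext_d_def theta_component[OF assms(2)] theta_component[OF assms(3)]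
  using has_orderD[OF momentum_order[of \<alpha> i] assms(1), of \<beta> j]
    has_orderD[OF momentum_order[of \<beta> j] assms(1), of \<alpha> i] assms by auto

lemma ext_d_antidiagonal:
  assumes z: "z \<in> W" and \<alpha>: "\<alpha> \<le> r"
  obtains c where "c \<noteq> 0"
    "\<And>i j. ext_d \<theta> z (\<alpha>, i) (r - \<alpha>, j) = c * pd (k, i) (pd (k, j) f) z"
proof -
  have zero: "pd (\<beta>, i) (momentum \<gamma> j) z = 0" if "k \<le> \<gamma>" "\<beta> \<le> r" for \<beta> \<gamma> i j
    using pd_cong_W[OF z that(2), of "momentum \<gamma> j" "\<lambda>w. 0"] momentum_high that(1) by simp
  have le: "r - \<alpha> \<le> r" by simp
  show ?thesis
  proof (cases "\<alpha> < k")
    case True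
    obtain c where c: "c \<noteq> 0" 
      "\<And>i j. pd (r - \<alpha>, i) (momentum \<alpha> j) z = c * pd (k, i) (pd (k, j) f) z"
      using pd_momentum_top[OF True] z by metis
    have "pd (k, j) (pd (k, i) f) z = pd (k, i) (pd (k, j) f) z" for i j
      by (rule pd_commute[OF box finite_idx smooth_f z]) (use k_le_r in auto)
    then have "ext_d \<theta> z (\<alpha>, i) (r - \<alpha>, j) = (- c) * pd (k, i) (pd (k, j) f) z" for i j
      unfolding ext_d_def theta_component[OF \<alpha>] theta_component[OF le] c(2) using zero True rk \<alpha> by simp
    then show ?thesis using that[of "- c"] c(1) by simp
  next
    case False
    then have "r - \<alpha> < k" using rk by auto
    obtain c where c: "c \<noteq> 0" 
      "\<And>i j. pd (r - (r - \<alpha>), i) (momentum (r - \<alpha>) j) z = c * pd (k, i) (pd (k, j) f) z"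
      using pd_momentum_top[OF \<open>r - \<alpha> < k\<close>] z by metis
    have "r - (r - \<alpha>) = \<alpha>" using \<alpha> by simp
    then have "ext_d \<theta> z (\<alpha>, i) (r - \<alpha>, j) = c * pd (k, i) (pd (k, j) f) z" for i j
      unfolding ext_d_def theta_component[OF \<alpha>] theta_component[OF le] using zero c(2) False by simp
    then show ?thesis using that c(1) by simp
  qed
qed

end

section \<open>The rank of an antitriangular skew form\<close>

text \<open>Gaussian elimination: an equation with a nonzero coefficient eliminates one unknown.\<close>

lemma underdetermined_system:
  fixes M :: "'a \<Rightarrow> 'b \<Rightarrow> real"
  assumes "finite J" "finite R" "card J < card R"
  obtains c where "\<exists>a\<in>R. c a \<noteq> 0" "\<And>b. b \<in> J \<Longrightarrow> (\<Sum>a\<in>R. c a * M a b) = 0"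
proof -
  have "\<exists>c. (\<exists>a\<in>R. c a \<noteq> 0) \<and> (\<forall>b\<in>J. (\<Sum>a\<in>R. c a * M a b) = 0)"
    using assms
  proof (induction J arbitrary: R M rule: finite_induct)
    case empty
    then have "R \<noteq> {}" by auto
    then show ?case by (intro exI[of _ "\<lambda>_. 1"]) auto
  next
    case (insert b J)
    show ?case
    proof (cases "\<forall>a\<in>R. M a b = 0")
      case True
      obtain c where "\<exists>a\<in>R. c a \<noteq> 0" "\<forall>b\<in>J. (\<Sum>a\<in>R. c a * M a b) = 0"
        using insert.IH[of R M] insert.prems insert.hyps by auto
      with True show ?thesis by (intro exI[of _ c]) auto
    next
      case False
      then obtain a0 where a0: "a0 \<in> R" "M a0 b \<noteq> 0" by auto
      define M' where "M' a b' = M a b' - M a b / M a0 b * M a0 b'" for a b'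
      have "card J < card (R - {a0})" using insert.prems insert.hyps a0 by simp
      then obtain c where c: "\<exists>a\<in>R - {a0}. c a \<noteq> 0"
        "\<And>b'. b' \<in> J \<Longrightarrow> (\<Sum>a\<in>R - {a0}. c a * M' a b') = 0"
        using insert.IH[of "R - {a0}" M'] insert.prems by auto
      define s where "s = - (\<Sum>a\<in>R - {a0}. c a * M a b) / M a0 b"
      have *: "(\<Sum>a\<in>R. (c(a0 := s)) a * M a b') = (\<Sum>a\<in>R - {a0}. c a * M' a b')" for b'
      proof -
        have "(\<Sum>a\<in>R. (c(a0 := s)) a * M a b') = s * M a0 b' + (\<Sum>a\<in>R - {a0}. c a * M a b')"
          using insert.prems a0 by (simp add: sum.remove[of R a0])
        moreover have "s * M a0 b' = (\<Sum>a\<in>R - {a0}. - (c a * (M a b / M a0 b * M a0 b')))"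
          by (simp add: s_def sum_divide_distrib sum_distrib_right sum_negf mult.assoc)
        ultimately show ?thesis
          by (simp add: M'_def right_diff_distrib sum_subtractf sum_negf)
      qed
      have "M' a b = 0" for a using a0 by (simp add: M'_def)
      then have "\<forall>b'\<in>insert b J. (\<Sum>a\<in>R. (c(a0 := s)) a * M a b') = 0"
        using c(2) unfolding * by auto
      moreover have "\<exists>a\<in>R. (c(a0 := s)) a \<noteq> 0" using c(1) by (metis DiffE fun_upd_other singletonI)
      ultimately show ?thesis by blast
    qed
  qed
  then show ?thesis using that by blast
qed

text \<open>The independence condition inside \<open>form_rank\<close>, for an arbitrary matrix and index set.\<close>

definition row_independent :: "'a set \<Rightarrow> ('a \<Rightarrow> 'a \<Rightarrow> real) \<Rightarrow> 'a set \<Rightarrow> bool" where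
  "row_independent I M R \<longleftrightarrow> R \<subseteq> I \<and>
     (\<forall>c. (\<forall>b\<in>I. (\<Sum>a\<in>R. c a * M a b) = 0) \<longrightarrow> (\<forall>a\<in>R. c a = 0))"

text \<open>If a combination of the rows in \<open>R\<close> is zero as soon as its entries outside \<open>Q\<close> are zero, then the columns
  in \<open>Q\<close> carry no information.\<close>

lemma card_row_independent_le:
  assumes "finite I" and R: "row_independent I M R"
    and Q: "\<And>c. (\<And>b. b \<in> I - Q \<Longrightarrow> (\<Sum>a\<in>R. c a * M a b) = 0) \<Longrightarrow>
      (\<forall>b\<in>I. (\<Sum>a\<in>R. c a * M a b) = 0)"
  shows "card R \<le> card (I - Q)"
proof (rule ccontr)
  assume "\<not> card R \<le> card (I - Q)"
  moreover have "finite R" using assms(1) R finite_subset unfolding row_independent_def by blast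
  ultimately obtain c where "\<exists>a\<in>R. c a \<noteq> 0" "\<And>b. b \<in> I - Q \<Longrightarrow> (\<Sum>a\<in>R. c a * M a b) = 0"
    using underdetermined_system[of "I - Q" R M] assms(1) by auto
  then show False using Q R unfolding row_independent_def by blast
qed

lemma form_rank_eq: "form_rank r \<omega> z = Max (card ` {R. row_independent (idx r) (\<omega> z) R})"
  unfolding form_rank_def row_independent_def by (intro arg_cong[of _ _ Max]) auto

lemma finite_row_independent: "finite I \<Longrightarrow> finite {R. row_independent I M R}"
  by (rule finite_subset[of _ "Pow I"]) (auto simp: row_independent_def)

lemma form_rank_le:
  assumes "\<And>R. row_independent (idx r) (\<omega> z) R \<Longrightarrow> card R \<le> m"
  shows "form_rank r \<omega> z \<le> m"
proof -
  have "{} \<in> {R. row_independent (idx r) (\<omega> z) R}" by (simp add: row_independent_def)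
  then show ?thesis unfolding form_rank_eq
    using assms finite_row_independent[OF finite_idx, of r "\<omega> z"] by (intro Max.boundedI) auto
qed

lemma form_rank_ge: "row_independent (idx r) (\<omega> z) R \<Longrightarrow> card R \<le> form_rank r \<omega> z"
  unfolding form_rank_eq using finite_row_independent[OF finite_idx, of r "\<omega> z"]
  by (intro Max_ge) auto

lemma sum_single_term:
  fixes g :: "'a \<Rightarrow> real"
  assumes "finite I" "a \<in> I" "\<And>b. b \<in> I - {a} \<Longrightarrow> g b = 0"
  shows "sum g I = g a"
  using sum.remove[OF assms(1,2), of g] sum.neutral[of "I - {a}" g] assms(3) by simp

text \<open>The kernel vectors \<open>w m\<close> form a staircase: \<open>w m\<close> starts in block \<open>m\<close>, and it starts with the same
  vector \<open>y\<close> for every \<open>m\<close>.\<close>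

locale antitriangular_form =
  fixes r :: nat and M :: "nat \<times> 'n::finite \<Rightarrow> nat \<times> 'n \<Rightarrow> real" and H :: "'n \<Rightarrow> 'n \<Rightarrow> real"
    and w :: "nat \<Rightarrow> nat \<times> 'n \<Rightarrow> real" and y :: "'n \<Rightarrow> real" and j0 :: 'n
  assumes skew: "\<And>a b. M a b = - M b a"
    and low: "\<And>\<alpha> \<beta> i j. \<alpha> \<le> r \<Longrightarrow> \<beta> \<le> r \<Longrightarrow> r < \<alpha> + \<beta> \<Longrightarrow> M (\<alpha>, i) (\<beta>, j) = 0"
    and antidiagonal: "\<And>\<alpha>. \<alpha> \<le> r \<Longrightarrow> \<exists>c. c \<noteq> 0 \<and> (\<forall>i j. M (\<alpha>, i) (r - \<alpha>, j) = c * H i j)"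
    and sym: "\<And>i j. H i j = H j i"
    and kernel: "\<And>m b. m \<le> r \<Longrightarrow> b \<in> idx r \<Longrightarrow> (\<Sum>a\<in>idx r. w m a * M a b) = 0"
    and staircase: "\<And>m \<gamma> i. m \<le> r \<Longrightarrow> \<gamma> < m \<Longrightarrow> w m (\<gamma>, i) = 0"
    and corner: "\<And>m i. m \<le> r \<Longrightarrow> w m (m, i) = y i"
    and y: "y j0 \<noteq> 0"
begin

text \<open>One column in each block, at an index where \<open>y\<close> is nonzero: there the staircase can be solved for the
  entries of a row that the kernel annihilates (\<open>pivots\<close>).\<close>

definition pivot_set :: "(nat \<times> 'n) set" where
  "pivot_set = {..r} \<times> {j0}"

lemma card_free: "card (idx r - pivot_set) = (r + 1) * (CARD('n) - 1)"
proof -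
  have "idx r - pivot_set = {..r} \<times> (UNIV - {j0})" by (auto simp: idx_def pivot_set_def)
  then show ?thesis by (simp add: card_cartesian_product)
qed

text \<open>By skew symmetry, a left kernel vector also annihilates every combination of rows.\<close>

lemma annihilated:
  assumes "R \<subseteq> idx r" and v: "\<And>b. b \<in> idx r \<Longrightarrow> (\<Sum>a\<in>idx r. v a * M a b) = 0"
  shows "(\<Sum>b\<in>idx r. v b * (\<Sum>a\<in>R. c a * M a b)) = 0"
proof -
  have "(\<Sum>b\<in>idx r. v b * (\<Sum>a\<in>R. c a * M a b)) = (\<Sum>a\<in>R. \<Sum>b\<in>idx r. v b * (c a * M a b))"
    unfolding sum_distrib_left by (rule sum.swap)
  also have "\<dots> = (\<Sum>a\<in>R. - c a * (\<Sum>b\<in>idx r. v b * M b a))"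
    unfolding sum_distrib_left by (intro sum.cong refl) (subst skew, simp)
  also have "\<dots> = 0" using v assms(1) by (intro sum.neutral) auto
  finally show ?thesis .
qed

lemma pivots:
  assumes ann: "\<And>m. m \<le> r \<Longrightarrow> (\<Sum>b\<in>idx r. w m b * u b) = 0"
    and off: "\<And>b. b \<in> idx r - pivot_set \<Longrightarrow> u b = 0" and b: "b \<in> idx r"
  shows "u b = 0"
proof -
  \<comment> \<open>Downward from the top block: in the pairing of \<open>u\<close> with \<open>w m\<close> only the pivot of block \<open>m\<close> survives.\<close>
  have zero: "u (m, j0) = 0" if "m \<le> r" for m
    using that
  proof (induction "r - m" arbitrary: m rule: less_induct)
    case less
    have "w m b * u b = 0" if b: "b \<in> idx r - {(m, j0)}" for b
    proof -
      obtain \<gamma> i where bi: "b = (\<gamma>, i)" "\<gamma> \<le> r" using b by (cases b) (auto simp: idx_def)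
      consider "i \<noteq> j0" | "i = j0" "\<gamma> < m" | "i = j0" "m < \<gamma>" using b bi by force
      then show ?thesis
      proof cases
        case 1 then show ?thesis using off[of b] bi by (auto simp: pivot_set_def idx_def)
      next
        case 2 then show ?thesis using staircase less.prems bi by simp
      next
        case 3 then show ?thesis using less.hyps[of \<gamma>] bi by simp
      qed
    qed
    then have "(\<Sum>b\<in>idx r. w m b * u b) = w m (m, j0) * u (m, j0)"
      using less.prems by (intro sum_single_term) (auto simp: idx_def)
    then show ?case using ann[OF less.prems] corner[OF less.prems] y by simp
  qed
  obtain \<gamma> i where "b = (\<gamma>, i)" "\<gamma> \<le> r" using b by (cases b) (auto simp: idx_def)
  then show ?thesis using zero[of \<gamma>] off[OF DiffI, of b] b by (auto simp: pivot_set_def)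
qed

text \<open>For a combination of rows from block \<open>\<alpha>\<close> on, the columns of block \<open>r - \<alpha>\<close> only see the antidiagonal
  block.\<close>

lemma contract_top:
  assumes "\<alpha> \<le> r" and v: "\<And>\<gamma> i. \<gamma> < \<alpha> \<Longrightarrow> v (\<gamma>, i) = 0" and c: "\<And>i j. M (\<alpha>, i) (r - \<alpha>, j) = c * H i j"
  shows "(\<Sum>a\<in>idx r. v a * M a (r - \<alpha>, j)) = c * (\<Sum>i\<in>UNIV. H j i * v (\<alpha>, i))"
proof -
  have "(\<Sum>i\<in>UNIV. v (\<gamma>, i) * M (\<gamma>, i) (r - \<alpha>, j)) = 0" if "\<gamma> \<in> {..r} - {\<alpha>}" for \<gamma>
  proof (intro sum.neutral ballI)
    fix i
    have "\<gamma> < \<alpha> \<or> r < \<gamma> + (r - \<alpha>)" using that assms(1) by auto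
    then show "v (\<gamma>, i) * M (\<gamma>, i) (r - \<alpha>, j) = 0"
      using v low[of \<gamma> "r - \<alpha>" i j] that by auto
  qed
  then have "(\<Sum>a\<in>idx r. v a * M a (r - \<alpha>, j)) = (\<Sum>i\<in>UNIV. v (\<alpha>, i) * M (\<alpha>, i) (r - \<alpha>, j))"
    unfolding sum_idx using assms(1) by (intro sum_single_term) auto
  also have "\<dots> = c * (\<Sum>i\<in>UNIV. H j i * v (\<alpha>, i))"
    unfolding c sum_distrib_left by (intro sum.cong refl) (subst sym, simp)
  finally show ?thesis .
qed

lemma H_y: "(\<Sum>i\<in>UNIV. H j i * y i) = 0"
proof -
  obtain c where c: "c \<noteq> 0" "\<And>i j. M (r, i) (r - r, j) = c * H i j" using antidiagonal[of r] by auto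
  have "(\<Sum>a\<in>idx r. w r a * M a (r - r, j)) = c * (\<Sum>i\<in>UNIV. H j i * w r (r, i))"
    by (rule contract_top[OF _ _ c(2)]) (use staircase in auto)
  then show ?thesis using kernel[of r "(r - r, j)"] c(1) corner[of r] by (simp add: idx_def)
qed

text \<open>A vanishing combination of the rows outside \<open>pivot_set\<close> is zero block by block, upwards: by
  \<open>contract_top\<close> its next block is in the kernel of \<open>H\<close>, hence a multiple of \<open>y\<close>, and it is zero at the
  pivot.\<close>

lemma row_independent_free:
  assumes H: "\<And>v. (\<And>j. (\<Sum>i\<in>UNIV. H j i * v i) = 0) \<Longrightarrow> \<exists>s. \<forall>i. v i = s * y i"
  shows "row_independent (idx r) M (idx r - pivot_set)"
  unfolding row_independent_def
proof safe
  fix c \<alpha> and i :: 'n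
  assume c: "\<forall>b\<in>idx r. (\<Sum>a\<in>idx r - pivot_set. c a * M a b) = 0"
    and \<alpha>: "(\<alpha>, i) \<in> idx r" "(\<alpha>, i) \<notin> pivot_set"
  define v where "v a = (if a \<in> pivot_set then 0 else c a)" for a
  have v: "(\<Sum>a\<in>idx r. v a * M a b) = 0" if "b \<in> idx r" for b
  proof -
    have "(\<Sum>a\<in>idx r. v a * M a b) = (\<Sum>a\<in>idx r - pivot_set. c a * M a b)"
      by (rule sum.mono_neutral_cong_right) (auto simp: v_def)
    then show ?thesis using c that by simp
  qed
  have "v (\<gamma>, i) = 0" if "\<gamma> \<le> r" for \<gamma> i
    using that
  proof (induction \<gamma> arbitrary: i rule: less_induct)
    case (less \<gamma>)
    obtain q where q: "q \<noteq> 0" "\<And>i j. M (\<gamma>, i) (r - \<gamma>, j) = q * H i j"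
      using antidiagonal[OF less.prems] by auto
    have "(\<Sum>a\<in>idx r. v a * M a (r - \<gamma>, j)) = q * (\<Sum>i\<in>UNIV. H j i * v (\<gamma>, i))" for j
      by (rule contract_top[OF less.prems _ q(2)]) (use less in auto)
    then have "(\<Sum>i\<in>UNIV. H j i * v (\<gamma>, i)) = 0" for j
      using v[of "(r - \<gamma>, j)"] q(1) by (simp add: idx_def)
    from H[OF this] obtain s where s: "\<And>i. v (\<gamma>, i) = s * y i" by auto
    have "v (\<gamma>, j0) = 0" using less.prems by (simp add: v_def pivot_set_def)
    then show ?case using s y by simp
  qed
  from this[of \<alpha> i] \<alpha> show "c (\<alpha>, i) = 0" by (simp add: v_def idx_def)
qed

lemma card_row_independent:
  assumes "row_independent (idx r) M R"
  shows "card R \<le> (r + 1) * (CARD('n) - 1)"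
proof -
  have "card R \<le> card (idx r - pivot_set)"
  proof (rule card_row_independent_le[OF finite_idx assms])
    fix c assume *: "\<And>b. b \<in> idx r - pivot_set \<Longrightarrow> (\<Sum>a\<in>R. c a * M a b) = 0"
    have R: "R \<subseteq> idx r" using assms by (simp add: row_independent_def)
    show "\<forall>b\<in>idx r. (\<Sum>a\<in>R. c a * M a b) = 0"
    proof
      fix b :: "nat \<times> 'n" assume b: "b \<in> idx r"
      show "(\<Sum>a\<in>R. c a * M a b) = 0"
        by (rule pivots[OF annihilated[OF R kernel] * b])
    qed
  qed
  then show ?thesis by (simp add: card_free)
qed

text \<open>A further kernel vector \<open>v\<close> of \<open>H\<close>, normalised to vanish at the pivot, gives the kernel vector \<open>e\<close> with \<open>v\<close>
  in the top block, and thus one more column that carries no information.\<close>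

lemma card_row_independent_degenerate:
  assumes R: "row_independent (idx r) M R"
    and v: "\<And>j. (\<Sum>i\<in>UNIV. H j i * v i) = 0" "v j0 = 0" "v j1 \<noteq> 0"
  shows "card R < (r + 1) * (CARD('n) - 1)"
proof -
  have Rsub: "R \<subseteq> idx r" using R by (simp add: row_independent_def)
  define e where "e = (\<lambda>(\<gamma>, i). if \<gamma> = r then v i else 0)"
  have e: "(\<Sum>a\<in>idx r. e a * M a b) = 0" if bI: "b \<in> idx r" for b
  proof -
    obtain \<beta> j where b: "b = (\<beta>, j)" "\<beta> \<le> r" using bI by (cases b) (auto simp: idx_def)
    have *: "(\<Sum>a\<in>idx r. e a * M a b) = (\<Sum>i\<in>UNIV. v i * M (r, i) b)"
      unfolding sum_idx by (subst sum_single_term[of _ r]) (auto simp: e_def)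
    show ?thesis
    proof (cases "\<beta> = 0")
      case True
      obtain c where c: "\<And>i j. M (r, i) (r - r, j) = c * H i j" using antidiagonal[of r] by auto
      have "(\<Sum>a\<in>idx r. e a * M a (r - r, j)) = c * (\<Sum>i\<in>UNIV. H j i * e (r, i))"
        by (rule contract_top[OF _ _ c]) (auto simp: e_def)
      then show ?thesis using v(1) True b by (simp add: e_def)
    next
      case False
      then show ?thesis unfolding * using low[of r \<beta>] b by simp
    qed
  qed
  have j1: "j1 \<noteq> j0" using v by auto
  let ?Q = "insert (r, j1) pivot_set"
  have "card R \<le> card (idx r - ?Q)"
  proof (rule card_row_independent_le[OF finite_idx R])
    fix c assume *: "\<And>b. b \<in> idx r - ?Q \<Longrightarrow> (\<Sum>a\<in>R. c a * M a b) = 0"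
    let ?u = "\<lambda>b. \<Sum>a\<in>R. c a * M a b"
    have "e b * ?u b = 0" if "b \<in> idx r - {(r, j1)}" for b
      using that *[of b] v(2) by (cases b) (auto simp: e_def pivot_set_def)
    then have "(\<Sum>b\<in>idx r. e b * ?u b) = e (r, j1) * ?u (r, j1)"
      by (intro sum_single_term) (auto simp: idx_def)
    then have "?u (r, j1) = 0" using annihilated[OF Rsub e, of c] v(3) by (simp add: e_def)
    then have **: "?u b = 0" if "b \<in> idx r - pivot_set" for b using that * by (cases "b = (r, j1)") auto
    show "\<forall>b\<in>idx r. ?u b = 0"
    proof
      fix b :: "nat \<times> 'n" assume b: "b \<in> idx r"
      show "?u b = 0" by (rule pivots[OF annihilated[OF Rsub kernel] ** b])
    qed
  qed
  also have "idx r - ?Q = (idx r - pivot_set) - {(r, j1)}" by auto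
  also have "card \<dots> < card (idx r - pivot_set)"
    by (rule psubset_card_mono) (use j1 in \<open>auto simp: idx_def pivot_set_def\<close>)
  finally show ?thesis by (simp add: card_free)
qed

theorem form_rank_maximal_iff:
  assumes "\<omega> z = M"
  shows "form_rank r \<omega> z = (r + 1) * (CARD('n) - 1) \<longleftrightarrow>
    (\<forall>v. (\<forall>j. (\<Sum>i\<in>UNIV. H j i * v i) = 0) \<longrightarrow> (\<exists>s. \<forall>i. v i = s * y i))"
    (is "?l \<longleftrightarrow> ?K")
proof
  assume ?K
  then have "card (idx r - pivot_set) \<le> form_rank r \<omega> z"
    by (intro form_rank_ge) (use row_independent_free assms in auto)
  moreover have "form_rank r \<omega> z \<le> (r + 1) * (CARD('n) - 1)"
    by (rule form_rank_le) (use card_row_independent assms in auto)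
  ultimately show ?l by (simp add: card_free)
next
  assume ?l
  show ?K
  proof (rule ccontr)
    assume "\<not> ?K"
    then obtain v where v: "\<And>j. (\<Sum>i\<in>UNIV. H j i * v i) = 0" "\<And>s. \<exists>i. v i \<noteq> s * y i" by metis
    \<comment> \<open>subtract a multiple of \<open>y\<close> to normalise \<open>v\<close> at the pivot\<close>
    define v' where "v' i = v i - v j0 / y j0 * y i" for i
    obtain j1 where j1: "v' j1 \<noteq> 0" using v(2)[of "v j0 / y j0"] by (auto simp: v'_def)
    have "(\<Sum>i\<in>UNIV. H j i * v' i) = (\<Sum>i\<in>UNIV. H j i * v i) - v j0 / y j0 * (\<Sum>i\<in>UNIV. H j i * y i)" for j
      by (simp add: v'_def right_diff_distrib sum_subtractf sum_distrib_left algebra_simps)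
    then have "(\<Sum>i\<in>UNIV. H j i * v' i) = 0" for j using v(1) H_y by simp
    note lt = card_row_independent_degenerate[OF _ this _ j1]
    have "v' j0 = 0" using y by (simp add: v'_def)
    with lt have lt: "card R < (r + 1) * (CARD('n) - 1)" if "row_independent (idx r) M R" for R
      using that by blast
    have "form_rank r \<omega> z \<le> (r + 1) * (CARD('n) - 1) - 1"
      by (rule form_rank_le) (use lt assms in fastforce)
    moreover have "0 < (r + 1) * (CARD('n) - 1)" using lt[of "{}"] by (simp add: row_independent_def)
    ultimately show False using \<open>?l\<close> by linarith
  qed
qed

end

text \<open>The kernel is the orthogonal complement of the row space, so its dimension and the rank add up to the
  dimension of the space.\<close>

lemma rank_eq_pred_iff:
  fixes A :: "real ^ 'n ^ 'n"
  assumes y: "y \<noteq> 0" "A *v y = 0"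
  shows "rank A = CARD('n) - 1 \<longleftrightarrow> (\<forall>v. A *v v = 0 \<longrightarrow> (\<exists>s. v = s *\<^sub>R y))"
proof -
  let ?N = "{v. A *v v = 0}"
  have "?N = {v \<in> UNIV. \<forall>x\<in>span (rows A). orthogonal x v}"
  proof (intro set_eqI iffI)
    fix v assume "v \<in> ?N"
    then show "v \<in> {v \<in> UNIV. \<forall>x\<in>span (rows A). orthogonal x v}"
      using orthogonal_nullspace_rowspace[of A v] by (simp add: orthogonal_commute)
  next
    fix v assume v: "v \<in> {v \<in> UNIV. \<forall>x\<in>span (rows A). orthogonal x v}"
    have "row i A \<bullet> v = 0" for i
      using v span_base[of "row i A" "rows A"] by (auto simp: rows_def orthogonal_def)
    then show "v \<in> ?N" by (simp add: vec_eq_iff matrix_vector_mul_component row_def vec_lambda_eta)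
  qed
  then have "dim ?N + rank A = CARD('n)"
    using dim_subspace_orthogonal_to_vectors[of "span (rows A)" "UNIV :: (real^'n) set"]
    by (simp add: row_rank_def dim_span)
  moreover have "dim ?N = 1 \<longleftrightarrow> ?N \<subseteq> span {y}"
  proof
    assume "dim ?N = 1"
    moreover have "independent {y}" "{y} \<subseteq> ?N" using y by auto
    ultimately show "?N \<subseteq> span {y}" using card_ge_dim_independent[of "{y}" ?N] by auto
  next
    assume sub: "?N \<subseteq> span {y}"
    then have "dim ?N \<le> dim {y}" by (rule dim_mono)
    moreover have "dim {y} \<le> dim ?N" using y by (intro dim_mono) (auto intro: span_base)
    moreover have "dim {y} = 1" using y(1) by (simp add: dim_singleton)
    ultimately show "dim ?N = 1" by simp
  qed
  moreover have "0 < CARD('n)" by simp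
  ultimately have "rank A = CARD('n) - 1 \<longleftrightarrow> ?N \<subseteq> span {y}" by linarith
  then show ?thesis unfolding span_singleton by blast
qed

section \<open>The Poincare-Cartan form in an induced chart\<close>

lemma pd_truncate:
  "pd (\<gamma>, i) (\<lambda>w. g (truncate k w)) z = (if \<gamma> \<le> k then pd (\<gamma>, i) g (truncate k z) else 0)"
proof -
  have "truncate k (z((\<gamma>, i) := s)) =
      (if \<gamma> \<le> k then (truncate k z)((\<gamma>, i) := s) else truncate k z)" for s
    by (auto simp: truncate_def fun_eq_iff)
  moreover have "truncate k z (\<gamma>, i) = z (\<gamma>, i)" if "\<gamma> \<le> k" using that by (simp add: truncate_def)
  ultimately show ?thesis unfolding pd_def by auto
qed

lemma smooth_truncate:
  fixes g :: "'n::finite pt \<Rightarrow> real"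
  assumes g: "smooth_fun (idx k) V g" and W: "box_open (idx r) W" "truncate k ` W \<subseteq> V"
  shows "smooth_fun (idx r) W (\<lambda>z. g (truncate k z))"
proof (rule smooth_fun_coinduct[where P = "\<lambda>h. \<exists>g. smooth_fun (idx k) V g \<and> h = (\<lambda>z. g (truncate k z))",
      OF W(1)], goal_cases)
  case 1 then show ?case using g by blast
next
  case (2 h)
  then obtain g where h: "smooth_fun (idx k) V g" "h = (\<lambda>z. g (truncate k z))" by blast
  have "continuous_on W (truncate k)"
  proof (rule continuous_on_coordinatewise_then_product)
    fix a :: "nat \<times> 'n"
    obtain \<gamma> i where "a = (\<gamma>, i)" by force
    then show "continuous_on W (\<lambda>z. truncate k z a)"
      by (cases "\<gamma> \<le> k") (auto simp: truncate_def intro: continuous_on_subset[OF continuous_on_product_coordinates])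
  qed
  then show ?case unfolding h(2)
    using continuous_on_compose2[OF smooth_fun_continuous[OF h(1)] _ W(2)] by blast
next
  case (3 h z c)
  then obtain g where h: "smooth_fun (idx k) V g" "h = (\<lambda>z. g (truncate k z))" by blast
  obtain \<gamma> i where c: "c = (\<gamma>, i)" by force
  have upd: "truncate k (z(c := s)) =
      (if \<gamma> \<le> k then (truncate k z)(c := s) else truncate k z)" for s
    by (auto simp: c truncate_def fun_eq_iff)
  show ?case
  proof (cases "\<gamma> \<le> k")
    case True
    have "truncate k z c = z c" "truncate k z \<in> V" using True W(2) 3(2) by (auto simp: c truncate_def)
    then show ?thesis
      using smooth_fun_differentiable[OF h(1), of "truncate k z" c] True by (simp add: h(2) upd[unfolded c] c)
  next
    case False then show ?thesis by (simp add: h(2) upd)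
  qed
next
  case (4 h c)
  then obtain g where h: "smooth_fun (idx k) V g" "h = (\<lambda>z. g (truncate k z))" by blast
  obtain \<gamma> i where c: "c = (\<gamma>, i)" by force
  show ?case
  proof (cases "\<gamma> \<le> k")
    case True
    have "smooth_fun (idx k) V (pd c g)" using smooth_fun_pd[OF h(1)] True by (simp add: c)
    moreover have "pd c h z = pd c g (truncate k z)" for z
      using True unfolding h(2) c pd_truncate by simp
    ultimately show ?thesis by blast
  next
    case False
    have "smooth_fun (idx k) V (\<lambda>w. 0)"
      unfolding smooth_fun_def
    proof (intro allI impI)
      fix cs :: "(nat \<times> 'n) list"
      have "foldr pd cs (\<lambda>w. 0) = (\<lambda>w. 0)" by (induction cs) (simp_all add: pd_def fun_eq_iff[of "pd _ _"])
      then show "continuous_on V (foldr pd cs (\<lambda>w. 0)) \<and> (\<forall>z\<in>V. \<forall>c\<in>idx k.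
          (\<lambda>s. foldr pd cs (\<lambda>w. 0) (z(c := s))) differentiable at (z c))" by simp
    qed
    moreover have "\<forall>z\<in>W. pd c h z = 0"
      using False unfolding h(2) c pd_truncate by simp
    ultimately show ?thesis by blast
  qed
qed

text \<open>Each application of \<open>J\<close> raises the order of a coordinate field by one.\<close>

lemma d_J_order:
  assumes "\<And>\<gamma> i. k < \<gamma> \<Longrightarrow> \<gamma> \<le> r \<Longrightarrow> pd (\<gamma>, i) f z = 0" "k < \<alpha> + \<beta>"
  shows "d_J r \<alpha> f z (\<beta>, i) = 0"
proof -
  have J: "(tangent_J r ^^ \<alpha>) (\<lambda>a. if a = (\<beta>, i) then 1 else 0) (\<gamma>, j) = 0" if "\<gamma> \<noteq> \<alpha> + \<beta>" for \<gamma> j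
    using that by (induction \<alpha> arbitrary: \<gamma>) (auto simp: tangent_J_def)
  have "pd a f z * (tangent_J r ^^ \<alpha>) (\<lambda>a. if a = (\<beta>, i) then 1 else 0) a = 0" if "a \<in> idx r" for a
  proof -
    obtain \<gamma> j where a: "a = (\<gamma>, j)" "\<gamma> \<le> r" using \<open>a \<in> idx r\<close> by (cases a) auto
    show ?thesis using J[of \<gamma> j] assms(1)[of \<gamma> j] assms(2) a by (cases "\<gamma> = \<alpha> + \<beta>") auto
  qed
  then show ?thesis unfolding d_J_def by (rule sum.neutral[rule_format])
qed

context jet_patch
begin

text \<open>A Lie derivative along a semispray raises the order of a semibasic form by at most one, since
  \<open>y\<^sup>\<beta>\<close> with \<open>\<beta> > s\<close> occurs only in components of the semispray of order at least \<open>s\<close>.\<close>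

lemma lie_form_iterate_semibasic:
  assumes Y: "\<And>z \<gamma> i. z \<in> W \<Longrightarrow> \<gamma> < r \<Longrightarrow> Y z (\<gamma>, i) = real (\<gamma> + 1) * z (\<gamma> + 1, i)"
    and \<eta>: "\<And>z \<beta> i. z \<in> W \<Longrightarrow> s \<le> \<beta> \<Longrightarrow> \<beta> \<le> r \<Longrightarrow> \<eta> z (\<beta>, i) = 0"
    and z: "z \<in> W" and \<beta>: "s + m \<le> \<beta>" "\<beta> \<le> r"
  shows "((lie_form r Y ^^ m) \<eta>) z (\<beta>, i) = 0"
  using z \<beta>
proof (induction m arbitrary: z \<beta> i)
  case 0 then show ?case using \<eta> by simp
next
  case (Suc m)
  let ?\<theta> = "(lie_form r Y ^^ m) \<eta>"
  have \<theta>: "?\<theta> w (\<gamma>, j) = 0" if "w \<in> W" "s + m \<le> \<gamma>" "\<gamma> \<le> r" for w \<gamma> j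
    by (rule Suc.IH) (use that in auto)
  have "Y z a * pd a (\<lambda>w. ?\<theta> w (\<beta>, i)) z + ?\<theta> z a * pd (\<beta>, i) (\<lambda>w. Y w a) z = 0"
    if "a \<in> idx r" for a
  proof -
    obtain \<gamma> j where a: "a = (\<gamma>, j)" "\<gamma> \<le> r" using \<open>a \<in> idx r\<close> by (cases a) auto
    have "pd a (\<lambda>w. ?\<theta> w (\<beta>, i)) z = pd a (\<lambda>w. 0) z"
      unfolding a(1) by (rule pd_cong_W[OF Suc.prems(1) a(2)]) (use \<theta> Suc.prems in auto)
    moreover have "?\<theta> z a * pd (\<beta>, i) (\<lambda>w. Y w a) z = 0"
    proof (cases "s + m \<le> \<gamma>")
      case True then show ?thesis using \<theta>[OF Suc.prems(1)] a by simp
    next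
      case False
      then have \<gamma>: "\<gamma> < r" "\<gamma> + 1 \<noteq> \<beta>" using Suc.prems by auto
      have "pd (\<beta>, i) (\<lambda>w. Y w a) z = pd (\<beta>, i) (\<lambda>w. real (\<gamma> + 1) * w (\<gamma> + 1, j)) z"
        unfolding a(1) by (rule pd_cong_W[OF Suc.prems(1,3)]) (rule Y[OF _ \<gamma>(1)])
      also have "\<dots> = real (\<gamma> + 1) * pd (\<beta>, i) (\<lambda>w. w (\<gamma> + 1, j)) z"
        by (rule pd_cmult[OF box smooth_coord Suc.prems(1)]) (use Suc.prems in auto)
      also have "\<dots> = 0" using \<gamma>(2) by (simp add: pd_coord)
      finally show ?thesis by simp
    qed
    ultimately show ?thesis by simp
  qed
  then have "lie_form r Y ?\<theta> z (\<beta>, i) = 0"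
    unfolding lie_form_def[of r Y ?\<theta> z "(\<beta>, i)"] by (rule sum.neutral[rule_format])
  then show ?case by simp
qed

lemma lie_fun_iterate_zero:
  assumes "\<And>z. z \<in> W \<Longrightarrow> g z = 0" "z \<in> W"
  shows "((lie_fun r Y ^^ m) g) z = 0"
  using assms(2)
proof (induction m arbitrary: z)
  case (Suc m)
  have "pd a ((lie_fun r Y ^^ m) g) z = pd a (\<lambda>w. 0) z" if "a \<in> idx r" for a
    by (rule pd_cong[OF box Suc.prems that]) (rule Suc.IH)
  then have "lie_fun r Y ((lie_fun r Y ^^ m) g) z = 0"
    unfolding lie_fun_def[of r Y "(lie_fun r Y ^^ m) g" z] by simp
  then show ?case by simp
qed (use assms in simp)

end

context poincare_cartan
begin

text \<open>The factor \<open>F\<^sup>2\<^sup>k\<^sup>-\<^sup>1\<close> in the tensor \<open>h\<close> is nonzero and does not change the kernel of the Hessian.\<close>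

theorem form_rank_iff_rank_h:
  assumes z: "z \<in> W" and y: "z (1, j0) \<noteq> 0" and pos: "f z \<noteq> 0"
  shows "form_rank r (ext_d \<theta>) z = 2 * k * (CARD('n) - 1) \<longleftrightarrow>
    rank (h_matrix k f z) = CARD('n) - 1"
proof -
  define w where "w m = (if m = 0 then X z else liouville r m z)" for m
  interpret F: antitriangular_form r "ext_d \<theta> z" "\<lambda>i j. pd (k, i) (pd (k, j) f) z" w "\<lambda>i. z (1, i)" j0
  proof
    show "ext_d \<theta> z a b = - ext_d \<theta> z b a" for a b by (simp add: ext_d_def)
    show "ext_d \<theta> z (\<alpha>, i) (\<beta>, j) = 0" if "\<alpha> \<le> r" "\<beta> \<le> r" "r < \<alpha> + \<beta>" for \<alpha> \<beta> i j
      by (rule ext_d_low[OF z that])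
    show "\<exists>c. c \<noteq> 0 \<and> (\<forall>i j. ext_d \<theta> z (\<alpha>, i) (r - \<alpha>, j) = c * pd (k, i) (pd (k, j) f) z)"
      if "\<alpha> \<le> r" for \<alpha> using ext_d_antidiagonal[OF z that] by metis
    show "pd (k, i) (pd (k, j) f) z = pd (k, j) (pd (k, i) f) z" for i j
      by (rule pd_commute[OF box finite_idx smooth_f z]) (use k_le_r in auto)
    show "(\<Sum>a\<in>idx r. w m a * ext_d \<theta> z a b) = 0" if "m \<le> r" "b \<in> idx r" for m b
      using semispray_kernel[OF z that(2)] liouville_kernel[OF z that(2), of m] that(1)
      by (auto simp: w_def contr2_def)
    show "w m (\<gamma>, i) = 0" if "m \<le> r" "\<gamma> < m" for m \<gamma> i
      using that by (auto simp: w_def liouville_apply)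
    show "w m (m, i) = z (1, i)" if "m \<le> r" for m i
      using that semispray[OF z, of 0 i] r_pos by (auto simp: w_def liouville_apply)
    show "z (1, j0) \<noteq> 0" by (rule y)
  qed
  let ?y = "\<chi> i. z (1, i)"
  have h: "(h_matrix k f z *v v) $ j = f z ^ (2 * k - 1) * (\<Sum>i\<in>UNIV. pd (k, j) (pd (k, i) f) z * v $ i)" for v j
    by (simp add: h_matrix_def matrix_vector_mult_def sum_distrib_left mult.assoc)
  have ker: "h_matrix k f z *v v = 0 \<longleftrightarrow> (\<forall>j. (\<Sum>i\<in>UNIV. pd (k, j) (pd (k, i) f) z * v $ i) = 0)" for v
    using pos by (simp add: vec_eq_iff h)
  have "?y \<noteq> 0" using y by (auto simp: vec_eq_iff)
  moreover have "h_matrix k f z *v ?y = 0" unfolding ker using F.H_y by simp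
  ultimately have "rank (h_matrix k f z) = CARD('n) - 1 \<longleftrightarrow>
      (\<forall>v. h_matrix k f z *v v = 0 \<longrightarrow> (\<exists>s. v = s *\<^sub>R ?y))"
    by (rule rank_eq_pred_iff)
  then have "rank (h_matrix k f z) = CARD('n) - 1 \<longleftrightarrow>
      (\<forall>v. (\<forall>j. (\<Sum>i\<in>UNIV. pd (k, j) (pd (k, i) f) z * v $ i) = 0) \<longrightarrow> (\<exists>s. v = s *\<^sub>R ?y))"
    unfolding ker .
  also have "\<dots> \<longleftrightarrow> (\<forall>v. (\<forall>j. (\<Sum>i\<in>UNIV. pd (k, j) (pd (k, i) f) z * v i) = 0) \<longrightarrow>
      (\<exists>s. \<forall>i. v i = s * z (1, i)))" (is "?l \<longleftrightarrow> ?r")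
  proof
    assume l: ?l
    show ?r
    proof (intro allI impI)
      fix v assume "\<forall>j. (\<Sum>i\<in>UNIV. pd (k, j) (pd (k, i) f) z * v i) = 0"
      then obtain s where "(\<chi> i. v i) = s *\<^sub>R ?y" using l[rule_format, of "\<chi> i. v i"] by auto
      then show "\<exists>s. \<forall>i. v i = s * z (1, i)" by (auto simp: vec_eq_iff)
    qed
  next
    assume r: ?r
    show ?l
    proof (intro allI impI)
      fix v :: "real ^ 'n" assume "\<forall>j. (\<Sum>i\<in>UNIV. pd (k, j) (pd (k, i) f) z * v $ i) = 0"
      then obtain s where "\<forall>i. v $ i = s * z (1, i)" using r[rule_format, of "\<lambda>i. v $ i"] by auto
      then show "\<exists>s. v = s *\<^sub>R ?y" by (auto simp: vec_eq_iff)
    qed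
  qed
  also have "\<dots> \<longleftrightarrow> form_rank r (ext_d \<theta>) z = (r + 1) * (CARD('n) - 1)"
    by (rule F.form_rank_maximal_iff[symmetric]) simp
  finally show ?thesis using rk by simp
qed

end

context smooth_manifold
begin

lemma jet_patch_chart: "ch \<in> A \<Longrightarrow> jet_patch r (jet_range r ch)"
  by (standard, rule box_open_jet_range)

lemma semispray_components:
  assumes S: "semispray A r S" and ch: "ch \<in> A" and r: "1 \<le> r"
  shows "a \<in> idx r \<Longrightarrow> smooth_fun (idx r) (jet_range r ch) (\<lambda>z. vloc A r ch S z a)"
    and "z \<in> jet_range r ch \<Longrightarrow> \<gamma> < r \<Longrightarrow> vloc A r ch S z (\<gamma>, i) = real (\<gamma> + 1) * z (\<gamma> + 1, i)"
proof -
  show "a \<in> idx r \<Longrightarrow> smooth_fun (idx r) (jet_range r ch) (\<lambda>z. vloc A r ch S z a)"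
    using S ch unfolding semispray_def vector_field_def jimg_eq[OF ch r, symmetric] by blast
  assume z: "z \<in> jet_range r ch" and \<gamma>: "\<gamma> < r"
  have "(\<gamma> + 1, i) \<in> idx r" using \<gamma> by simp
  then have "tangent_J r (vloc A r ch S z) (\<gamma> + 1, i) = liouville r 1 z (\<gamma> + 1, i)"
    using S ch z unfolding semispray_def jimg_eq[OF ch r, symmetric] by blast
  then show "vloc A r ch S z (\<gamma>, i) = real (\<gamma> + 1) * z (\<gamma> + 1, i)"
    using \<gamma> by (simp add: tangent_J_def liouville_apply)
qed

text \<open>The \<open>\<alpha>\<close>-th summand of \<open>\<theta>\<close> has components of order below \<open>k + 1 - \<alpha>\<close> before the \<open>\<alpha> - 1\<close> Lie derivatives
  are taken, and hence below \<open>k\<close> afterwards. Zermelo conditions with \<open>\<alpha> > k\<close> hold because such a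
  Liouville field has no components of order up to \<open>k\<close>.\<close>

lemma chart_poincare_cartan:
  fixes F :: "'a jet \<Rightarrow> real"
  assumes k: "k \<ge> 1" and F_smooth: "smooth_T0 A k F" and F_zermelo: "zermelo A k F"
    and S: "semispray A (2 * k - 1) S" and S': "semispray A (2 * k - 1) S'"
    and S_eq: "\<forall>ch\<in>A. \<forall>z\<in>jimg A (2 * k - 1) ch. \<forall>b\<in>idx (2 * k - 1).
       lie_form (2 * k - 1) (vloc A (2 * k - 1) ch S) (theta_F A k S' F ch) z b
         = pd b (floc A (2 * k - 1) ch (pull A k F)) z"
    and ch: "ch \<in> A"
  shows "poincare_cartan (2 * k - 1) (jet_range (2 * k - 1) ch) k
    (floc A (2 * k - 1) ch (pull A k F)) (vloc A (2 * k - 1) ch S) (theta_F A k S' F ch)"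
proof -
  define r where "r = 2 * k - 1"
  have r: "1 \<le> r" "k \<le> r" "Suc r = 2 * k" using k by (auto simp: r_def)
  define W where "W = jet_range r ch"
  define f where "f = floc A r ch (pull A k F)"
  define g where "g = floc A k ch F"
  interpret P: jet_patch r W unfolding W_def by (rule jet_patch_chart[OF ch])
  have fg: "f z = g (truncate k z)" if "z \<in> W" for z
    using floc_pull[OF ch k r(2)] that by (simp add: f_def g_def W_def)
  have trunc: "truncate k ` W \<subseteq> jet_range k ch" by (simp add: W_def truncate_jet_range[OF k r(2)])
  have "smooth_fun (idx k) (jet_range k ch) g"
    using F_smooth[unfolded smooth_T0_def, rule_format, OF ch] by (simp add: jimg_eq[OF ch k] g_def)
  from smooth_truncate[OF this P.box trunc] have smg: "P.smooth (\<lambda>z. g (truncate k z))" .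
  then have smf: "P.smooth f" by (rule P.smooth_cong) (simp add: fg)
  have pdf: "pd (\<gamma>, i) f z = (if \<gamma> \<le> k then pd (\<gamma>, i) g (truncate k z) else 0)"
    if "z \<in> W" "\<gamma> \<le> r" for z \<gamma> i
    using P.pd_cong_W[OF that, of f "\<lambda>z. g (truncate k z)" i] fg by (simp add: pd_truncate)
  have zer: "P.L \<alpha> f z = (if \<alpha> = 1 then f z else 0)" if z: "z \<in> W" and \<alpha>: "1 \<le> \<alpha>" "\<alpha> \<le> r" for z \<alpha>
  proof -
    have "P.L \<alpha> f z = (\<Sum>\<gamma>\<le>r. \<Sum>i\<in>UNIV. real (\<gamma> + 1 - \<alpha>) * z (\<gamma> + 1 - \<alpha>, i) *
        (if \<gamma> \<le> k then pd (\<gamma>, i) g (truncate k z) else 0))"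
      unfolding P.L_eq by (intro sum.cong refl) (simp add: pdf[OF z])
    also have "\<dots> = (\<Sum>\<gamma>\<le>k. \<Sum>i\<in>UNIV. real (\<gamma> + 1 - \<alpha>) * z (\<gamma> + 1 - \<alpha>, i) *
        (if \<gamma> \<le> k then pd (\<gamma>, i) g (truncate k z) else 0))"
      by (rule sum.mono_neutral_right) (use r in auto)
    also have "\<dots> = lie_fun k (liouville k \<alpha>) g (truncate k z)"
      unfolding lie_fun_def sum_idx
      by (intro sum.cong refl) (use \<alpha>(1) in \<open>auto simp: liouville_apply truncate_def\<close>)
    finally have L: "P.L \<alpha> f z = lie_fun k (liouville k \<alpha>) g (truncate k z)" .
    have tz: "truncate k z \<in> jimg A k ch" using trunc z jimg_eq[OF ch k] by auto
    show ?thesis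
    proof (cases "\<alpha> \<le> k")
      case True
      then show ?thesis using F_zermelo ch tz \<alpha>(1) L fg[OF z] unfolding zermelo_def g_def by auto
    next
      case False
      have "lie_fun k (liouville k \<alpha>) g (truncate k z) = 0"
        unfolding lie_fun_def sum_idx by (intro sum.neutral ballI) (use False in \<open>auto simp: liouville_apply\<close>)
      then show ?thesis using L False k by simp
    qed
  qed
  have semibasic: "theta_F A k S' F ch z (\<beta>, i) = 0" if "z \<in> W" "k \<le> \<beta>" "\<beta> \<le> r" for z \<beta> i
  proof -
    have "((lie_form r (vloc A r ch S') ^^ (\<alpha> - 1)) (d_J r \<alpha> f)) z (\<beta>, i) = 0" if "\<alpha> \<in> {1..k}" for \<alpha>
    proof (rule P.lie_form_iterate_semibasic[where s = "k + 1 - \<alpha>"])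
      show "vloc A r ch S' z (\<gamma>, i) = real (\<gamma> + 1) * z (\<gamma> + 1, i)" if "z \<in> W" "\<gamma> < r" for z \<gamma> i
        using semispray_components(2)[of r S' ch] S' ch r that by (simp add: r_def W_def)
      show "d_J r \<alpha> f z (\<beta>, i) = 0" if "z \<in> W" "k + 1 - \<alpha> \<le> \<beta>" "\<beta> \<le> r" for z \<beta> i
        by (rule d_J_order[of k]) (use pdf that \<open>\<alpha> \<in> {1..k}\<close> in auto)
    qed (use \<open>z \<in> W\<close> \<open>k \<le> \<beta>\<close> \<open>\<beta> \<le> r\<close> \<open>\<alpha> \<in> {1..k}\<close> in auto)
    then show ?thesis unfolding theta_F_def Let_def r_def[symmetric] f_def[symmetric] by simp
  qed
  have "poincare_cartan r W k f (vloc A r ch S) (theta_F A k S' F ch)"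
  proof (standard, goal_cases)
    case 1 show ?case by (rule r)
  next
    case 2 show ?case by (rule smf)
  next
    case 3 then show ?case by (simp add: pdf)
  next
    case 4 then show ?case by (rule zer)
  next
    case 5 then show ?case
      using semispray_components(1)[of r S ch] S ch r by (simp add: r_def W_def)
  next
    case 6 then show ?case
      using semispray_components(2)[of r S ch] S ch r by (simp add: r_def W_def)
  next
    case 7 then show ?case by (rule semibasic)
  next
    case (8 z b) then show ?case
      using S_eq[folded r_def, rule_format, OF ch, of z b] by (simp add: jimg_eq[OF ch r(1)] f_def W_def)
  qed
  then show ?thesis by (simp add: r_def W_def f_def)
qed

lemma h_matrix_truncate:
  assumes ch: "ch \<in> A" and k: "1 \<le> k" "k \<le> r" and z: "z \<in> jet_range r ch"
  shows "h_matrix k (floc A r ch (pull A k F)) z = h_matrix k (floc A k ch F) (truncate k z)"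
proof -
  interpret P: jet_patch r "jet_range r ch" by (rule jet_patch_chart[OF ch])
  let ?f = "floc A r ch (pull A k F)" and ?g = "floc A k ch F"
  have 1: "pd (k, j) ?f w = pd (k, j) ?g (truncate k w)" if "w \<in> jet_range r ch" for w j
    using P.pd_cong_W[OF that k(2), of ?f "\<lambda>w. ?g (truncate k w)" j] floc_pull[OF ch k]
    by (simp add: pd_truncate)
  have "pd (k, i) (pd (k, j) ?f) z = pd (k, i) (pd (k, j) ?g) (truncate k z)" for i j
    using P.pd_cong_W[OF z k(2), of "pd (k, j) ?f" "\<lambda>w. pd (k, j) ?g (truncate k w)" i] 1
    by (simp add: pd_truncate)
  then show ?thesis by (simp add: h_matrix_def floc_pull[OF ch k z])
qed

lemma floc_positive:
  assumes "\<forall>p\<in>T0 A k. F p > 0" and ch: "ch \<in> A" and k: "1 \<le> k" and z: "z \<in> jet_range k ch"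
  shows "floc A k ch F z > 0"
proof -
  have "z \<in> icoord k ch ` jdom A k ch" using z jimg_eq[OF ch k] by (simp add: jimg_def)
  then have "jinv A k ch z \<in> jdom A k ch" unfolding jinv_def by (rule inv_into_into)
  then show ?thesis using assms(1) by (simp add: floc_def jdom_def)
qed

end

theorem lemma4p3:
  fixes A :: "('a::{t2_space, second_countable_topology}, 'n::finite) chart set"
    and k :: nat
    and F :: "'a jet \<Rightarrow> real"
    and S S' :: "'a vfield"
  assumes atlas: "smooth_atlas A"
    and k: "k \<ge> 1"
    and F_smooth: "smooth_T0 A k F"
    and F_pos: "\<forall>p\<in>T0 A k. F p > 0"
    and F_zermelo: "zermelo A k F"
    and S: "semispray A (2 * k - 1) S"
    and S': "semispray A (2 * k - 1) S'"
    and S_eq: "\<forall>ch\<in>A. \<forall>z\<in>jimg A (2 * k - 1) ch. \<forall>b\<in>idx (2 * k - 1).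
       lie_form (2 * k - 1) (vloc A (2 * k - 1) ch S) (theta_F A k S' F ch) z b
         = pd b (floc A (2 * k - 1) ch (pull A k F)) z"
  shows
    "\<comment> \<open>(i)\<close>
     (\<forall>\<alpha>\<in>{1..2 * k - 1}. \<forall>ch\<in>A. \<forall>z\<in>jimg A (2 * k - 1) ch.
        contr (2 * k - 1) (liouville (2 * k - 1) \<alpha>) (theta_F A k S' F ch) z = 0 \<and>
        (\<forall>b\<in>idx (2 * k - 1).
           lie_form (2 * k - 1) (liouville (2 * k - 1) \<alpha>) (theta_F A k S' F ch) z b = 0))
     \<and> \<comment> \<open>(ii)\<close>
     (\<forall>ch\<in>A. \<forall>z\<in>jimg A (2 * k - 1) ch.
        contr (2 * k - 1) (vloc A (2 * k - 1) ch S) (theta_F A k S' F ch) z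
          = floc A (2 * k - 1) ch (pull A k F) z \<and>
        energy_F A k S' F ch z = 0 \<and>
        (\<forall>\<alpha>\<in>{1..2 * k - 1}. \<forall>b\<in>idx (2 * k - 1).
           contr2 (2 * k - 1) (liouville (2 * k - 1) \<alpha>) (omega_F A k S' F ch) z b = 0))
     \<and> \<comment> \<open>(iii)\<close>
     (finsler_function A k F \<longleftrightarrow>
        (\<forall>ch\<in>A. \<forall>z\<in>jimg A (2 * k - 1) ch.
           form_rank (2 * k - 1) (ext_d (theta_F A k S' F ch)) z = 2 * k * (CARD('n) - 1)))"
proof -
  interpret smooth_manifold A by (standard; rule atlas)
  define r where "r = 2 * k - 1"
  have r: "1 \<le> r" "k \<le> r" using k by (auto simp: r_def)
  note img = jimg_eq[OF _ r(1)]
  have PC: "poincare_cartan r (jet_range r ch) k (floc A r ch (pull A k F)) (vloc A r ch S)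
      (theta_F A k S' F ch)" if "ch \<in> A" for ch
    unfolding r_def by (rule chart_poincare_cartan[OF k F_smooth F_zermelo S S' S_eq that])
  have i: "contr r (liouville r \<alpha>) (theta_F A k S' F ch) z = 0"
      "\<forall>b\<in>idx r. lie_form r (liouville r \<alpha>) (theta_F A k S' F ch) z b = 0"
    if "\<alpha> \<in> {1..r}" "ch \<in> A" "z \<in> jet_range r ch" for \<alpha> ch z
    using poincare_cartan.contr_liouville[OF PC[OF that(2)]] poincare_cartan.contraction_zero[OF PC[OF that(2)]]
      poincare_cartan.lie_form_liouville_zero[OF PC[OF that(2)]] that by simp_all
  have ii: "contr r (vloc A r ch S) (theta_F A k S' F ch) z = floc A r ch (pull A k F) z"
    if "ch \<in> A" "z \<in> jet_range r ch" for ch z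
    using poincare_cartan.contr_semispray[OF PC[OF that(1)]] poincare_cartan.contraction_0[OF PC[OF that(1)]] that by simp
  have omega: "contr2 r (liouville r \<alpha>) (omega_F A k S' F ch) z b = 0"
    if "ch \<in> A" "z \<in> jet_range r ch" "\<alpha> \<in> {1..r}" "b \<in> idx r" for ch z \<alpha> b
    using poincare_cartan.liouville_kernel[OF PC[OF that(1)] that(2,4), of \<alpha>] that(3)
    by (simp add: contr2_def omega_F_def sum_negf)
  have energy: "energy_F A k S' F ch z = 0" if "ch \<in> A" "z \<in> jet_range r ch" for ch z
  proof -
    interpret poincare_cartan r "jet_range r ch" k "floc A r ch (pull A k F)" "vloc A r ch S"
      "theta_F A k S' F ch" by (rule PC[OF that(1)])
    let ?f = "floc A r ch (pull A k F)" and ?X = "vloc A r ch S'"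
    have *: "lie_fun r (liouville r \<alpha>) ?f w = (if \<alpha> = 1 then ?f w else 0)"
      if "w \<in> jet_range r ch" "\<alpha> \<in> {1..k}" for w \<alpha>
      using zermelo[OF that(1), of \<alpha>] that(2) r by (simp add: L_def)
    have "(-1) ^ (\<alpha> - 1) / fact \<alpha> * ((lie_fun r ?X ^^ (\<alpha> - 1)) (lie_fun r (liouville r \<alpha>) ?f)) z
        = (if \<alpha> = 1 then ?f z else 0)" if \<alpha>: "\<alpha> \<in> {1..k}" for \<alpha>
    proof (cases "\<alpha> = 1")
      case True then show ?thesis using *[OF \<open>z \<in> jet_range r ch\<close> \<alpha>] by simp
    next
      case False
      then show ?thesis
        using lie_fun_iterate_zero[of "lie_fun r (liouville r \<alpha>) ?f" z "\<alpha> - 1" ?X] * \<alpha> \<open>z \<in> jet_range r ch\<close>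
        by simp
    qed
    then have "(\<Sum>\<alpha>=1..k. (-1) ^ (\<alpha> - 1) / fact \<alpha> *
        ((lie_fun r ?X ^^ (\<alpha> - 1)) (lie_fun r (liouville r \<alpha>) ?f)) z)
      = (\<Sum>\<alpha>=1..k. if \<alpha> = 1 then ?f z else 0)" by (intro sum.cong refl)
    also have "\<dots> = ?f z" using k by simp
    finally show ?thesis unfolding energy_F_def Let_def r_def[symmetric] by simp
  qed
  have rank: "form_rank r (ext_d (theta_F A k S' F ch)) z = 2 * k * (CARD('n) - 1) \<longleftrightarrow>
      rank (h_matrix k (floc A k ch F) (truncate k z)) = CARD('n) - 1"
    if "ch \<in> A" "z \<in> jet_range r ch" for ch z
  proof -
    have "\<exists>j0. z (1, j0) \<noteq> 0" using that(2) by (auto simp: jet_range_def)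
    then obtain j0 where "z (1, j0) \<noteq> 0" by blast
    moreover have "truncate k z \<in> jet_range k ch"
      using that(2) truncate_jet_range[OF k r(2), symmetric, of ch] by simp
    then have "floc A r ch (pull A k F) z \<noteq> 0"
      using floc_positive[OF F_pos that(1) k] floc_pull[OF that(1) k r(2) that(2), of F] by fastforce
    ultimately show ?thesis
      using poincare_cartan.form_rank_iff_rank_h[OF PC[OF that(1)] that(2)] h_matrix_truncate[OF that(1) k r(2) that(2)] by simp
  qed
  have iii: "finsler_function A k F \<longleftrightarrow> (\<forall>ch\<in>A. \<forall>z\<in>jet_range r ch.
      form_rank r (ext_d (theta_F A k S' F ch)) z = 2 * k * (CARD('n) - 1))"
  proof -
    have "finsler_function A k F \<longleftrightarrow> (\<forall>ch\<in>A. \<forall>z\<in>jet_range k ch.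
        rank (h_matrix k (floc A k ch F) z) = CARD('n) - 1)"
      using F_smooth F_pos F_zermelo jimg_eq[OF _ k] by (simp add: finsler_function_def)
    also have "\<dots> \<longleftrightarrow> (\<forall>ch\<in>A. \<forall>z\<in>jet_range r ch.
        rank (h_matrix k (floc A k ch F) (truncate k z)) = CARD('n) - 1)"
      by (simp add: truncate_jet_range[OF k r(2), symmetric])
    finally show ?thesis using rank by simp
  qed
  show ?thesis
    unfolding r_def[symmetric] using i ii energy omega iii by (simp add: img)
qed

end
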